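(* Let $\alpha,\beta$ be compositions and $n$ be a positive integer. Then $$\mathbf{s}_{\alpha/\beta}\cdot\mathbf{s}_{(n)}=\sum_{i+j=n}(-1)^j\,\mathbf{s}_{\alpha^+/\beta^-},$$ where the sum is over all integers $i,j\ge0$ with $i+j=n$, all compositions $\alpha^+$ such that $\alpha^+$ can be obtained by adding an $i$-right horizontal strip to $\alpha$, and all compositions $\beta^-$ such that $\beta$ can be obtained by adding a $j$-right vertical strip to $\beta^-$. Similarly, $$\mathbf{s}_{\alpha/\beta}\cdot\mathbf{s}_{(1^n)}=\sum_{i+j=n}(-1)^j\,\mathbf{s}_{\alpha^+/\beta^-},$$ where the sum is over all integers $i,j\ge0$ with $i+j=n$, all compositions $\alpha^+$ such that $\alpha^+$ can be obtained by adding an $i$-right vertical strip to $\alpha$, and all compositions $\beta^-$ such that $\beta$ can be obtained by adding a $j$-right horizontal strip to $\beta^-$.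
   Context: **Compositions.** A weak composition is a finite list of nonnegative integers; a composition is a finite list of positive integers (the empty composition $\emptyset$ is allowed). For $\alpha=(\alpha_1,\dots,\alpha_\ell)$ the $\alpha_i$ are its parts and its size is $|\alpha|=\sum\alpha_i$; $(1^n)$ is the composition with $n$ parts equal to $1$. The diagram of $\alpha$ is the array of left-justified boxes with $\alpha_i$ boxes in row $i$ from the top. For compositions $\beta,\gamma$, $\beta\gamma$ is the concatenation and $\beta\odot\gamma$ is the near-concatenation (the last part of $\beta$ and the first part of $\gamma$ are added together). For a subset $S=\{s_1<\cdots<s_m\}\subseteq[N-1]$ let $\mathrm{comp}(S)=(s_1,s_2-s_1,\dots,N-s_m)$, with $\mathrm{comp}(\emptyset)=(N)$ for $N\ge1$; for $\alpha=(\alpha_1,\dots,\alpha_\ell)$ let $\mathrm{set}(\alpha)=\{\alpha_1,\alpha_1+\alpha_2,\dots,\alpha_1+\cdots+\alpha_{\ell-1}\}$. **Adding right strips.** For $i\ge1$ and a weak composition $\alpha=(\alpha_1,\dots,\alpha_\ell)$: $\mathfrak{d}_i(\alpha)$ is obtained by subtracting $1$ from the rightmost part of $\alpha$ equal to $i$, and $\mathfrak{d}_i(\alpha)=0$ (not a valid weak composition, and all operators send $0$ to $0$) if there is no such part; $a_i(\alpha)=(\alpha_1,\dots,\alpha_\ell,i)$; and $\mathfrak{u}_i=a_i\,\mathfrak{d}_1\mathfrak{d}_2\cdots\mathfrak{d}_{i-1}$ (so $\mathfrak{u}_1=a_1$). Products of operators are compositions of maps, the rightmost acting first. For positive integers $i_1<\cdots<i_k$,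 if $\mathfrak{u}_{i_k}\cdots\mathfrak{u}_{i_1}(\alpha)$ is a valid weak composition, it is said to be obtained by adding a $k$-right horizontal strip to $\alpha$. For positive integers $i_1\ge\cdots\ge i_k$, if $\mathfrak{u}_{i_k}\cdots\mathfrak{u}_{i_1}(\alpha)$ is a valid weak composition, it is said to be obtained by adding a $k$-right vertical strip to $\alpha$. Adding a $0$-strip of either kind leaves $\alpha$ unchanged. Convention: any parts equal to $0$ that arise are ignored, i.e. a resulting weak composition is replaced by the composition obtained by deleting its zeros. Each composition $\alpha^+$ (resp. $\beta^-$) satisfying the stated condition is counted once. **Quasisymmetric functions.** $\mathrm{QSym}\subset\mathbb{C}[[x_1,x_2,\dots]]$ is the graded Hopf algebra with basis the fundamental quasisymmetric functions $F_\emptyset=1$ and $F_\alpha=\sum x_{i_1}\cdots x_{i_{|\alpha|}}$, summed over $i_1\le\cdots\le i_{|\alpha|}$ with $i_j<i_{j+1}$ if $j\in\mathrm{set}(\alpha)$. The product is that of power series, and the coproduct is $\Delta(1)=1\otimes1$ and $\Delta(F_\alpha)=\sum F_\beta\otimes F_\gamma$ over all $(\beta,\gamma)$ with $\beta\gamma=\alpha$ or $\beta\odot\gamma=\alpha$. **Quasisymmetric Schur functions.** For a composition $\alpha=(\alpha_1,\dots,\alpha_\ell)$ set $\mathfrak{t}_1(\alpha)=(1,\alpha_1,\dots,\alpha_\ell)$, and for $i\ge2$ let $\mathfrak{t}_i(\alpha)$ be obtained from $\alpha$ by adding $1$ to the leftmost part equal to $i-1$ (undefined if there is no such part). Write $\beta\lessdot_c\alpha$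 iff $\alpha=\mathfrak{t}_i(\beta)$ for some $i\ge1$; this is the cover relation of the composition poset. A standard composition tableau of shape $\alpha$, $|\alpha|=N$, is obtained from a saturated chain $\emptyset=\alpha^0\lessdot_c\alpha^1\lessdot_c\cdots\lessdot_c\alpha^N=\alpha$ by putting the number $N-k+1$ in the box of the diagram of $\alpha$ that is added in passing from $\alpha^{k-1}$ to $\alpha^k$ (where $\mathfrak{t}_1$ adds a new top row consisting of one box, and $\mathfrak{t}_i$ with $i\geq 2$ adds a box in column $i$). Its descent set is $\mathrm{Des}(\tau)=\{i:i+1\text{ appears weakly right of }i\}\subseteq[N-1]$ (comparison of columns), and $\mathrm{comp}(\tau)=\mathrm{comp}(\mathrm{Des}(\tau))$. The quasisymmetric Schur function is $\mathcal{S}_\alpha=\sum_\tau F_{\mathrm{comp}(\tau)}$ over all standard composition tableaux $\tau$ of shape $\alpha$, with $\mathcal{S}_\emptyset=1$; the $\mathcal{S}_\alpha$ form a basis of $\mathrm{QSym}$. **Noncommutative (skew) Schur functions.** $\mathrm{NSym}$ is the graded Hopf algebra dual to $\mathrm{QSym}$, with pairing $\langle\ ,\ \rangle:\mathrm{QSym}\otimes\mathrm{NSym}\to\mathbb{C}$; its product is dual to the coproduct of $\mathrm{QSym}$ and its coproduct $\Delta$ is dual to the product of $\mathrm{QSym}$, i.e. $\langle\Delta(f),s\otimes t\rangle=\langle f,s\cdot t\rangle$ and $\langle f\otimes g,\Delta(s)\rangle=\langle f\cdot g,s\rangle$. The noncommutative Schur functions $\mathbf{s}_\beta$ are the basis of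 $\mathrm{NSym}$ dual to the $\mathcal{S}_\alpha$: $\langle\mathcal{S}_\alpha,\mathbf{s}_\beta\rangle=\delta_{\alpha\beta}$. The skew noncommutative Schur functions $\mathbf{s}_{\alpha/\beta}$ (for all compositions $\alpha,\beta$) are defined implicitly by $$\Delta(\mathbf{s}_\alpha)=\sum_\beta\mathbf{s}_{\alpha/\beta}\otimes\mathbf{s}_\beta,$$ the sum over all compositions $\beta$. *)

theory Defs
  imports Complex_Main "HOL-Library.Multiset" "HOL-Library.Function_Algebras"
begin

section \<open>Compositions\<close>

text \<open>Weak compositions are arbitrary lists of natural numbers.\<close>

definition compositions :: "nat list set" where
  "compositions = {\<alpha>. 0 \<notin> set \<alpha>}"

definition near_concat :: "nat list \<Rightarrow> nat list \<Rightarrow> nat list" where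
  "near_concat \<beta> \<gamma> = butlast \<beta> @ [last \<beta> + hd \<gamma>] @ tl \<gamma>"

text \<open>The composition of \<open>N\<close> with partial sums \<open>S \<subseteq> {1..N-1}\<close>, and the set of proper partial
  sums of a composition.\<close>

definition comp_of_set :: "nat \<Rightarrow> nat set \<Rightarrow> nat list" where
  "comp_of_set N S =
     (if N = 0 then []
      else let s = sorted_list_of_set S in map (\<lambda>(a, b). b - a) (zip (0 # s) (s @ [N])))"

definition set_of_comp :: "nat list \<Rightarrow> nat set" where
  "set_of_comp \<alpha> = {sum_list (take k \<alpha>) |k. 1 \<le> k \<and> k < length \<alpha>}"


section \<open>Right strips\<close>

text \<open>\<open>None\<close> is the invalid value \<open>0\<close> of the operators.\<close>

definition op_d :: "nat \<Rightarrow> nat list \<Rightarrow> nat list option" where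
  "op_d i \<alpha> =
     (if i \<in> set \<alpha>
      then Some (\<alpha>[(GREATEST k. k < length \<alpha> \<and> \<alpha> ! k = i) := i - 1])
      else None)"

definition op_a :: "nat \<Rightarrow> nat list \<Rightarrow> nat list" where
  "op_a i \<alpha> = \<alpha> @ [i]"

text \<open>\<open>u\<^sub>i = a\<^sub>i d\<^sub>1 d\<^sub>2 \<dots> d\<^bsub>i-1\<^esub>\<close>, with \<open>d\<^bsub>i-1\<^esub>\<close> acting first.\<close>

definition op_u :: "nat \<Rightarrow> nat list \<Rightarrow> nat list option" where
  "op_u i \<alpha> =
     map_option (op_a i) (foldr (\<lambda>k x. Option.bind x (op_d k)) [1..<i] (Some \<alpha>))"

text \<open>\<open>u\<^bsub>i\<^sub>k\<^esub> \<dots> u\<^bsub>i\<^sub>1\<^esub>\<close> for the list \<open>[i\<^sub>1, \<dots>, i\<^sub>k]\<close>, whose head acts first.\<close>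

definition op_us :: "nat list \<Rightarrow> nat list \<Rightarrow> nat list option" where
  "op_us is \<alpha> = fold (\<lambda>i x. Option.bind x (op_u i)) is (Some \<alpha>)"

text \<open>In the next two predicates the zero parts of the resulting weak composition are deleted.\<close>

definition right_horizontal_strip :: "nat \<Rightarrow> nat list \<Rightarrow> nat list \<Rightarrow> bool" where
  "right_horizontal_strip k \<alpha> \<gamma> \<longleftrightarrow>
     (\<exists>is \<delta>. length is = k \<and> (\<forall>i\<in>set is. 1 \<le> i) \<and> sorted_wrt (<) is \<and>
        op_us is \<alpha> = Some \<delta> \<and> \<gamma> = filter (\<lambda>p. p \<noteq> 0) \<delta>)"

definition right_vertical_strip :: "nat \<Rightarrow> nat list \<Rightarrow> nat list \<Rightarrow> bool" where
  "right_vertical_strip k \<alpha> \<gamma> \<longleftrightarrow>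
     (\<exists>is \<delta>. length is = k \<and> (\<forall>i\<in>set is. 1 \<le> i) \<and> sorted_wrt (\<ge>) is \<and>
        op_us is \<alpha> = Some \<delta> \<and> \<gamma> = filter (\<lambda>p. p \<noteq> 0) \<delta>)"


section \<open>Complex-valued functions as a vector space\<close>

text \<open>Power series, the elements of the graded dual, and their tensor products are all
  represented as complex-valued functions; addition is pointwise.\<close>

definition cscale :: "complex \<Rightarrow> ('a \<Rightarrow> complex) \<Rightarrow> ('a \<Rightarrow> complex)" where
  "cscale c f = (\<lambda>x. c * f x)"

interpretation cfun: vector_space cscale
  by unfold_locales (auto simp: cscale_def fun_eq_iff algebra_simps)

definition tensor :: "('a \<Rightarrow> complex) \<Rightarrow> ('b \<Rightarrow> complex) \<Rightarrow> ('a \<times> 'b \<Rightarrow> complex)" where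
  "tensor f g = (\<lambda>(x, y). f x * g y)"


section \<open>Quasisymmetric functions\<close>

text \<open>A monomial in the variables \<open>x\<^sub>1, x\<^sub>2, \<dots>\<close> is a multiset of variable indices, with
  \<open>k :: nat\<close> standing for \<open>x\<^bsub>k+1\<^esub>\<close>; a power series is its coefficient function.\<close>

type_synonym pseries = "nat multiset \<Rightarrow> complex"

definition pseries_mult :: "pseries \<Rightarrow> pseries \<Rightarrow> pseries" where
  "pseries_mult f g = (\<lambda>m. \<Sum>(a, b) \<in> {(a, b). a + b = m}. f a * g b)"

text \<open>List positions start at \<open>0\<close>, so the condition at \<open>j\<close> reads \<open>i\<^sub>j < i\<^bsub>j+1\<^esub>\<close>.\<close>

definition fundamental :: "nat list \<Rightarrow> pseries" where
  "fundamental \<alpha> = (\<lambda>m. of_nat (card {is. length is = sum_list \<alpha> \<and> sorted is \<and>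
       (\<forall>j\<in>set_of_comp \<alpha>. is ! (j - 1) < is ! j) \<and> mset is = m}))"

definition QSym :: "pseries set" where
  "QSym = cfun.span (fundamental ` compositions)"

text \<open>The coefficient of \<open>fundamental \<alpha>\<close> in the expansion of \<open>f \<in> QSym\<close>.\<close>

definition fundamental_coeff :: "pseries \<Rightarrow> nat list \<Rightarrow> complex" where
  "fundamental_coeff f \<alpha> =
     cfun.representation (fundamental ` compositions) f (fundamental \<alpha>)"

definition deconcat :: "nat list \<Rightarrow> (nat list \<times> nat list) set" where
  "deconcat \<alpha> = {(\<beta>, \<gamma>). \<beta> \<in> compositions \<and> \<gamma> \<in> compositions \<and>
     (\<beta> @ \<gamma> = \<alpha> \<or> (\<beta> \<noteq> [] \<and> \<gamma> \<noteq> [] \<and> near_concat \<beta> \<gamma> = \<alpha>))}"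

text \<open>The linear extension of
  \<open>fundamental \<alpha> \<mapsto> \<Sum> fundamental \<beta> \<otimes> fundamental \<gamma>\<close>; the tensor square of \<open>QSym\<close> is
  realised inside the power series in two alphabets.\<close>

definition qsym_coproduct :: "pseries \<Rightarrow> (nat multiset \<times> nat multiset \<Rightarrow> complex)" where
  "qsym_coproduct f =
     (\<Sum>\<alpha> | \<alpha> \<in> compositions \<and> fundamental_coeff f \<alpha> \<noteq> 0.
        cscale (fundamental_coeff f \<alpha>)
          (\<Sum>(\<beta>, \<gamma>)\<in>deconcat \<alpha>. tensor (fundamental \<beta>) (fundamental \<gamma>)))"


section \<open>Quasisymmetric Schur functions\<close>

definition leftmost :: "nat \<Rightarrow> nat list \<Rightarrow> nat" where
  "leftmost p \<alpha> = (LEAST k. k < length \<alpha> \<and> \<alpha> ! k = p)"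

text \<open>Only used for \<open>i \<ge> 1\<close>.\<close>

definition op_t :: "nat \<Rightarrow> nat list \<Rightarrow> nat list option" where
  "op_t i \<alpha> =
     (if i = 1 then Some (1 # \<alpha>)
      else if i - 1 \<in> set \<alpha> then Some (\<alpha>[leftmost (i - 1) \<alpha> := i])
      else None)"

text \<open>A filling is the list of its rows from top to bottom. \<open>fill_box i \<beta> v T\<close> puts \<open>v\<close> into the
  box by which \<open>op_t i\<close> enlarges the shape \<open>\<beta>\<close> of \<open>T\<close>.\<close>

definition fill_box :: "nat \<Rightarrow> nat list \<Rightarrow> nat \<Rightarrow> nat list list \<Rightarrow> nat list list" where
  "fill_box i \<beta> v T =
     (if i = 1 then [v] # T
      else let r = leftmost (i - 1) \<beta> in T[r := T ! r @ [v]])"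

text \<open>\<open>chain_filling N \<beta> T\<close>: the filling \<open>T\<close> of shape \<open>\<beta>\<close> arises from a saturated chain from the
  empty composition to \<open>\<beta>\<close> in the composition poset, where the \<open>k\<close>-th step inserts
  \<open>N - k + 1\<close>; in the step from \<open>\<beta>\<close> we have \<open>k - 1 = sum_list \<beta>\<close>.\<close>

inductive chain_filling :: "nat \<Rightarrow> nat list \<Rightarrow> nat list list \<Rightarrow> bool" for N where
  empty: "chain_filling N [] []"
| step: "chain_filling N \<beta> T \<Longrightarrow> 1 \<le> i \<Longrightarrow> op_t i \<beta> = Some \<alpha> \<Longrightarrow>
    chain_filling N \<alpha> (fill_box i \<beta> (N - sum_list \<beta>) T)"

definition SCT :: "nat list \<Rightarrow> nat list list set" where
  "SCT \<alpha> = {T. chain_filling (sum_list \<alpha>) \<alpha> T}"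

definition column :: "nat list list \<Rightarrow> nat \<Rightarrow> nat" where
  "column T v = (THE c. \<exists>r < length T. c < length (T ! r) \<and> T ! r ! c = v)"

definition Des :: "nat list list \<Rightarrow> nat set" where
  "Des T = {i. 1 \<le> i \<and> i < length (concat T) \<and> column T i \<le> column T (i + 1)}"

definition comp_tableau :: "nat list list \<Rightarrow> nat list" where
  "comp_tableau T = comp_of_set (length (concat T)) (Des T)"

definition qschur :: "nat list \<Rightarrow> pseries" where
  "qschur \<alpha> = (\<Sum>T\<in>SCT \<alpha>. fundamental (comp_tableau T))"


section \<open>Noncommutative symmetric functions\<close>

text \<open>The graded dual of \<open>QSym\<close>: linear functionals on \<open>QSym\<close> that vanish in all but finitely
  many degrees, extended by \<open>0\<close> outside \<open>QSym\<close>. The pairing of \<open>f\<close> with \<open>s\<close> is \<open>s f\<close>.\<close>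

definition NSym :: "(pseries \<Rightarrow> complex) set" where
  "NSym = {s. (\<forall>f\<in>QSym. \<forall>g\<in>QSym. s (f + g) = s f + s g) \<and>
              (\<forall>c. \<forall>f\<in>QSym. s (cscale c f) = c * s f) \<and>
              (\<forall>f. f \<notin> QSym \<longrightarrow> s f = 0) \<and>
              (\<exists>N. \<forall>\<alpha>\<in>compositions. N \<le> sum_list \<alpha> \<longrightarrow> s (fundamental \<alpha>) = 0)}"

text \<open>The value of \<open>s \<otimes> t\<close> on the tensor square of \<open>QSym\<close>: apply \<open>t\<close> in the second alphabet and
  \<open>s\<close> in the first, so that \<open>tensor f g\<close> is sent to \<open>s f * t g\<close>.\<close>

definition tensor_pairing ::
  "(nat multiset \<times> nat multiset \<Rightarrow> complex) \<Rightarrow> (pseries \<Rightarrow> complex) \<Rightarrow> (pseries \<Rightarrow> complex) \<Rightarrow> complex"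
  where "tensor_pairing P s t = s (\<lambda>m. t (\<lambda>m'. P (m, m')))"

definition nsym_mult ::
  "(pseries \<Rightarrow> complex) \<Rightarrow> (pseries \<Rightarrow> complex) \<Rightarrow> (pseries \<Rightarrow> complex)" where
  "nsym_mult s t = (\<lambda>f. if f \<in> QSym then tensor_pairing (qsym_coproduct f) s t else 0)"

text \<open>The tensor square of \<open>NSym\<close> is realised inside the functions on pairs of series, an element
  being determined by its pairings with the tensors of \<open>f\<close> and \<open>g\<close> in \<open>QSym\<close>.\<close>

definition nsym_coproduct :: "(pseries \<Rightarrow> complex) \<Rightarrow> (pseries \<times> pseries \<Rightarrow> complex)" where
  "nsym_coproduct s =
     (\<lambda>(f, g). if f \<in> QSym \<and> g \<in> QSym then s (pseries_mult f g) else 0)"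

definition nschur :: "nat list \<Rightarrow> (pseries \<Rightarrow> complex)" where
  "nschur \<beta> = (THE s. s \<in> NSym \<and>
     (\<forall>\<alpha>\<in>compositions. s (qschur \<alpha>) = (if \<alpha> = \<beta> then 1 else 0)))"

text \<open>The family of skew functions is determined by the expansion of the coproduct of
  \<open>nschur \<alpha>\<close>, a sum with finitely many nonzero terms. Values at lists that are not
  compositions are fixed to be \<open>0\<close> for uniqueness.\<close>

definition skew_nschur :: "nat list \<Rightarrow> nat list \<Rightarrow> (pseries \<Rightarrow> complex)" where
  "skew_nschur \<alpha> = (THE t.
     (\<forall>\<beta>\<in>compositions. t \<beta> \<in> NSym) \<and> (\<forall>\<beta>. \<beta> \<notin> compositions \<longrightarrow> t \<beta> = 0) \<and>
     finite {\<beta>. t \<beta> \<noteq> 0} \<and>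
     nsym_coproduct (nschur \<alpha>) = (\<Sum>\<beta> | t \<beta> \<noteq> 0. tensor (t \<beta>) (nschur \<beta>)))"

end

theory Submission imports Defs begin

text \<open>
  A standard composition tableau is a word \<open>c\<^sub>1 \<dots> c\<^sub>N\<close> of columns with
  \<open>t\<^bsub>c\<^sub>N\<^esub> \<dots> t\<^bsub>c\<^sub>1\<^esub>(\<emptyset>) = \<beta>\<close>, and its descent composition only depends on the positions where
  the word ascends. The left operators \<open>t\<^sub>k\<close> and the right operators \<open>u\<^sub>i\<close> satisfy
  \<open>t\<^sub>k u\<^sub>i = u\<^sub>i t\<^sub>k\<close>, except that \<open>t\<^bsub>i+1\<^esub> u\<^sub>i \<alpha> = u\<^bsub>i+1\<^esub> t\<^sub>i \<alpha>\<close> if \<open>\<alpha>\<close> has no part \<open>i\<close>. These are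
  jeu de taquin moves: passing a word of left steps through a word of right steps is a
  bijection that keeps the ascent pattern of both words. Since strips added to the empty
  composition from the left and from the right agree, cutting off the end of the descent
  pattern of \<open>\<S>\<^sub>\<beta>\<close> amounts to removing a right strip from \<open>\<beta>\<close>, which is dual to the right Pieri rules.

  Let \<open>H\<^sub>n f\<close> be the coefficient of the \<open>n\<close>-th power of a last variable in \<open>f\<close>, and let \<open>E\<^sub>n\<close> be its analogue
  for \<open>(1\<^sup>n)\<close>; these operators are dual to right multiplication by \<open>s\<^bsub>(n)\<^esub>\<close> and \<open>s\<^bsub>(1\<^sup>n)\<^esub>\<close>. From
  \<open>H\<^sub>n(fg) = \<Sum> H\<^sub>i f \<cdot> H\<^bsub>n-i\<^esub> g\<close> and \<open>\<Sum> (-1)\<^sup>j H\<^bsub>n-j\<^esub> E\<^sub>j = 0 = \<Sum> (-1)\<^sup>j E\<^bsub>n-j\<^esub> H\<^sub>j\<close> for \<open>n > 0\<close> one gets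
  \<open>\<Sum> (-1)\<^sup>j H\<^bsub>n-j\<^esub>(g \<cdot> E\<^sub>j f) = H\<^sub>n g \<cdot> f\<close> and the same with \<open>H\<close> and \<open>E\<close> exchanged. The skew function
  \<open>s\<^bsub>\<alpha>/\<beta>\<^esub>\<close> is the functional \<open>g \<mapsto> s\<^sub>\<alpha>(g \<cdot> \<S>\<^sub>\<beta>)\<close>, so with \<open>f = \<S>\<^sub>\<beta>\<close> this is the claim.
\<close>

section \<open>Exchanging the left and right box-adding operators\<close>

text \<open>The exceptional exchange relabels two steps, so it might turn an ascent of a word into a
  non-ascent. It cannot: it happens only when a certain part is missing, and this excludes exactly
  the neighbouring labels for which a comparison would change. Both operators replace one part k - 1
  by k in the multiset of parts; hence one condition decides whether either is defined, and the
  partial operators can be replaced by total ones. The same count shows that the endpoints of a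
  right path fix the multiset of its letters, so a strip carries only one monotone word and enters
  each sum once. The product rule is proved for H, where it is a statement about coefficients; the
  identity with H and E exchanged comes from inverting the first one. Both the fundamental and the
  quasisymmetric Schur functions are triangular when evaluated at one test monomial for each
  composition. This identifies QSym with the quasisymmetric series of bounded degree, hence with a
  ring, and yields both bases at once.\<close>

fun dec_last :: "nat \<Rightarrow> nat list \<Rightarrow> nat list" where
  "dec_last i [] = []"
| "dec_last i (a # \<alpha>) =
     (if i \<in> set \<alpha> then a # dec_last i \<alpha> else if a = i then (i - 1) # \<alpha> else a # \<alpha>)"

fun inc_first :: "nat \<Rightarrow> nat list \<Rightarrow> nat list" where
  "inc_first k [] = []"
| "inc_first k (a # \<alpha>) = (if a = k - 1 then k # \<alpha> else a # inc_first k \<alpha>)"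

fun dec_chain :: "nat \<Rightarrow> nat list \<Rightarrow> nat list" where
  "dec_chain 0 \<alpha> = \<alpha>"
| "dec_chain (Suc n) \<alpha> = dec_chain n (dec_last (Suc n) \<alpha>)"

abbreviation drop_zeros :: "nat list \<Rightarrow> nat list" where
  "drop_zeros \<equiv> filter ((<) 0)"

definition addL :: "nat \<Rightarrow> nat list \<Rightarrow> nat list" where
  "addL k \<alpha> = (if k = 1 then 1 # \<alpha> else inc_first k \<alpha>)"

text \<open>Zeros are deleted at every step, so that paths stay within compositions;
  \<open>op_us_path\<close> reconciles this with a single deletion at the end.\<close>

definition addR :: "nat \<Rightarrow> nat list \<Rightarrow> nat list" where
  "addR i \<alpha> = drop_zeros (dec_chain (i - 1) \<alpha> @ [i])"

text \<open>One condition for both sides: u_c is defined as soon as its first decrement d_{c-1} is,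
  because each decrement creates the part that the next one takes.\<close>

definition addable :: "nat \<Rightarrow> nat list \<Rightarrow> bool" where
  "addable c \<alpha> \<longleftrightarrow> c = 1 \<or> (2 \<le> c \<and> c - 1 \<in> set \<alpha>)"

lemma dec_last_split: "i \<notin> set ys \<Longrightarrow> dec_last i (xs @ i # ys) = xs @ (i - 1) # ys"
  by (induction xs) auto

lemma inc_first_split: "k - 1 \<notin> set xs \<Longrightarrow> inc_first k (xs @ (k - 1) # ys) = xs @ k # ys"
  by (induction xs) auto

lemma op_d_eq: "op_d i \<alpha> = (if i \<in> set \<alpha> then Some (dec_last i \<alpha>) else None)"
proof (cases "i \<in> set \<alpha>")
  case True
  then obtain xs ys where \<alpha>: "\<alpha> = xs @ i # ys" "i \<notin> set ys"
    by (meson split_list_last)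
  have "(GREATEST k. k < length \<alpha> \<and> \<alpha> ! k = i) = length xs"
  proof (rule Greatest_equality)
    show "length xs < length \<alpha> \<and> \<alpha> ! length xs = i" using \<alpha> by simp
    fix y assume y: "y < length \<alpha> \<and> \<alpha> ! y = i"
    show "y \<le> length xs"
    proof (rule ccontr)
      assume "\<not> y \<le> length xs"
      then have "\<alpha> ! y = ys ! (y - Suc (length xs))" "y - Suc (length xs) < length ys"
        using \<alpha> y by (auto simp: nth_append nth_Cons')
      then show False using y \<alpha> by (metis nth_mem)
    qed
  qed
  then show ?thesis using \<alpha> by (simp add: op_d_def dec_last_split)
qed (simp add: op_d_def)

lemma leftmost_split: "p \<notin> set xs \<Longrightarrow> leftmost p (xs @ p # ys) = length xs"
  unfolding leftmost_def
proof (rule Least_equality)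
  fix y assume "p \<notin> set xs" "y < length (xs @ p # ys) \<and> (xs @ p # ys) ! y = p"
  then show "length xs \<le> y"
    by (metis leI nth_append nth_mem)
qed simp

lemma op_t_eq:
  assumes "1 \<le> k"
  shows "op_t k \<alpha> = (if addable k \<alpha> then Some (addL k \<alpha>) else None)"
proof (cases "k \<noteq> 1 \<and> k - 1 \<in> set \<alpha>")
  case True
  then obtain xs ys where \<alpha>: "\<alpha> = xs @ (k - 1) # ys" "k - 1 \<notin> set xs"
    by (meson split_list_first)
  then show ?thesis
    using True assms leftmost_split[of "k - 1" xs ys] inc_first_split[of k xs ys]
    by (simp add: op_t_def addable_def addL_def)
qed (use assms in \<open>auto simp: op_t_def addable_def addL_def\<close>)

lemma count_dec_last:
  "i \<in> set \<alpha> \<Longrightarrow> mset (dec_last i \<alpha>) = mset \<alpha> - {#i#} + {#i - 1#}"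
proof -
  assume "i \<in> set \<alpha>"
  then obtain xs ys where "\<alpha> = xs @ i # ys" "i \<notin> set ys"
    by (meson split_list_last)
  then show ?thesis by (simp add: dec_last_split)
qed

text \<open>One part n is carried down to 0, since each decrement leaves what the next one looks
  for. The position that is lowered may change along the way, but the multiset does not
  notice.\<close>

lemma mset_dec_chain:
  "n = 0 \<or> n \<in> set \<alpha> \<Longrightarrow> mset (dec_chain n \<alpha>) = (if n = 0 then mset \<alpha> else mset \<alpha> - {#n#} + {#0#})"
proof (induction n arbitrary: \<alpha>)
  case (Suc n)
  have m: "mset (dec_last (Suc n) \<alpha>) = mset \<alpha> - {#Suc n#} + {#n#}"
    using Suc.prems count_dec_last[of "Suc n" \<alpha>] by simp
  then have "n \<in> set (dec_last (Suc n) \<alpha>)"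
    by (metis add_mset_add_single set_mset_mset union_single_eq_member)
  then show ?case using Suc.IH[of "dec_last (Suc n) \<alpha>"] m by (cases "n = 0") simp_all
qed simp

lemma mset_addL:
  "addable k \<alpha> \<Longrightarrow> mset (addL k \<alpha>) = (if k = 1 then mset \<alpha> else mset \<alpha> - {#k - 1#}) + {#k#}"
proof (cases "k = 1")
  case False
  moreover assume "addable k \<alpha>"
  ultimately have "k - 1 \<in> set \<alpha>" by (simp add: addable_def)
  then obtain xs ys where "\<alpha> = xs @ (k - 1) # ys" "k - 1 \<notin> set xs"
    by (meson split_list_first)
  then show ?thesis using False inc_first_split[of k xs ys] by (simp add: addL_def)
qed (simp add: addL_def)

text \<open>The right-hand side is that of \<open>mset_addL\<close>: on multisets of parts the two
  operators coincide. All questions of definedness below therefore become questions about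
  counts.\<close>

lemma mset_addR:
  assumes "addable i \<alpha>" "\<alpha> \<in> compositions"
  shows "mset (addR i \<alpha>) = (if i = 1 then mset \<alpha> else mset \<alpha> - {#i - 1#}) + {#i#}"
proof -
  have "drop_zeros \<alpha> = \<alpha>"
    using assms(2) by (auto simp: compositions_def filter_id_conv intro: gr0I)
  then have "filter_mset ((<) 0) (mset \<alpha>) = mset \<alpha>"
    by (metis mset_filter)
  moreover have "mset (dec_chain (i - 1) \<alpha>) = (if i = 1 then mset \<alpha> else mset \<alpha> - {#i - 1#} + {#0#})"
    using assms mset_dec_chain[of "i - 1" \<alpha>] by (auto simp: addable_def)
  ultimately show ?thesis using assms(1)
    by (auto simp: addR_def addable_def)
qed

lemma addL_compositions: "addable k \<alpha> \<Longrightarrow> \<alpha> \<in> compositions \<Longrightarrow> addL k \<alpha> \<in> compositions"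
  using arg_cong[OF mset_addL, of k \<alpha> set_mset]
  by (auto simp: compositions_def addable_def dest: in_diffD split: if_splits)

lemma addR_compositions: "addR k \<alpha> \<in> compositions"
  by (simp add: addR_def compositions_def)

text \<open>Each side carries a correction term, so that removing a part k - 1 involves no
  subtraction of natural numbers.\<close>

lemma count_moved:
  fixes M :: "nat multiset"
  assumes "M' = (if k = 1 then M else M - {#k - 1#}) + {#k#}" "k = 1 \<or> (2 \<le> k \<and> k - 1 \<in># M)" "1 \<le> c"
  shows "count M' c + (if c + 1 = k then 1 else 0) = count M c + (if c = k then 1 else 0)"
proof (cases "k = 1")
  case False
  then have "2 \<le> k" "1 \<le> count M (k - 1)" using assms(2) by auto
  then show ?thesis using assms(1,3) by auto
qed (use assms in simp)

lemma count_addL: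
  "addable k \<alpha> \<Longrightarrow> 1 \<le> c \<Longrightarrow> count (mset (addL k \<alpha>)) c + (if c + 1 = k then 1 else 0)
    = count (mset \<alpha>) c + (if c = k then 1 else 0)"
  by (rule count_moved[OF mset_addL]) (auto simp: addable_def)

lemma count_addR:
  "addable k \<alpha> \<Longrightarrow> \<alpha> \<in> compositions \<Longrightarrow> 1 \<le> c \<Longrightarrow>
    count (mset (addR k \<alpha>)) c + (if c + 1 = k then 1 else 0)
    = count (mset \<alpha>) c + (if c = k then 1 else 0)"
  by (rule count_moved[OF mset_addR]) (auto simp: addable_def)

lemma in_set_countI: "0 < count (mset \<alpha>) c \<Longrightarrow> c \<in> set \<alpha>"
  by simp

section \<open>Commuting decrements with a left step\<close>

lemma set_dec_last_other: "r \<in> set \<alpha> \<Longrightarrow> c \<noteq> r \<Longrightarrow> c \<noteq> r - 1 \<Longrightarrow> c \<in> set (dec_last r \<alpha>) \<longleftrightarrow> c \<in> set \<alpha>"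
  by (induction \<alpha>) auto

lemma set_inc_first_other: "c \<noteq> k \<Longrightarrow> c \<noteq> k - 1 \<Longrightarrow> c \<in> set (inc_first k \<alpha>) \<longleftrightarrow> c \<in> set \<alpha>"
  by (induction \<alpha>) auto

lemma dec_last_absent: "r \<notin> set \<alpha> \<Longrightarrow> dec_last r \<alpha> = \<alpha>"
  by (induction \<alpha>) auto

lemma dec_last_inc_first_other:
  "r \<noteq> k \<Longrightarrow> r \<noteq> k - 1 \<Longrightarrow> 1 \<le> r \<Longrightarrow> 1 \<le> k \<Longrightarrow> inc_first k (dec_last r \<alpha>) = dec_last r (inc_first k \<alpha>)"
proof (induction \<alpha>)
  case (Cons a \<alpha>)
  then show ?case using set_inc_first_other[of r k \<alpha>] by auto
qed simp

text \<open>The k that is created is the only one, hence also the rightmost.\<close>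

lemma dec_last_inc_first_cancel:
  "k \<notin> set \<alpha> \<Longrightarrow> k - 1 \<in> set \<alpha> \<Longrightarrow> dec_last k (inc_first k \<alpha>) = \<alpha>"
proof -
  assume *: "k \<notin> set \<alpha>" "k - 1 \<in> set \<alpha>"
  then obtain xs ys where "\<alpha> = xs @ (k - 1) # ys" "k - 1 \<notin> set xs"
    by (meson split_list_first)
  then show ?thesis using * inc_first_split[of k xs ys] dec_last_split[of k ys xs] by simp
qed

text \<open>Two parts k - 1 are enough for the leftmost one, which is raised, and the rightmost one,
  which is lowered, to be different.\<close>

lemma dec_last_inc_first_twice:
  "2 \<le> k \<Longrightarrow> 2 \<le> count (mset \<alpha>) (k - 1) \<Longrightarrow>
    inc_first k (dec_last (k - 1) \<alpha>) = dec_last (k - 1) (inc_first k \<alpha>)"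
proof (induction \<alpha>)
  case (Cons a \<alpha>)
  show ?case
  proof (cases "a = k - 1")
    case True
    then have "k - 1 \<in> set \<alpha>" using Cons.prems by (intro in_set_countI) simp
    then show ?thesis using True Cons.prems by auto
  next
    case False
    then have c: "2 \<le> count (mset \<alpha>) (k - 1)" using Cons.prems by auto
    then have "k - 1 \<in> set \<alpha>" by (intro in_set_countI) linarith
    moreover have "k - 1 \<in> set (inc_first k \<alpha>)"
      using c mset_addL[of k \<alpha>] \<open>k - 1 \<in> set \<alpha>\<close> Cons.prems(1)
      by (intro in_set_countI) (simp add: addL_def addable_def del: count_greater_zero_iff)
    ultimately show ?thesis using False Cons c by auto
  qed
qed simp

lemma in_set_dec_last_pred: "i \<in> set \<alpha> \<Longrightarrow> i - 1 \<in> set (dec_last i \<alpha>)"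
  by (induction \<alpha>) auto

lemma in_set_inc_first: "k - 1 \<in> set \<alpha> \<Longrightarrow> k \<in> set (inc_first k \<alpha>)"
  by (induction \<alpha>) auto

text \<open>If k and k - 1 both occur, t_k commutes with d_k: either they act on different parts, or
  each restores what the other changed. After d_k there are at least two parts k - 1, so t_k and
  d_{k-1} act in different places.\<close>

lemma dec_last_inc_first_pair:
  "2 \<le> k \<Longrightarrow> k \<in> set \<alpha> \<Longrightarrow> k - 1 \<in> set \<alpha> \<Longrightarrow>
    inc_first k (dec_last (k - 1) (dec_last k \<alpha>)) = dec_last (k - 1) (dec_last k (inc_first k \<alpha>))"
proof (induction \<alpha>)
  case (Cons a \<alpha>)
  consider (both) "k \<in> set \<alpha>" "k - 1 \<in> set \<alpha>" | (k) "k \<in> set \<alpha>" "k - 1 \<notin> set \<alpha>"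
    | (pred) "k \<notin> set \<alpha>" "k - 1 \<in> set \<alpha>" | (none) "k \<notin> set \<alpha>" "k - 1 \<notin> set \<alpha>"
    by blast
  then show ?case
  proof cases
    case both
    have "k - 1 \<in> set (dec_last k \<alpha>)" "k \<in> set (inc_first k \<alpha>)"
      using both by (simp_all only: in_set_dec_last_pred in_set_inc_first)
    moreover from this have "k - 1 \<in> set (dec_last k (inc_first k \<alpha>))"
      by (simp only: in_set_dec_last_pred)
    ultimately show ?thesis using both Cons.IH[OF Cons.prems(1) both] by simp
  next
    case k
    then have "k - 1 \<in> set (dec_last k \<alpha>)" by (simp only: in_set_dec_last_pred)
    then show ?thesis using k Cons.prems by auto
  next
    case pred
    then have "k \<in> set (inc_first k \<alpha>)" "dec_last k (inc_first k \<alpha>) = \<alpha>"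
      by (blast intro: in_set_inc_first dec_last_inc_first_cancel)+
    then show ?thesis using pred Cons.prems by auto
  next
    case none
    then show ?thesis using Cons.prems by auto
  qed
qed simp

lemma dec_chain_inc_first_below:
  "2 \<le> k \<Longrightarrow> n < k - 1 \<Longrightarrow> inc_first k (dec_chain n \<alpha>) = dec_chain n (inc_first k \<alpha>)"
proof (induction n arbitrary: \<alpha>)
  case (Suc n)
  then show ?case using dec_last_inc_first_other[of "Suc n" k \<alpha>] by simp
qed simp

text \<open>The chain lowers parts above k, which do not concern t_k, then the pair k and k - 1,
  then parts below k - 1. That a part k is present when the pair is reached is inherited from the
  part n.\<close>

lemma dec_chain_inc_first_above:
  "2 \<le> k \<Longrightarrow> k \<le> n \<Longrightarrow> n \<in> set \<alpha> \<Longrightarrow> k - 1 \<in> set \<alpha> \<Longrightarrow>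
    inc_first k (dec_chain n \<alpha>) = dec_chain n (inc_first k \<alpha>)"
proof (induction n arbitrary: \<alpha>)
  case (Suc n)
  show ?case
  proof (cases "k = Suc n")
    case True
    then obtain m where n: "n = Suc m" using Suc.prems by (cases n) auto
    have "inc_first k (dec_chain m (dec_last n (dec_last k \<alpha>)))
        = dec_chain m (inc_first k (dec_last n (dec_last k \<alpha>)))"
      using Suc.prems True n by (intro dec_chain_inc_first_below) auto
    also have "\<dots> = dec_chain m (dec_last n (dec_last k (inc_first k \<alpha>)))"
      using dec_last_inc_first_pair[of k \<alpha>] Suc.prems True by simp
    finally show ?thesis using True n by simp
  next
    case False
    then have "n \<in> set (dec_last (Suc n) \<alpha>)" "k - 1 \<in> set (dec_last (Suc n) \<alpha>)"
      using Suc.prems in_set_dec_last_pred[of "Suc n" \<alpha>] set_dec_last_other[of "Suc n" \<alpha> "k - 1"]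
      by auto
    then show ?thesis using Suc False dec_last_inc_first_other[of "Suc n" k \<alpha>] by simp
  qed
qed simp

lemma dec_chain_Cons: "n = 0 \<or> n \<in> set \<alpha> \<Longrightarrow> dec_chain n (a # \<alpha>) = a # dec_chain n \<alpha>"
proof (induction n arbitrary: \<alpha>)
  case (Suc n)
  then show ?case using in_set_dec_last_pred[of "Suc n" \<alpha>] by simp
qed simp

lemma inc_first_append: "k - 1 \<in> set xs \<Longrightarrow> inc_first k (xs @ ys) = inc_first k xs @ ys"
  by (induction xs) auto

lemma inc_first_drop_zeros: "2 \<le> k \<Longrightarrow> inc_first k (drop_zeros xs) = drop_zeros (inc_first k xs)"
  by (induction xs) auto

lemma addL_drop_zeros: "1 \<le> k \<Longrightarrow> addL k (drop_zeros xs) = drop_zeros (addL k xs)"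
  using inc_first_drop_zeros[of k xs] by (auto simp: addL_def)

lemma addable_ge1: "addable c \<alpha> \<Longrightarrow> 1 \<le> c"
  by (auto simp: addable_def)

lemma addable_count: "addable c \<alpha> \<longleftrightarrow> c = 1 \<or> (2 \<le> c \<and> 0 < count (mset \<alpha>) (c - 1))"
  by (simp add: addable_def)

lemma addable_addL:
  assumes "addable k \<alpha>"
  shows "addable c (addL k \<alpha>) \<longleftrightarrow>
    c = 1 \<or> (2 \<le> c \<and> (if c = k then 1 else 0) < count (mset \<alpha>) (c - 1) + (if c = Suc k then 1 else 0))"
proof (cases "2 \<le> c")
  case True
  then have "1 \<le> c - 1" "c - 1 + 1 = c" "c - 1 = k \<longleftrightarrow> c = Suc k" by auto
  then show ?thesis using True count_addL[OF assms, of "c - 1"]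
    unfolding addable_count by (auto split: if_splits simp del: count_greater_zero_iff)
qed (auto simp: addable_def)

lemma addable_addR:
  assumes "addable k \<alpha>" "\<alpha> \<in> compositions"
  shows "addable c (addR k \<alpha>) \<longleftrightarrow>
    c = 1 \<or> (2 \<le> c \<and> (if c = k then 1 else 0) < count (mset \<alpha>) (c - 1) + (if c = Suc k then 1 else 0))"
proof (cases "2 \<le> c")
  case True
  then have "1 \<le> c - 1" "c - 1 + 1 = c" "c - 1 = k \<longleftrightarrow> c = Suc k" by auto
  then show ?thesis using True count_addR[OF assms, of "c - 1"]
    unfolding addable_count by (auto split: if_splits simp del: count_greater_zero_iff)
qed (auto simp: addable_def)

text \<open>The chain inside u_i stays below k - 1, starts at k - 1, or runs through k and k - 1,
  according to i < k, i = k or k < i. It leaves a part k - 1 standing, so t_k acts to the left of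
  the appended i, even if k = i + 1.\<close>

lemma addL_addR_commute:
  assumes "\<alpha> \<in> compositions" "addable i \<alpha>" "addable k (addR i \<alpha>)" "\<not> (k = Suc i \<and> i \<notin> set \<alpha>)"
  shows "addL k (addR i \<alpha>) = addR i (addL k \<alpha>)"
proof (cases "k = 1")
  case True
  then show ?thesis using assms dec_chain_Cons[of "i - 1" \<alpha> 1]
    by (auto simp: addR_def addL_def addable_def)
next
  case False
  with assms have k: "2 \<le> k" by (auto simp: addable_def)
  \<comment> \<open>For i = k the chain uses up one part k - 1 before t_k needs another, so two must
    be present.\<close>
  have cnt: "(if k = i then 1 else 0) < count (mset \<alpha>) (k - 1)"
  proof (cases "k = Suc i")
    case True
    then show ?thesis using assms(4) by simp
  next
    case False
    then show ?thesis using assms addable_addR[of i \<alpha> k] \<open>k \<noteq> 1\<close> by simp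
  qed
  then have k\<alpha>: "k - 1 \<in> set \<alpha>" by (intro in_set_countI) linarith
  have comm: "inc_first k (dec_chain (i - 1) \<alpha>) = dec_chain (i - 1) (inc_first k \<alpha>)"
  proof -
    consider "i < k" | "i = k" | "k < i" by linarith
    then show ?thesis
    proof cases
      case 1
      then show ?thesis using dec_chain_inc_first_below[of k "i - 1" \<alpha>] k assms(2)
        by (auto simp: addable_def)
    next
      case 2
      then obtain m where m: "k = Suc (Suc m)" using k that[of "k - 2"] by simp
      have "inc_first k (dec_last (k - 1) \<alpha>) = dec_last (k - 1) (inc_first k \<alpha>)"
        using 2 cnt k by (intro dec_last_inc_first_twice) auto
      then show ?thesis using 2 m dec_chain_inc_first_below[of k m] by simp
    next
      case 3
      then show ?thesis using dec_chain_inc_first_above[of k "i - 1" \<alpha>] k k\<alpha> assms(2)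
        by (auto simp: addable_def)
    qed
  qed
  have "k - 1 \<in> set (dec_chain (i - 1) \<alpha>)"
    using cnt k assms(2) mset_dec_chain[of "i - 1" \<alpha>]
    by (intro in_set_countI) (auto simp: addable_def simp del: count_greater_zero_iff count_mset_0_iff split: if_splits)
  then show ?thesis using k comm
    by (simp only: addR_def addL_drop_zeros[of k])
      (simp add: addL_def addR_def inc_first_append)
qed

text \<open>The appended i is the only part i, so t_{i+1} raises it to i + 1. On the other side t_i
  creates the only part i, and u_{i+1} starts by lowering it again. Up to deleted zeros, both sides
  are the chain of u_i applied to \<alpha>, followed by i + 1.\<close>

lemma addL_addR_adjacent:
  assumes "\<alpha> \<in> compositions" "addable i \<alpha>" "i \<notin> set \<alpha>"
  shows "addL (Suc i) (addR i \<alpha>) = addR (Suc i) (addL i \<alpha>)"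
proof -
  obtain n where i: "i = Suc n" using assms(2) by (cases i) (auto simp: addable_def)
  have "set_mset (mset (dec_chain n \<alpha>)) \<subseteq> insert 0 (set \<alpha>)"
    using assms i by (subst mset_dec_chain) (auto simp: addable_def dest: in_diffD)
  then have "i \<notin> set (dec_chain n \<alpha>)" using assms(3) i by auto
  then have "addL (Suc i) (dec_chain n \<alpha> @ [i]) = dec_chain n \<alpha> @ [Suc i]"
    using inc_first_split[of "Suc i" "dec_chain n \<alpha>" "[]"] i by (simp add: addL_def)
  moreover have "addL (Suc i) (addR i \<alpha>) = drop_zeros (addL (Suc i) (dec_chain n \<alpha> @ [i]))"
    unfolding addR_def i diff_Suc_1 by (rule addL_drop_zeros) simp
  ultimately have left: "addL (Suc i) (addR i \<alpha>) = drop_zeros (dec_chain n \<alpha> @ [Suc i])"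
    by simp
  show ?thesis
  proof (cases "n = 0")
    case True
    then show ?thesis using left i assms
      by (simp add: addR_def addL_def)
  next
    case False
    then have "dec_last i (inc_first i \<alpha>) = \<alpha>"
      using assms i by (intro dec_last_inc_first_cancel) (auto simp: addable_def)
    then show ?thesis using left i False by (simp add: addR_def addL_def)
  qed
qed


section \<open>Passing words through strips\<close>

fun path :: "(nat \<Rightarrow> nat list \<Rightarrow> nat list) \<Rightarrow> nat list \<Rightarrow> nat list \<Rightarrow> nat list \<Rightarrow> bool" where
  "path f \<alpha> [] \<gamma> \<longleftrightarrow> \<alpha> = \<gamma>"
| "path f \<alpha> (c # cs) \<gamma> \<longleftrightarrow> addable c \<alpha> \<and> path f (f c \<alpha>) cs \<gamma>"

fun ascents :: "nat list \<Rightarrow> bool list" where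
  "ascents (x # y # xs) = (x < y) # ascents (y # xs)"
| "ascents xs = []"

text \<open>For a right step i followed by a left step k from \<alpha>, this gives the labels (left,
  right) of the same move with the left step first. The same rule also computes the reverse
  exchange.\<close>

definition swap_cols :: "nat list \<Rightarrow> nat \<Rightarrow> nat \<Rightarrow> nat \<times> nat" where
  "swap_cols \<alpha> i k = (if k = Suc i \<and> i \<notin> set \<alpha> then (i, k) else (k, i))"

lemma in_set_addL_iff:
  assumes "addable k \<alpha>" "1 \<le> c"
  shows "c \<in> set (addL k \<alpha>) \<longleftrightarrow> (if Suc c = k then 1 else 0) < count (mset \<alpha>) c + (if c = k then 1 else 0)"
  using addable_addL[OF assms(1), of "Suc c"] assms(2) by (simp add: addable_def)

lemma in_set_addR_iff:
  assumes "addable k \<alpha>" "\<alpha> \<in> compositions" "1 \<le> c"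
  shows "c \<in> set (addR k \<alpha>) \<longleftrightarrow> (if Suc c = k then 1 else 0) < count (mset \<alpha>) c + (if c = k then 1 else 0)"
  using addable_addR[OF assms(1,2), of "Suc c"] assms(3) by (simp add: addable_def)

text \<open>Definedness depends on counts of parts only and ignores the sides of the steps, so the
  hypothesis may speak of either order. The last conclusion makes \<open>swap_cols\<close> its own
  inverse; \<open>exchange_LR\<close> follows from \<open>exchange_RL\<close> in this way.\<close>

lemma swap_cols_addable:
  assumes "\<alpha> \<in> compositions" "addable i \<alpha>" "swap_cols \<alpha> i k = (a, b)"
    and "addable k (addR i \<alpha>) \<or> addable k (addL i \<alpha>)"
  shows "addable a \<alpha>" "addable b (addL a \<alpha>)" "addable b (addR a \<alpha>)" "swap_cols \<alpha> a b = (i, k)"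
proof -
  have k: "k = 1 \<or> (2 \<le> k \<and> (if k = i then 1 else 0) < count (mset \<alpha>) (k - 1) + (if k = Suc i then 1 else 0))"
    using assms(4) addable_addL[OF assms(2), of k] addable_addR[OF assms(2,1), of k] by blast
  have i: "i = 1 \<or> (2 \<le> i \<and> 0 < count (mset \<alpha>) (i - 1))"
    using assms(2) by (simp add: addable_def)
  have ab: "addable a \<alpha> \<and> (b = 1 \<or> (2 \<le> b \<and> (if b = a then 1 else 0)
      < count (mset \<alpha>) (b - 1) + (if b = Suc a then 1 else 0)))"
  proof (cases "k = Suc i \<and> i \<notin> set \<alpha>")
    case True
    then show ?thesis using assms(2,3) k by (auto simp: swap_cols_def)
  next
    case False
    then have [simp]: "a = k" "b = i" using assms(3) by (auto simp: swap_cols_def split: if_splits)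
    have "addable k \<alpha>"
    proof (cases "k = Suc i")
      case True
      then show ?thesis using False i by (auto simp: addable_def)
    next
      case False
      with k have "k = 1 \<or> (2 \<le> k \<and> 0 < count (mset \<alpha>) (k - 1))"
        by (auto simp del: count_greater_zero_iff split: if_splits)
      then show ?thesis by (simp add: addable_def)
    qed
    then show ?thesis using k i by auto
  qed
  then show "addable a \<alpha>" by blast
  show "addable b (addL a \<alpha>)" "addable b (addR a \<alpha>)"
    using ab addable_addL[of a \<alpha> b] addable_addR[of a \<alpha> b] assms(1) by blast+
  show "swap_cols \<alpha> a b = (i, k)"
  proof (cases "k = Suc i \<and> i \<notin> set \<alpha>")
    case True
    then show ?thesis using assms(3) by (auto simp: swap_cols_def)
  next
    case False
    then have [simp]: "a = k" "b = i" using assms(3) by (auto simp: swap_cols_def split: if_splits)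
    have "i = Suc k \<Longrightarrow> k \<in> set \<alpha>"
      using i k in_set_countI[of \<alpha> k] by auto
    then show ?thesis by (auto simp: swap_cols_def)
  qed
qed

lemma exchange_RL:
  assumes "\<alpha> \<in> compositions" "addable i \<alpha>" "addable k (addR i \<alpha>)" "swap_cols \<alpha> i k = (a, b)"
  shows "addL k (addR i \<alpha>) = addR b (addL a \<alpha>)"
proof (cases "k = Suc i \<and> i \<notin> set \<alpha>")
  case True
  then show ?thesis using assms addL_addR_adjacent[of \<alpha> i] by (auto simp: swap_cols_def)
next
  case False
  then have "a = k" "b = i" using assms(4) by (auto simp: swap_cols_def split: if_splits)
  then show ?thesis using assms False by (simp add: addL_addR_commute)
qed

lemma exchange_LR:
  assumes "\<alpha> \<in> compositions" "addable k \<alpha>" "addable i (addL k \<alpha>)" "swap_cols \<alpha> k i = (a, b)"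
  shows "addR i (addL k \<alpha>) = addL b (addR a \<alpha>)"
  using exchange_RL[of \<alpha> a b k i] swap_cols_addable[OF assms(1,2,4)] assms by metis

text \<open>The comparison could change only if i becomes i + 1 while j = i + 1, or if j becomes j +
  1 while i = j. In the first case u_{i+1} would consume the single part i that t_{i+1} needs; in
  the second, u_i has just created the part whose absence is required.\<close>

lemma exchange_two_right:
  assumes "\<alpha> \<in> compositions" "addable i \<alpha>" "addable j (addR i \<alpha>)" "addable k (addR j (addR i \<alpha>))"
    and "swap_cols (addR i \<alpha>) j k = (k1, j')" "swap_cols \<alpha> i k1 = (k0, i')"
  shows "i' < j' \<longleftrightarrow> i < j"
proof -
  have i1: "1 \<le> i" using assms(2) by (rule addable_ge1)
  have i: "i \<in> set (addR i \<alpha>)" using in_set_addR_iff[OF assms(2,1) i1] by simp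
  show ?thesis
  proof (cases "k = Suc j \<and> j \<notin> set (addR i \<alpha>)")
    case True
    then have "k1 = j" "j' = Suc j" "i \<noteq> j" using assms(5) i by (auto simp: swap_cols_def)
    then show ?thesis using assms(6) by (auto simp: swap_cols_def split: if_splits)
  next
    case False
    then have [simp]: "k1 = k" "j' = j" using assms(5) by (auto simp: swap_cols_def split: if_splits)
    show ?thesis
    proof (cases "k = Suc i \<and> i \<notin> set \<alpha>")
      case True
      have "count (mset (addR i \<alpha>)) i = 1"
        using count_addR[OF assms(2,1) i1] True by simp
      then have "j \<noteq> Suc i"
        using assms(4) addable_addR[OF assms(3) addR_compositions, of k] True i1 by auto
      then show ?thesis using True assms(6) by (auto simp: swap_cols_def)
    qed (use assms(6) in \<open>auto simp: swap_cols_def split: if_splits\<close>)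
  qed
qed

text \<open>The mirror image, with two left steps passing one right step. If the first exchange is
  exceptional, k uses up the only part i, so l = k is impossible; if the second is, a part i is
  missing, which k = i would have created.\<close>

lemma exchange_two_left:
  assumes "\<alpha> \<in> compositions" "addable i \<alpha>" "addable k (addR i \<alpha>)" "addable l (addL k (addR i \<alpha>))"
    and "swap_cols \<alpha> i k = (k', i')" "swap_cols (addL k' \<alpha>) i' l = (l', i'')"
  shows "k' < l' \<longleftrightarrow> k < l"
proof (cases "k = Suc i \<and> i \<notin> set \<alpha>")
  case True
  then have [simp]: "k' = i" "i' = Suc i" "k = Suc i" using assms(5) by (auto simp: swap_cols_def)
  have i1: "1 \<le> i" using assms(2) by (rule addable_ge1)
  have "count (mset (addR i \<alpha>)) i = 1"
    using count_addR[OF assms(2,1) i1] True by simp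
  then have "l \<noteq> Suc i"
    using assms(4) addable_addL[OF assms(3), of l] i1 by auto
  then show ?thesis using assms(6) by (auto simp: swap_cols_def split: if_splits)
next
  case False
  then have [simp]: "k' = k" "i' = i" using assms(5) by (auto simp: swap_cols_def split: if_splits)
  have "addable k \<alpha>" using swap_cols_addable(1)[OF assms(1,2,5)] assms(3) by simp
  then have "k \<in> set (addL k \<alpha>)"
    using in_set_addL_iff[of k \<alpha> k] addable_ge1 by simp
  then have "i \<notin> set (addL k \<alpha>) \<Longrightarrow> k \<noteq> i" by blast
  then show ?thesis using assms(6) by (auto simp: swap_cols_def less_Suc_eq split: if_splits)
qed

lemma path_addL_compositions: "path addL \<alpha> cs \<gamma> \<Longrightarrow> \<alpha> \<in> compositions \<Longrightarrow> \<gamma> \<in> compositions"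
  by (induction cs arbitrary: \<alpha>) (auto simp: addL_compositions)

text \<open>The left step k comes after the right word and so meets its last letter first. The
  result is the label with which it arrives at the front, together with the relabelled word.\<close>

fun pass_right :: "nat list \<Rightarrow> nat list \<Rightarrow> nat \<Rightarrow> nat \<times> nat list" where
  "pass_right \<alpha> [] k = (k, [])"
| "pass_right \<alpha> (i # is) k =
     (let (k1, is') = pass_right (addR i \<alpha>) is k; (k0, i') = swap_cols \<alpha> i k1 in (k0, i' # is'))"

fun unpass_right :: "nat list \<Rightarrow> nat \<Rightarrow> nat list \<Rightarrow> nat list \<times> nat" where
  "unpass_right \<alpha> k [] = ([], k)"
| "unpass_right \<alpha> k (i' # is') =
     (let (i, k1) = swap_cols \<alpha> k i'; (is, k2) = unpass_right (addR i \<alpha>) k1 is' in (i # is, k2))"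

lemma pass_right_path:
  assumes "\<alpha> \<in> compositions" "path addR \<alpha> is \<beta>" "addable k \<beta>" "pass_right \<alpha> is k = (k', is')"
  shows "addable k' \<alpha> \<and> path addR (addL k' \<alpha>) is' (addL k \<beta>) \<and> ascents is' = ascents is
    \<and> length is' = length is \<and> unpass_right \<alpha> k' is' = (is, k)"
  using assms
proof (induction "is" arbitrary: \<alpha> k' is')
  case (Cons i "is")
  obtain k1 is1 where inner: "pass_right (addR i \<alpha>) is k = (k1, is1)" by fastforce
  obtain k0 i0 where sw: "swap_cols \<alpha> i k1 = (k0, i0)" by fastforce
  have [simp]: "k' = k0" "is' = i0 # is1" using Cons.prems(4) inner sw by auto
  have i: "addable i \<alpha>" "path addR (addR i \<alpha>) is \<beta>" using Cons.prems(2) by auto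
  note IH = Cons.IH[OF addR_compositions i(2) Cons.prems(3) inner]
  have k1: "addable k1 (addR i \<alpha>)" using IH by blast
  note sw' = swap_cols_addable[OF Cons.prems(1) i(1) sw disjI1[OF k1]]
  note ex = exchange_RL[OF Cons.prems(1) i(1) k1 sw]
  have asc: "ascents (i0 # is1) = ascents (i # is)"
  proof (cases "is")
    case Nil
    then show ?thesis using inner by auto
  next
    case (Cons j js)
    obtain k2 js2 where in2: "pass_right (addR j (addR i \<alpha>)) js k = (k2, js2)" by fastforce
    obtain k3 j3 where sw2: "swap_cols (addR i \<alpha>) j k2 = (k3, j3)" by fastforce
    have [simp]: "k1 = k3" "is1 = j3 # js2" using inner in2 sw2 Cons by auto
    have j: "addable j (addR i \<alpha>)" "path addR (addR j (addR i \<alpha>)) js \<beta>" using i(2) Cons by auto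
    \<comment> \<open>The induction hypothesis speaks of the label after passing j, whereas
      \<open>exchange_two_right\<close> needs the label before. It is recovered by undoing that
      exchange.\<close>
    have "addable k2 (addR j (addR i \<alpha>))"
    proof -
      obtain a b where ab: "swap_cols (addR i \<alpha>) k3 j3 = (a, b)" by fastforce
      have "unpass_right (addR i \<alpha>) k3 (j3 # js2) = (j # js, k)"
        "path addR (addL k3 (addR i \<alpha>)) (j3 # js2) (addL k \<beta>)" using IH Cons by auto
      moreover have "addable j3 (addL k3 (addR i \<alpha>))" using calculation(2) by simp
      ultimately have ab': "a = j" "addable b (addR a (addR i \<alpha>))"
        using ab swap_cols_addable(3)[OF addR_compositions k1[unfolded \<open>k1 = k3\<close>] ab]
        by (auto split: prod.splits)
      have "swap_cols (addR i \<alpha>) a b = (k3, j3)"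
        using swap_cols_addable(4)[OF addR_compositions k1[unfolded \<open>k1 = k3\<close>] ab]
          \<open>addable j3 (addL k3 (addR i \<alpha>))\<close> by blast
      then have "b = k2" using sw2 ab' by (auto simp: swap_cols_def split: if_splits)
      then show ?thesis using ab' by simp
    qed
    then have "i0 < j3 \<longleftrightarrow> i < j"
      using exchange_two_right[OF Cons.prems(1) i(1) j(1) _ sw2] sw by simp
    then show ?thesis using IH Cons by simp
  qed
  show ?case using IH sw' ex asc by simp
qed simp

lemma unpass_right_path:
  assumes "\<alpha> \<in> compositions" "addable k' \<alpha>" "path addR (addL k' \<alpha>) is' \<gamma>"
    and "unpass_right \<alpha> k' is' = (is, k)"
  shows "\<exists>\<beta>. path addR \<alpha> is \<beta> \<and> addable k \<beta> \<and> \<gamma> = addL k \<beta> \<and> pass_right \<alpha> is k = (k', is')"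
  using assms
proof (induction is' arbitrary: \<alpha> k' "is" k)
  case (Cons i' is')
  obtain i k1 where sw: "swap_cols \<alpha> k' i' = (i, k1)" by fastforce
  obtain is1 k2 where inner: "unpass_right (addR i \<alpha>) k1 is' = (is1, k2)" by fastforce
  have [simp]: "is = i # is1" "k = k2" using Cons.prems(4) sw inner by auto
  have i': "addable i' (addL k' \<alpha>)" using Cons.prems(3) by simp
  note sw' = swap_cols_addable[OF Cons.prems(1,2) sw disjI2[OF i']]
  note ex = exchange_LR[OF Cons.prems(1,2) i' sw]
  have "path addR (addL k1 (addR i \<alpha>)) is' \<gamma>" using Cons.prems(3) ex by simp
  then show ?case
    using Cons.IH[OF addR_compositions sw'(3) _ inner] sw' by auto
qed auto

text \<open>Both left steps pass each right letter in turn, so \<open>exchange_two_left\<close>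
  carries the comparison from the end of the word to its front.\<close>

lemma pass_right_two:
  assumes "\<alpha> \<in> compositions" "path addR \<alpha> is \<beta>" "addable k \<beta>" "addable l (addL k \<beta>)"
    and "pass_right \<alpha> is k = (k', is')" "pass_right (addL k' \<alpha>) is' l = (l', is'')"
  shows "k' < l' \<longleftrightarrow> k < l"
  using assms
proof (induction "is" arbitrary: \<alpha> k' is' l' is'')
  case (Cons i "is")
  obtain k1 is1 where inner: "pass_right (addR i \<alpha>) is k = (k1, is1)" by fastforce
  obtain k0 i0 where sw: "swap_cols \<alpha> i k1 = (k0, i0)" by fastforce
  have [simp]: "k' = k0" "is' = i0 # is1" using Cons.prems(5) inner sw by auto
  have i: "addable i \<alpha>" "path addR (addR i \<alpha>) is \<beta>" using Cons.prems(2) by auto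
  note P = pass_right_path[OF addR_compositions i(2) Cons.prems(3) inner]
  have k1: "addable k1 (addR i \<alpha>)" using P by blast
  note ex = exchange_RL[OF Cons.prems(1) i(1) k1 sw]
  obtain l1 is2 where inner2: "pass_right (addR i0 (addL k0 \<alpha>)) is1 l = (l1, is2)" by fastforce
  obtain l0 i2 where sw2: "swap_cols (addL k0 \<alpha>) i0 l1 = (l0, i2)" by fastforce
  have [simp]: "l' = l0" using Cons.prems(6) inner2 sw2 by auto
  have inner2': "pass_right (addL k1 (addR i \<alpha>)) is1 l = (l1, is2)" using inner2 ex by simp
  have "addable l1 (addL k1 (addR i \<alpha>))"
    using pass_right_path[OF addL_compositions[OF k1 addR_compositions] _ Cons.prems(4) inner2'] P
    by blast
  then have "k0 < l0 \<longleftrightarrow> k1 < l1"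
    using exchange_two_left[OF Cons.prems(1) i(1) k1 _ sw sw2] by blast
  then show ?case
    using Cons.IH[OF addR_compositions i(2) Cons.prems(3,4) inner inner2'] by simp
qed simp

fun pass_all :: "nat list \<Rightarrow> nat list \<Rightarrow> nat list \<Rightarrow> nat list \<times> nat list" where
  "pass_all \<alpha> is [] = ([], is)"
| "pass_all \<alpha> is (k # ks) =
     (let (k', is') = pass_right \<alpha> is k; (ks', is'') = pass_all (addL k' \<alpha>) is' ks in (k' # ks', is''))"

fun unpass_all :: "nat list \<Rightarrow> nat list \<Rightarrow> nat list \<Rightarrow> nat list \<times> nat list" where
  "unpass_all \<alpha> [] is = (is, [])"
| "unpass_all \<alpha> (k' # ks') is'' =
     (let (is', ks) = unpass_all (addL k' \<alpha>) ks' is''; (is, k) = unpass_right \<alpha> k' is' in (is, k # ks))"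

text \<open>Left steps pass in the order in which they are performed, each through the right word
  left by its predecessor. Together with \<open>unpass_all_path\<close> this makes
  \<open>pass_all\<close> a bijection that keeps both endpoints and both ascent patterns.\<close>

lemma pass_all_path:
  assumes "\<alpha> \<in> compositions" "path addR \<alpha> is \<beta>" "path addL \<beta> ks \<gamma>" "pass_all \<alpha> is ks = (ks', is')"
  shows "(\<exists>\<delta>. path addL \<alpha> ks' \<delta> \<and> path addR \<delta> is' \<gamma>) \<and> ascents is' = ascents is \<and> ascents ks' = ascents ks
    \<and> length is' = length is \<and> length ks' = length ks \<and> unpass_all \<alpha> ks' is' = (is, ks)"
  using assms
proof (induction ks arbitrary: \<alpha> \<beta> "is" ks' is')
  case (Cons k ks)
  obtain k1 is1 where p: "pass_right \<alpha> is k = (k1, is1)" by fastforce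
  obtain ks2 is2 where q: "pass_all (addL k1 \<alpha>) is1 ks = (ks2, is2)" by fastforce
  have [simp]: "ks' = k1 # ks2" "is' = is2" using Cons.prems(4) p q by auto
  have k: "addable k \<beta>" "path addL (addL k \<beta>) ks \<gamma>" using Cons.prems(3) by auto
  note P = pass_right_path[OF Cons.prems(1,2) k(1) p]
  have comp: "addL k1 \<alpha> \<in> compositions" using P Cons.prems(1) addL_compositions by blast
  have P2: "path addR (addL k1 \<alpha>) is1 (addL k \<beta>)" using P by blast
  note IH = Cons.IH[OF comp P2 k(2) q]
  have "ascents (k1 # ks2) = ascents (k # ks)"
  proof (cases ks)
    case Nil
    then show ?thesis using q by auto
  next
    case (Cons l ls)
    obtain l1 is3 where r: "pass_right (addL k1 \<alpha>) is1 l = (l1, is3)" by fastforce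
    have "\<exists>ls'. ks2 = l1 # ls'" using q r Cons by (auto split: prod.splits)
    moreover have "k1 < l1 \<longleftrightarrow> k < l"
      using pass_right_two[OF Cons.prems(1,2) k(1) _ p r] k(2) Cons by simp
    ultimately show ?thesis using IH Cons by auto
  qed
  then show ?case using IH P by auto
qed auto

lemma unpass_all_path:
  assumes "\<alpha> \<in> compositions" "path addL \<alpha> ks' \<delta>" "path addR \<delta> is' \<gamma>" "unpass_all \<alpha> ks' is' = (is, ks)"
  shows "\<exists>\<beta>. path addR \<alpha> is \<beta> \<and> path addL \<beta> ks \<gamma> \<and> pass_all \<alpha> is ks = (ks', is')"
  using assms
proof (induction ks' arbitrary: \<alpha> "is" ks)
  case (Cons k' ks')
  obtain is1 ks1 where q: "unpass_all (addL k' \<alpha>) ks' is' = (is1, ks1)" by fastforce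
  obtain is0 k0 where p: "unpass_right \<alpha> k' is1 = (is0, k0)" by fastforce
  have [simp]: "is = is0" "ks = k0 # ks1" using Cons.prems(4) p q by auto
  have k': "addable k' \<alpha>" "path addL (addL k' \<alpha>) ks' \<delta>" using Cons.prems(2) by auto
  obtain \<beta> where \<beta>: "path addR (addL k' \<alpha>) is1 \<beta>" "path addL \<beta> ks1 \<gamma>"
    "pass_all (addL k' \<alpha>) is1 ks1 = (ks', is')"
    using Cons.IH[OF addL_compositions[OF k'(1) Cons.prems(1)] k'(2) Cons.prems(3) q] by blast
  show ?case using unpass_right_path[OF Cons.prems(1) k'(1) \<beta>(1) p] \<beta> by auto
qed auto


section \<open>Right strips as paths along monotone words\<close>

lemma length_ascents: "length (ascents xs) = length xs - 1"
  by (induction xs rule: ascents.induct) auto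

lemma nth_ascents: "Suc x < length xs \<Longrightarrow> ascents xs ! x \<longleftrightarrow> xs ! x < xs ! Suc x"
  by (induction xs arbitrary: x rule: ascents.induct) (auto simp: nth_Cons')

text \<open>\<open>h = True\<close> selects strictly increasing and \<open>h = False\<close> weakly decreasing words, so that
  the two halves of the theorem are treated at once.\<close>

definition monotone_word :: "bool \<Rightarrow> nat list \<Rightarrow> bool" where
  "monotone_word h w \<longleftrightarrow> (\<forall>b\<in>set (ascents w). b = h)"

definition strip :: "bool \<Rightarrow> nat \<Rightarrow> nat list \<Rightarrow> nat list \<Rightarrow> bool" where
  "strip h n \<alpha> \<gamma> \<longleftrightarrow> (\<exists>is. length is = n \<and> monotone_word h is \<and> path addR \<alpha> is \<gamma>)"

lemma monotone_word_Cons2: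
  "monotone_word h (x # y # w) \<longleftrightarrow> (x < y) = h \<and> monotone_word h (y # w)"
  by (auto simp: monotone_word_def)

lemma monotone_word_True: "monotone_word True w \<longleftrightarrow> sorted_wrt (<) w"
  by (induction w rule: ascents.induct)
    (auto simp: monotone_word_Cons2, auto simp: monotone_word_def)

lemma monotone_word_False: "monotone_word False w \<longleftrightarrow> sorted_wrt (\<ge>) w"
  by (induction w rule: ascents.induct)
    (auto simp: monotone_word_Cons2, auto simp: monotone_word_def)

text \<open>The part to be lowered is positive, so zeros neither hide nor supply it; a zero created
  for r = 1 disappears on both sides.\<close>

lemma drop_zeros_dec_last:
  "1 \<le> r \<Longrightarrow> drop_zeros (dec_last r (drop_zeros \<alpha>)) = drop_zeros (dec_last r \<alpha>)"
  by (induction \<alpha>) (auto simp: dec_last_absent)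

lemma drop_zeros_dec_chain: "drop_zeros (dec_chain n (drop_zeros \<alpha>)) = drop_zeros (dec_chain n \<alpha>)"
proof (induction n arbitrary: \<alpha>)
  case (Suc n)
  then show ?case
    by (metis dec_chain.simps(2) drop_zeros_dec_last le_add1 plus_1_eq_Suc)
qed simp

lemma addable_drop_zeros: "addable c (drop_zeros \<alpha>) \<longleftrightarrow> addable c \<alpha>"
  by (auto simp: addable_def)

lemma op_u_eq:
  assumes "1 \<le> i"
  shows "op_u i \<alpha> = (if addable i \<alpha> then Some (dec_chain (i - 1) \<alpha> @ [i]) else None)"
proof -
  have "foldr (\<lambda>k x. Option.bind x (op_d k)) [1..<Suc n] (Some \<alpha>)
      = (if n = 0 \<or> n \<in> set \<alpha> then Some (dec_chain n \<alpha>) else None)" for n \<alpha>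
  proof (induction n arbitrary: \<alpha>)
    case (Suc n)
    have None: "foldr (\<lambda>k x. Option.bind x (op_d k)) ks None = None" for ks
      by (induction ks) auto
    have "foldr (\<lambda>k x. Option.bind x (op_d k)) [1..<Suc (Suc n)] (Some \<alpha>)
        = foldr (\<lambda>k x. Option.bind x (op_d k)) [1..<Suc n] (op_d (Suc n) \<alpha>)" by simp
    note unroll = this
    show ?case
    proof (cases "Suc n \<in> set \<alpha>")
      case True
      then have "n \<in> set (dec_last (Suc n) \<alpha>)"
        using in_set_dec_last_pred[of "Suc n" \<alpha>] by simp
      moreover from True have "op_d (Suc n) \<alpha> = Some (dec_last (Suc n) \<alpha>)" by (simp add: op_d_eq)
      ultimately show ?thesis unfolding unroll using True Suc.IH[of "dec_last (Suc n) \<alpha>"]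
        by (simp del: upt_Suc)
    next
      case False
      then have "op_d (Suc n) \<alpha> = None" by (simp add: op_d_eq)
      then show ?thesis unfolding unroll using None False by (simp del: upt_Suc)
    qed
  qed simp
  from this[of "i - 1"] show ?thesis using assms
    by (auto simp: op_u_def addable_def op_a_def)
qed

text \<open>Zeros that accumulate are invisible to later steps, so keeping them to the end or
  deleting them after every step leads to the same composition.\<close>

lemma op_us_path:
  "(\<forall>i\<in>set is. 1 \<le> i) \<Longrightarrow>
    (\<exists>\<delta>. op_us is \<alpha> = Some \<delta> \<and> \<gamma> = drop_zeros \<delta>) \<longleftrightarrow> path addR (drop_zeros \<alpha>) is \<gamma>"
proof (induction "is" arbitrary: \<alpha>)
  case Nil
  then show ?case by (auto simp: op_us_def)
next
  case (Cons i "is")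
  have None: "fold (\<lambda>i x. Option.bind x (op_u i)) ks None = None" for ks
    by (induction ks) auto
  have "op_us (i # is) \<alpha> = (if addable i \<alpha> then op_us is (dec_chain (i - 1) \<alpha> @ [i]) else None)"
    using Cons.prems by (simp add: op_us_def op_u_eq None)
  moreover have "drop_zeros (dec_chain (i - 1) \<alpha> @ [i]) = addR i (drop_zeros \<alpha>)"
    using drop_zeros_dec_chain by (simp add: addR_def)
  ultimately show ?case
    using Cons.IH[of "dec_chain (i - 1) \<alpha> @ [i]"] Cons.prems by (simp add: addable_drop_zeros)
qed

lemma path_ge1: "path f \<alpha> cs \<gamma> \<Longrightarrow> \<forall>c\<in>set cs. 1 \<le> c"
  by (induction cs arbitrary: \<alpha>) (auto dest: addable_ge1)

lemma right_strip_eq: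
  assumes "\<alpha> \<in> compositions"
  shows "right_horizontal_strip n \<alpha> \<gamma> \<longleftrightarrow> strip True n \<alpha> \<gamma>"
    and "right_vertical_strip n \<alpha> \<gamma> \<longleftrightarrow> strip False n \<alpha> \<gamma>"
proof -
  have dz: "drop_zeros \<alpha> = \<alpha>" using assms by (auto simp: compositions_def filter_id_conv intro: gr0I)
  have nz: "filter (\<lambda>p. p \<noteq> 0) = drop_zeros" by (simp add: fun_eq_iff)
  show "right_horizontal_strip n \<alpha> \<gamma> \<longleftrightarrow> strip True n \<alpha> \<gamma>"
    unfolding right_horizontal_strip_def strip_def monotone_word_True
    using op_us_path[of _ \<alpha> \<gamma>] path_ge1[of addR \<alpha> _ \<gamma>] unfolding dz nz by metis
  show "right_vertical_strip n \<alpha> \<gamma> \<longleftrightarrow> strip False n \<alpha> \<gamma>"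
    unfolding right_vertical_strip_def strip_def monotone_word_False
    using op_us_path[of _ \<alpha> \<gamma>] path_ge1[of addR \<alpha> _ \<gamma>] unfolding dz nz by metis
qed

lemma sum_mset_addable:
  assumes "M' = (if c = 1 then M else M - {#c - 1#}) + {#c#}" "addable c \<alpha>" "M = mset \<alpha>"
  shows "sum_mset M' = Suc (sum_mset M)"
proof (cases "c = 1")
  case False
  then have "2 \<le> c" "c - 1 \<in># M" using assms by (auto simp: addable_def)
  then obtain M0 where "M = add_mset (c - 1) M0" by (metis insert_DiffM)
  then show ?thesis using assms(1) \<open>2 \<le> c\<close> by simp
qed (use assms in simp)

lemma sum_list_addL: "addable c \<alpha> \<Longrightarrow> sum_list (addL c \<alpha>) = Suc (sum_list \<alpha>)"
  using sum_mset_addable[OF mset_addL] by (metis sum_mset_sum_list)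

lemma sum_list_addR: "addable c \<alpha> \<Longrightarrow> \<alpha> \<in> compositions \<Longrightarrow> sum_list (addR c \<alpha>) = Suc (sum_list \<alpha>)"
  using sum_mset_addable[OF mset_addR] by (metis sum_mset_sum_list)

lemma sum_list_path_addL: "path addL \<alpha> cs \<gamma> \<Longrightarrow> sum_list \<gamma> = sum_list \<alpha> + length cs"
  by (induction cs arbitrary: \<alpha>) (auto simp: sum_list_addL)

lemma sum_list_path_addR:
  "path addR \<alpha> cs \<gamma> \<Longrightarrow> \<alpha> \<in> compositions \<Longrightarrow> sum_list \<gamma> = sum_list \<alpha> + length cs"
proof (induction cs arbitrary: \<alpha>)
  case (Cons c cs)
  then show ?case using Cons.IH[OF _ addR_compositions] by (auto simp: sum_list_addR)
qed simp

lemma addable_le: "addable c \<alpha> \<Longrightarrow> c \<le> Suc (sum_list \<alpha>)"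
  using member_le_sum_list[of "c - 1" \<alpha>] by (auto simp: addable_def)

lemma path_addL_le: "path addL \<alpha> cs \<gamma> \<Longrightarrow> \<forall>c\<in>set cs. c \<le> sum_list \<gamma>"
proof (induction cs arbitrary: \<alpha>)
  case (Cons c cs)
  then have "c \<le> Suc (sum_list \<alpha>)" "sum_list \<gamma> = Suc (sum_list \<alpha>) + length cs"
    using addable_le[of c \<alpha>] sum_list_path_addL[of "addL c \<alpha>" cs \<gamma>] sum_list_addL[of c \<alpha>] by auto
  then show ?case using Cons by auto
qed simp

section \<open>Words of columns and their descents\<close>

definition words :: "nat list \<Rightarrow> nat list set" where
  "words \<beta> = {ks. path addL [] ks \<beta>}"

lemma words_length: "ks \<in> words \<beta> \<Longrightarrow> length ks = sum_list \<beta>"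
  unfolding words_def using sum_list_path_addL by fastforce

lemma finite_words: "finite (words \<beta>)"
proof (rule finite_subset)
  show "words \<beta> \<subseteq> {ks. set ks \<subseteq> {..sum_list \<beta>} \<and> length ks = sum_list \<beta>}"
    using words_length path_addL_le by (auto simp: words_def)
qed (simp add: finite_lists_length_eq)

lemma finite_compositions_le: "finite {\<alpha> \<in> compositions. sum_list \<alpha> \<le> N}"
proof (rule finite_subset)
  have "\<alpha> \<in> compositions \<Longrightarrow> length \<alpha> \<le> sum_list \<alpha>" for \<alpha>
    by (induction \<alpha>) (auto simp: compositions_def)
  then show "{\<alpha> \<in> compositions. sum_list \<alpha> \<le> N} \<subseteq> {\<alpha>. set \<alpha> \<subseteq> {..N} \<and> length \<alpha> \<le> N}"
    using member_le_sum_list by fastforce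
qed (simp add: finite_lists_length_le)

text \<open>With N = \<open>length ks\<close>, entry v of the tableau is placed by the letter at
  position N - v and entry v + 1 by the letter just before it; hence descents are read from the end
  of the word.\<close>

definition descents :: "nat list \<Rightarrow> nat set" where
  "descents ks = {v. 1 \<le> v \<and> v < length ks \<and> ks ! (length ks - v) \<le> ks ! (length ks - v - 1)}"

lemma descents_alt:
  "descents ks = {v. 1 \<le> v \<and> v < length ks \<and> \<not> ascents ks ! (length ks - v - 1)}"
proof -
  have "ks ! (length ks - v) \<le> ks ! (length ks - v - 1) \<longleftrightarrow> \<not> ascents ks ! (length ks - v - 1)"
    if "1 \<le> v" "v < length ks" for v
    using that nth_ascents[of "length ks - v - 1" ks] by (simp add: Suc_diff_Suc not_less)
  then show ?thesis by (auto simp: descents_def)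
qed

lemma descents_cong: "ascents ks = ascents ks' \<Longrightarrow> length ks = length ks' \<Longrightarrow> descents ks = descents ks'"
  by (simp add: descents_alt)

text \<open>Early letters place large entries, so the comparisons among the first n letters concern
  exactly these v. At v = \<open>length ks - n\<close> the last letter of the prefix meets the first
  one after it, and nothing is imposed.\<close>

lemma monotone_word_take:
  assumes "n \<le> length ks"
  shows "monotone_word h (take n ks) \<longleftrightarrow>
    (\<forall>v. length ks - n < v \<and> v < length ks \<longrightarrow> (v \<notin> descents ks) = h)"
proof -
  have "monotone_word h (take n ks) \<longleftrightarrow> (\<forall>x. Suc x < n \<longrightarrow> (ks ! x < ks ! Suc x) = h)"
    using assms by (fastforce simp: monotone_word_def all_set_conv_all_nth length_ascents nth_ascents)
  also have "\<dots> \<longleftrightarrow> (\<forall>v. length ks - n < v \<and> v < length ks \<longrightarrow> (v \<notin> descents ks) = h)"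
  proof (rule iffI; intro allI impI)
    fix v assume *: "\<forall>x. Suc x < n \<longrightarrow> (ks ! x < ks ! Suc x) = h" "length ks - n < v \<and> v < length ks"
    define x where "x = length ks - v - 1"
    have x: "Suc x < n" "length ks - v = Suc x" "length ks - v - 1 = x" "1 \<le> v"
      using * by (auto simp: x_def)
    with * show "(v \<notin> descents ks) = h" unfolding descents_def mem_Collect_eq x(2,3) by auto
  next
    fix x assume *: "\<forall>v. length ks - n < v \<and> v < length ks \<longrightarrow> (v \<notin> descents ks) = h" "Suc x < n"
    have "(length ks - Suc x \<notin> descents ks) = h" using *(2) assms by (intro *(1)[rule_format]) auto
    moreover have "length ks - (length ks - Suc x) - 1 = x" "length ks - (length ks - Suc x) = Suc x"
      using * assms by auto
    ultimately show "(ks ! x < ks ! Suc x) = h"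
      using * assms unfolding descents_def mem_Collect_eq by auto
  qed
  finally show ?thesis .
qed

lemma descents_drop:
  assumes "n \<le> length ks"
  shows "descents (drop n ks) = descents ks \<inter> {..<length ks - n}"
proof -
  have "n + (length ks - n - v) = length ks - v" "n + (length ks - n - v - 1) = length ks - v - 1"
    if "v < length ks - n" for v
    using that assms by auto
  then show ?thesis using assms by (auto simp: descents_def)
qed

lemma path_append: "path f \<alpha> (cs @ ds) \<gamma> \<longleftrightarrow> (\<exists>\<beta>. path f \<alpha> cs \<beta> \<and> path f \<beta> ds \<gamma>)"
  by (induction cs arbitrary: \<alpha>) auto

text \<open>A single row m offers only the columns 1 and m + 1, and 1 is ruled out by the
  increase.\<close>

lemma path_increasing_from_row:
  assumes "f \<in> {addL, addR}"
  shows "1 \<le> m \<Longrightarrow> monotone_word True (m # ws) \<Longrightarrow>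
    path f [m] ws \<mu> \<longleftrightarrow> ws = [Suc m..<Suc m + length ws] \<and> \<mu> = [m + length ws]"
proof (induction ws arbitrary: m)
  case (Cons c ws)
  have c: "m < c" "monotone_word True (c # ws)" using Cons.prems by (auto simp: monotone_word_Cons2)
  have "addable c [m] \<longleftrightarrow> c = Suc m" using c Cons.prems by (auto simp: addable_def)
  moreover have "f (Suc m) [m] = [Suc m]"
  proof -
    have "dec_chain n [n] = [0]" for n by (induction n) auto
    then show ?thesis using assms Cons.prems by (auto simp: addL_def addR_def)
  qed
  moreover have "[Suc m..<Suc m + length (c # ws)] = Suc m # [Suc (Suc m)..<Suc (Suc m) + length ws]"
    by (subst upt_conv_Cons) (simp_all del: upt_Suc)
  ultimately show ?case using Cons.IH[of c] c Cons.prems by (auto simp: Suc_le_eq simp del: upt_Suc)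
qed auto

lemma path_decreasing_from_column:
  assumes "f \<in> {addL, addR}"
  shows "monotone_word False (1 # ws) \<Longrightarrow>
    path f (replicate m 1) ws \<mu> \<longleftrightarrow> ws = replicate (length ws) 1 \<and> \<mu> = replicate (m + length ws) 1"
proof (induction ws arbitrary: m)
  case (Cons c ws)
  have c: "c \<le> 1" using Cons.prems by (auto simp: monotone_word_Cons2)
  then have a: "addable c (replicate m 1) \<longleftrightarrow> c = 1" by (auto simp: addable_def)
  have "f 1 (replicate m 1) = replicate (Suc m) 1"
    using assms by (auto simp: addL_def addR_def replicate_append_same)
  then show ?case using a Cons.IH[of "Suc m"] Cons.prems by (auto simp: monotone_word_Cons2)
qed auto

text \<open>The first letter must be 1, after which a monotone word is forced to grow one row or one
  column. No trace of \<open>f\<close> remains on the right, so such a word may be read as left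
  steps or as right steps.\<close>

lemma path_monotone_from_empty:
  assumes "f \<in> {addL, addR}" "monotone_word h w"
  shows "path f [] w \<mu> \<longleftrightarrow> (if h then w = [1..<Suc (length w)] \<and> \<mu> = (if w = [] then [] else [length w])
    else w = replicate (length w) 1 \<and> \<mu> = replicate (length w) 1)"
proof (cases w)
  case (Cons c ws)
  have a: "addable c [] \<longleftrightarrow> c = 1" by (simp add: addable_def)
  have f: "f 1 [] = [1]" using assms(1) by (auto simp: addL_def addR_def)
  show ?thesis
  proof (cases "c = 1")
    case True
    have "[1..<Suc (length w)] = 1 # [Suc 1..<Suc 1 + length ws]"
      using Cons by (subst upt_conv_Cons) (simp_all del: upt_Suc)
    then show ?thesis
      using True Cons a f assms path_increasing_from_row[OF assms(1), of 1 ws \<mu>]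
        path_decreasing_from_column[OF assms(1), of ws 1 \<mu>] by (auto simp: Suc_le_eq simp del: upt_Suc)
  next
    case False
    then show ?thesis using a Cons upt_conv_Cons[of 1 "Suc (length w)"] by (auto simp del: upt_Suc)
  qed
qed auto

text \<open>Let L count the parts of size at least c, that is, the boxes in column c. A step i
  raises this number by one for c = i and for no other c \<ge> 1, so the endpoints determine how
  often each letter occurs.\<close>

lemma mset_path_unique:
  assumes "path addR \<alpha> is \<beta>" "path addR \<alpha> is' \<beta>" "\<alpha> \<in> compositions"
  shows "mset is = mset is'"
proof -
  define L :: "nat list \<Rightarrow> nat \<Rightarrow> nat" where "L \<gamma> c = length (filter (\<lambda>p. c \<le> p) \<gamma>)" for \<gamma> c
  have L_mset: "L \<gamma> c = size (filter_mset (\<lambda>p. c \<le> p) (mset \<gamma>))" for \<gamma> c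
    unfolding L_def by (metis mset_filter size_mset)
  have step: "L (addR i \<gamma>) c = L \<gamma> c + (if c = i then 1 else 0)"
    if "addable i \<gamma>" "\<gamma> \<in> compositions" "1 \<le> c" for i \<gamma> c
  proof (cases "i = 1")
    case True
    then show ?thesis using mset_addR[OF that(1,2)] that(3) unfolding L_mset by auto
  next
    case False
    then have i: "i - 1 \<in># mset \<gamma>" "2 \<le> i" using that by (auto simp: addable_def)
    then obtain M where M: "mset \<gamma> = add_mset (i - 1) M" by (metis insert_DiffM)
    then have "mset (addR i \<gamma>) = add_mset i M" using mset_addR[OF that(1,2)] False by simp
    then show ?thesis unfolding L_mset using M i by auto
  qed
  have count: "L \<beta> c = L \<gamma> c + count (mset is) c"
    if "path addR \<gamma> is \<beta>" "\<gamma> \<in> compositions" "1 \<le> c" for "is" \<gamma> c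
    using that
  proof (induction "is" arbitrary: \<gamma>)
    case (Cons i "is")
    then show ?case using Cons.IH[OF _ addR_compositions] step[of i \<gamma> c] by auto
  qed simp
  show ?thesis
  proof (rule multiset_eqI)
    fix c
    show "count (mset is) c = count (mset is') c"
    proof (cases "c = 0")
      case True
      then show ?thesis using path_ge1[OF assms(1)] path_ge1[OF assms(2)]
        by (metis count_mset_0_iff not_one_le_zero)
    next
      case False
      then show ?thesis using count[OF assms(1,3), of c] count[OF assms(2,3), of c] by simp
    qed
  qed
qed

text \<open>With \<open>mset_path_unique\<close>, at most one monotone word leads from one
  composition to another, so that counting words and counting strips agree.\<close>

lemma monotone_word_unique:
  assumes "monotone_word h w" "monotone_word h w'" "mset w = mset w'"
  shows "w = w'"
proof (cases h)
  case True
  then have "sorted w" "sorted w'" using assms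
    by (auto simp: monotone_word_True strict_sorted_iff)
  then show ?thesis using assms(3) by (metis properties_for_sort)
next
  case False
  then have "sorted (rev w)" "sorted (rev w')" using assms
    by (auto simp: monotone_word_False sorted_wrt_rev)
  then show ?thesis using assms(3) by (metis mset_rev properties_for_sort rev_rev_ident)
qed

text \<open>Cutting off the first \<open>n\<close> steps of a word leaves a path from \<open>\<mu> = (n)\<close> or \<open>\<mu> = (1\<^sup>n)\<close>, and
  \<open>\<mu>\<close> is also a strip added to the empty composition from the right. Passing the remaining left steps
  through this strip moves the strip to the end of the path.\<close>

lemma strip_sum:
  fixes G :: "nat \<Rightarrow> nat set \<Rightarrow> 'a::comm_monoid_add"
  assumes "\<beta> \<in> compositions"
  shows "(\<Sum>ks\<in>words \<beta>. if n \<le> sum_list \<beta> \<and>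
      (\<forall>v. sum_list \<beta> - n < v \<and> v < sum_list \<beta> \<longrightarrow> (v \<notin> descents ks) = h)
      then G (sum_list \<beta> - n) (descents ks \<inter> {..<sum_list \<beta> - n}) else 0)
    = (\<Sum>\<alpha> | \<alpha> \<in> compositions \<and> strip h n \<alpha> \<beta>. \<Sum>ks\<in>words \<alpha>. G (sum_list \<alpha>) (descents ks))"
    (is "?l = ?r")
proof -
  define good where "good w \<longleftrightarrow> length w = n \<and> monotone_word h w" for w
  \<comment> \<open>Four index sets for the same terms: words of \<beta> with a monotone beginning
    (\<open>A\<close>), a right strip followed by left steps (\<open>B\<close>), left steps followed
    by a right strip (\<open>C\<close>), and words of the compositions from which a strip leads to
    \<beta> (\<open>E\<close>).\<close>
  define A where "A = {ks \<in> words \<beta>. n \<le> length ks \<and> good (take n ks)}"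
  define B where "B = {(w, ks). good w \<and> (\<exists>\<mu>. path addR [] w \<mu> \<and> path addL \<mu> ks \<beta>)}"
  define C where "C = {(ks, w). good w \<and> (\<exists>\<alpha>. path addL [] ks \<alpha> \<and> path addR \<alpha> w \<beta>)}"
  define E where "E = (SIGMA \<alpha>:{\<alpha> \<in> compositions. strip h n \<alpha> \<beta>}. words \<alpha>)"
  have [simp]: "[] \<in> compositions" by (simp add: compositions_def)
  have "?l = (\<Sum>ks\<in>A. G (length (drop n ks)) (descents (drop n ks)))"
    unfolding A_def good_def
    by (subst sum.inter_filter[OF finite_words])
      (auto intro!: sum.cong simp: words_length monotone_word_take descents_drop)
  also have "\<dots> = (\<Sum>(w, ks)\<in>B. G (length ks) (descents ks))"
  proof (rule sum.reindex_bij_witness[where i = "\<lambda>(w, ks). w @ ks" and j = "\<lambda>ks. (take n ks, drop n ks)"])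
    fix ks assume "ks \<in> A"
    then have g: "good (take n ks)" and "path addL [] (take n ks @ drop n ks) \<beta>"
      by (auto simp: A_def words_def)
    then obtain \<mu> where \<mu>: "path addL [] (take n ks) \<mu>" "path addL \<mu> (drop n ks) \<beta>"
      unfolding path_append by blast
    have "path addR [] (take n ks) \<mu>"
      using \<mu>(1) g path_monotone_from_empty[of addL h "take n ks" \<mu>]
        path_monotone_from_empty[of addR h "take n ks" \<mu>] by (simp add: good_def)
    then show "(take n ks, drop n ks) \<in> B" using \<mu> g by (auto simp: B_def)
  next
    fix p assume "p \<in> B"
    then obtain w ks \<mu> where p: "p = (w, ks)" "good w" "path addR [] w \<mu>" "path addL \<mu> ks \<beta>"
      by (auto simp: B_def)
    have "path addL [] w \<mu>"
      using p path_monotone_from_empty[of addL h w \<mu>]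
        path_monotone_from_empty[of addR h w \<mu>] by (simp add: good_def)
    then show "(case p of (w, ks) \<Rightarrow> w @ ks) \<in> A"
      using p by (auto simp: A_def words_def path_append good_def)
    show "(take n (case p of (w, ks) \<Rightarrow> w @ ks), drop n (case p of (w, ks) \<Rightarrow> w @ ks)) = p"
      using p by (simp add: good_def)
  qed auto
  also have "\<dots> = (\<Sum>(ks, w)\<in>C. G (length ks) (descents ks))"
  proof (rule sum.reindex_bij_witness[where i = "\<lambda>(ks, w). unpass_all [] ks w" and j = "\<lambda>(w, ks). pass_all [] w ks"])
    fix p assume "p \<in> B"
    then obtain w ks \<mu> where p: "p = (w, ks)" "good w" "path addR [] w \<mu>" "path addL \<mu> ks \<beta>"
      by (auto simp: B_def)
    obtain ks' w' where q: "pass_all [] w ks = (ks', w')" by fastforce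
    note P = pass_all_path[OF _ p(3,4) q]
    show "(case case p of (w, ks) \<Rightarrow> pass_all [] w ks of (ks, w) \<Rightarrow> unpass_all [] ks w) = p"
      using p q P by simp
    show "(case p of (w, ks) \<Rightarrow> pass_all [] w ks) \<in> C"
      using p q P by (auto simp: C_def good_def monotone_word_def)
    show "(case case p of (w, ks) \<Rightarrow> pass_all [] w ks of (ks, w) \<Rightarrow> G (length ks) (descents ks))
        = (case p of (w, ks) \<Rightarrow> G (length ks) (descents ks))"
      using p q P descents_cong[of ks ks'] by simp
  next
    fix p assume "p \<in> C"
    then obtain w ks \<alpha> where p: "p = (ks, w)" "good w" "path addL [] ks \<alpha>" "path addR \<alpha> w \<beta>"
      by (auto simp: C_def)
    obtain w' ks' where q: "unpass_all [] ks w = (w', ks')" by fastforce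
    obtain \<mu> where \<mu>: "path addR [] w' \<mu>" "path addL \<mu> ks' \<beta>" "pass_all [] w' ks' = (ks, w)"
      using unpass_all_path[OF _ p(3,4) q] by auto
    note P = pass_all_path[OF _ \<mu>]
    show "(case case p of (ks, w) \<Rightarrow> unpass_all [] ks w of (w, ks) \<Rightarrow> pass_all [] w ks) = p"
      using p q \<mu> by simp
    show "(case p of (ks, w) \<Rightarrow> unpass_all [] ks w) \<in> B"
      using p q P \<mu> by (auto simp: B_def good_def monotone_word_def)
  qed
  also have "\<dots> = (\<Sum>(\<alpha>, ks)\<in>E. G (sum_list \<alpha>) (descents ks))"
  proof -
    \<comment> \<open>The right word of a pair in \<open>C\<close> is determined by its two ends, so
      it can be restored by a definite description.\<close>
    define g where "g = (\<lambda>(\<alpha>, ks :: nat list). (ks, THE w. good w \<and> path addR \<alpha> w \<beta>))"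
    have the: "(THE w. good w \<and> path addR \<alpha> w \<beta>) = w"
      if "\<alpha> \<in> compositions" "good w" "path addR \<alpha> w \<beta>" for \<alpha> w
    proof (rule the_equality)
      show "good w \<and> path addR \<alpha> w \<beta>" using that by blast
      fix w' assume w': "good w' \<and> path addR \<alpha> w' \<beta>"
      then have "mset w' = mset w" using that by (blast intro: mset_path_unique)
      then show "w' = w" using that w' monotone_word_unique[of h w' w] by (simp add: good_def)
    qed
    have uniq: "path f \<alpha> ks \<gamma> \<Longrightarrow> path f \<alpha> ks \<gamma>' \<Longrightarrow> \<gamma> = \<gamma>'" for f \<alpha> ks \<gamma> \<gamma>'
      by (induction ks arbitrary: \<alpha>) auto
    have "bij_betw g E C"
    proof (rule bij_betwI')
      fix x y assume "x \<in> E" "y \<in> E"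
      then show "((g x)
          = (g y)) = (x = y)"
        using uniq by (auto simp: E_def words_def g_def)
    next
      fix x assume "x \<in> E"
      then show "(g x) \<in> C"
        using the by (fastforce simp: E_def C_def words_def strip_def good_def g_def)
    next
      fix y assume "y \<in> C"
      then obtain w ks \<alpha> where p: "y = (ks, w)" "good w" "path addL [] ks \<alpha>" "path addR \<alpha> w \<beta>"
        by (auto simp: C_def)
      then have "\<alpha> \<in> compositions" using path_addL_compositions[OF p(3)] by simp
      then have "(\<alpha>, ks) \<in> E" "y = (ks, THE w. good w \<and> path addR \<alpha> w \<beta>)"
        using p the by (auto simp: E_def words_def strip_def good_def)
      then show "\<exists>x\<in>E. y = (g x)"
        by (intro bexI[of _ "(\<alpha>, ks)"]) (auto simp: g_def)
    qed
    note sum.reindex_bij_betw[OF this, of "\<lambda>(ks, w). G (length ks) (descents ks)"]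
    moreover have "(\<Sum>(\<alpha>, ks)\<in>E. G (sum_list \<alpha>) (descents ks))
        = (\<Sum>x\<in>E. case g x of (ks, w) \<Rightarrow> G (length ks) (descents ks))"
      by (rule sum.cong) (auto simp: E_def words_length g_def)
    ultimately show ?thesis by simp
  qed
  also have "\<dots> = ?r"
  proof -
    have "finite {\<alpha> \<in> compositions. strip h n \<alpha> \<beta>}"
      by (rule finite_subset[OF _ finite_compositions_le[of "sum_list \<beta>"]])
        (auto simp: strip_def dest: sum_list_path_addR)
    then show ?thesis unfolding E_def by (subst sum.Sigma) (auto simp: finite_words)
  qed
  finally show ?thesis .
qed


section \<open>Compositions and fundamental quasisymmetric functions\<close>

definition ascent_set :: "nat multiset \<Rightarrow> nat set" where
  "ascent_set m = {j. 1 \<le> j \<and> j < size m \<and>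
     sorted_list_of_multiset m ! (j - 1) < sorted_list_of_multiset m ! j}"

text \<open>The fundamental function of degree N with descent set D, without a detour through
  compositions. Its coefficients are 0 or 1 because a monomial has just one weakly increasing
  arrangement.\<close>

definition fund :: "nat \<Rightarrow> nat set \<Rightarrow> pseries" where
  "fund N D m = (if size m = N \<and> D \<subseteq> ascent_set m then 1 else 0)"

lemma set_of_comp_Nil [simp]: "set_of_comp [] = {}"
  by (simp add: set_of_comp_def)

lemma set_of_comp_single [simp]: "set_of_comp [a] = {}"
  by (auto simp: set_of_comp_def)

lemma set_of_comp_Cons [simp]: "set_of_comp (a # b # \<gamma>) = insert a ((+) a ` set_of_comp (b # \<gamma>))"
proof -
  have "set_of_comp (a # \<delta>) = {a + sum_list (take k \<delta>) |k. k < length \<delta>}" for \<delta>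
  proof -
    have "(\<exists>k. v = sum_list (take k (a # \<delta>)) \<and> 1 \<le> k \<and> k < length (a # \<delta>)) \<longleftrightarrow>
      (\<exists>k. v = a + sum_list (take k \<delta>) \<and> k < length \<delta>)" for v
    proof
      assume "\<exists>k. v = sum_list (take k (a # \<delta>)) \<and> 1 \<le> k \<and> k < length (a # \<delta>)"
      then obtain k where "v = sum_list (take (Suc k) (a # \<delta>))" "Suc k < length (a # \<delta>)"
        by (metis Suc_le_D One_nat_def)
      then show "\<exists>k. v = a + sum_list (take k \<delta>) \<and> k < length \<delta>" by auto
    next
      assume "\<exists>k. v = a + sum_list (take k \<delta>) \<and> k < length \<delta>"
      then obtain k where "v = sum_list (take (Suc k) (a # \<delta>))" "Suc k < length (a # \<delta>)" by auto
      then show "\<exists>k. v = sum_list (take k (a # \<delta>)) \<and> 1 \<le> k \<and> k < length (a # \<delta>)"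
        by (metis One_nat_def Suc_le_mono zero_le)
    qed
    then show ?thesis by (simp add: set_of_comp_def)
  qed
  from this[of "b # \<gamma>"] show ?thesis
  proof (simp add: set_of_comp_def, intro set_eqI iffI)
    fix v assume "v \<in> {a + sum_list (take k (b # \<gamma>)) |k. k < Suc (length \<gamma>)}"
    then obtain k where k: "v = a + sum_list (take k (b # \<gamma>))" "k < Suc (length \<gamma>)" by auto
    show "v \<in> insert a ((+) a ` {sum_list (take k (b # \<gamma>)) |k. Suc 0 \<le> k \<and> k < Suc (length \<gamma>)})"
      using k by (cases "k = 0") (auto simp: image_iff)
  next
    fix v assume "v \<in> insert a ((+) a ` {sum_list (take k (b # \<gamma>)) |k. Suc 0 \<le> k \<and> k < Suc (length \<gamma>)})"
    then show "v \<in> {a + sum_list (take k (b # \<gamma>)) |k. k < Suc (length \<gamma>)}"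
      by (auto intro: exI[of _ 0])
  qed
qed

lemma compositions_Cons [simp]: "a # \<alpha> \<in> compositions \<longleftrightarrow> 1 \<le> a \<and> \<alpha> \<in> compositions"
  by (auto simp: compositions_def)

lemma compositions_Nil [simp]: "[] \<in> compositions"
  by (simp add: compositions_def)

lemma compositions_append [simp]: "\<alpha> @ \<beta> \<in> compositions \<longleftrightarrow> \<alpha> \<in> compositions \<and> \<beta> \<in> compositions"
  by (auto simp: compositions_def)

lemma sum_list_compositions_0: "\<alpha> \<in> compositions \<Longrightarrow> sum_list \<alpha> = 0 \<longleftrightarrow> \<alpha> = []"
  by (cases \<alpha>) auto

lemma set_of_comp_subset: "\<alpha> \<in> compositions \<Longrightarrow> set_of_comp \<alpha> \<subseteq> {1..<sum_list \<alpha>}"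
proof (induction \<alpha>)
  case (Cons a \<alpha>)
  then show ?case by (cases \<alpha>) (fastforce simp: image_iff)+
qed simp

lemma set_of_comp_inj:
  "\<alpha> \<in> compositions \<Longrightarrow> \<beta> \<in> compositions \<Longrightarrow> sum_list \<alpha> = sum_list \<beta> \<Longrightarrow>
    set_of_comp \<alpha> = set_of_comp \<beta> \<Longrightarrow> \<alpha> = \<beta>"
proof (induction \<alpha> arbitrary: \<beta>)
  case Nil
  then show ?case using sum_list_compositions_0[of \<beta>] by simp
next
  case (Cons a \<alpha>)
  then have "\<beta> \<noteq> []" by auto
  then obtain b \<beta>' where \<beta>: "\<beta> = b # \<beta>'" by (cases \<beta>) auto
  show ?case
  proof (cases \<alpha>)
    case Nil
    then show ?thesis using Cons.prems \<beta> by (cases \<beta>') auto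
  next
    case (Cons a' \<alpha>')
    then obtain b' \<beta>'' where \<beta>': "\<beta>' = b' # \<beta>''" using Cons.prems \<beta> by (cases \<beta>') auto
    have eq: "insert a ((+) a ` set_of_comp \<alpha>) = insert b ((+) b ` set_of_comp \<beta>')"
      using Cons.prems(4) unfolding \<beta> \<beta>' Cons by simp
    have pos: "\<forall>x\<in>set_of_comp \<alpha>. 1 \<le> x" "\<forall>x\<in>set_of_comp \<beta>'. 1 \<le> x"
      using Cons.prems(1,2) set_of_comp_subset[of \<alpha>] set_of_comp_subset[of \<beta>'] \<beta> by auto
    have "a \<in> insert b ((+) b ` set_of_comp \<beta>')" "b \<in> insert a ((+) a ` set_of_comp \<alpha>)" using eq by auto
    then have "a = b" by auto
    moreover have "a \<notin> (+) a ` set_of_comp \<alpha>" "a \<notin> (+) a ` set_of_comp \<beta>'" using pos by auto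
    ultimately have "(+) a ` set_of_comp \<alpha> = (+) a ` set_of_comp \<beta>'"
      using eq by (metis insert_ident)
    then have "set_of_comp \<alpha> = set_of_comp \<beta>'" by (simp add: inj_image_eq_iff)
    then show ?thesis using Cons.IH[of \<beta>'] Cons.prems \<beta> \<open>a = b\<close> by simp
  qed
qed

lemma comp_of_set:
  assumes "D \<subseteq> {1..<N}"
  shows "comp_of_set N D \<in> compositions" "sum_list (comp_of_set N D) = N"
    "set_of_comp (comp_of_set N D) = D"
proof -
  have "comp_of_set N D \<in> compositions \<and> sum_list (comp_of_set N D) = N \<and> set_of_comp (comp_of_set N D) = D"
  proof (cases "N = 0")
    case True
    then show ?thesis using assms by (simp add: comp_of_set_def)
  next
    case False
    have fin: "finite D" using assms finite_subset by blast
    define s where "s = sorted_list_of_set D"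
    \<comment> \<open>All partial sums, including 0 and N; the parts are their successive
      differences, so sums of parts telescope.\<close>
    define P where "P = 0 # s @ [N]"
    define c where "c = comp_of_set N D"
    have c: "c = map (\<lambda>(a, b). b - a) (zip (0 # s) (s @ [N]))"
      using False by (simp add: c_def comp_of_set_def s_def Let_def)
    have s: "set s = D" "sorted_wrt (<) s"
      using fin by (simp_all add: s_def strict_sorted_list_of_set)
    have P: "sorted_wrt (<) P" using s assms False by (auto simp: P_def sorted_wrt_append)
    have len: "length c = Suc (length s)" using c by simp
    have nth: "c ! k = P ! Suc k - P ! k" if "k < length c" for k
      using that len by (auto simp: c P_def nth_append nth_Cons')
    have mono: "P ! k < P ! Suc k" if "k < length c" for k
      using sorted_wrt_nth_less[OF P, of k "Suc k"] that len by (simp add: P_def)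
    have partial: "k \<le> length c \<Longrightarrow> sum_list (take k c) = P ! k" for k
    proof (induction k)
      case (Suc k)
      then show ?case using nth[of k] mono[of k] by (simp add: take_Suc_conv_app_nth)
    qed (simp add: P_def)
    have "0 \<notin> set c" using nth mono by (fastforce simp: in_set_conv_nth)
    moreover have "sum_list c = N" using partial[of "length c"] len by (simp add: P_def nth_append)
    moreover have "set_of_comp c = set s"
    proof -
      have "set_of_comp c = {P ! k |k. 1 \<le> k \<and> k < length c}"
        unfolding set_of_comp_def using partial by (metis (no_types, lifting) less_imp_le)
      also have "\<dots> = {s ! k |k. k < length s}"
      proof -
        have "P ! Suc k = s ! k" if "k < length s" for k
          using that by (simp add: P_def nth_append)
        then show ?thesis unfolding len
          by (metis (no_types, opaque_lifting) Suc_le_D Suc_le_mono Suc_less_eq One_nat_def zero_le)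
      qed
      finally show ?thesis by (simp add: set_conv_nth)
    qed
    ultimately show ?thesis using s by (simp add: c_def compositions_def)
  qed
  then show "comp_of_set N D \<in> compositions" "sum_list (comp_of_set N D) = N"
    "set_of_comp (comp_of_set N D) = D" by auto
qed

lemma fundamental_eq: "\<alpha> \<in> compositions \<Longrightarrow> fundamental \<alpha> = fund (sum_list \<alpha>) (set_of_comp \<alpha>)"
proof
  fix m :: "nat multiset"
  assume \<alpha>: "\<alpha> \<in> compositions"
  define s where "s = sorted_list_of_multiset m"
  have "length s = size m" unfolding s_def by (metis mset_sorted_list_of_multiset size_mset)
  define A where "A = {is. length is = sum_list \<alpha> \<and> sorted is \<and>
       (\<forall>j\<in>set_of_comp \<alpha>. is ! (j - 1) < is ! j) \<and> mset is = m}"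
  have sorted: "sorted x \<and> mset x = m \<longleftrightarrow> x = s" for x
    unfolding s_def by (metis mset_sorted_list_of_multiset sorted_sorted_list_of_multiset
        sorted_list_of_multiset_mset sorted_sort_id)
  have "x \<in> A \<longleftrightarrow> x = s \<and> length x = sum_list \<alpha> \<and> (\<forall>j\<in>set_of_comp \<alpha>. x ! (j - 1) < x ! j)" for x
    unfolding A_def using sorted[of x] by blast
  then have "A = (if length s = sum_list \<alpha> \<and> (\<forall>j\<in>set_of_comp \<alpha>. s ! (j - 1) < s ! j) then {s} else {})"
    by (intro set_eqI) auto
  moreover have "size m = sum_list \<alpha> \<Longrightarrow>
      set_of_comp \<alpha> \<subseteq> ascent_set m \<longleftrightarrow> (\<forall>j\<in>set_of_comp \<alpha>. s ! (j - 1) < s ! j)"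
    using set_of_comp_subset[OF \<alpha>] by (fastforce simp: ascent_set_def s_def)
  ultimately have "A = (if size m = sum_list \<alpha> \<and> set_of_comp \<alpha> \<subseteq> ascent_set m then {s} else {})"
    using \<open>length s = size m\<close> by auto
  then show "fundamental \<alpha> m = fund (sum_list \<alpha>) (set_of_comp \<alpha>) m"
    by (simp add: fundamental_def fund_def A_def)
qed

lemma fundamental_comp_of_set: "D \<subseteq> {1..<N} \<Longrightarrow> fundamental (comp_of_set N D) = fund N D"
  by (simp add: fundamental_eq comp_of_set)

section \<open>Concatenation and near-concatenation in terms of partial sums\<close>

lemma set_of_comp_append:
  "\<beta> \<noteq> [] \<Longrightarrow> \<gamma> \<noteq> [] \<Longrightarrow>
    set_of_comp (\<beta> @ \<gamma>) = set_of_comp \<beta> \<union> {sum_list \<beta>} \<union> (+) (sum_list \<beta>) ` set_of_comp \<gamma>"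
proof (induction \<beta>)
  case (Cons a \<beta>)
  then obtain c \<gamma>' where \<gamma>: "\<gamma> = c # \<gamma>'" by (cases \<gamma>) auto
  show ?case
  proof (cases \<beta>)
    case Nil
    then show ?thesis using \<gamma> by simp
  next
    case (Cons b \<beta>')
    then have "set_of_comp ((a # \<beta>) @ \<gamma>) = insert a ((+) a ` set_of_comp (\<beta> @ \<gamma>))" by simp
    also have "\<dots> = set_of_comp (a # \<beta>) \<union> {sum_list (a # \<beta>)}
        \<union> (+) (sum_list (a # \<beta>)) ` set_of_comp \<gamma>"
      using Cons.IH Cons Cons.prems by (simp add: image_Un image_image add.assoc insert_commute)
    finally show ?thesis .
  qed
qed simp

lemma near_concat_Cons: "\<beta> \<noteq> [] \<Longrightarrow> near_concat (a # \<beta>) \<gamma> = a # near_concat \<beta> \<gamma>"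
  by (simp add: near_concat_def)

lemma near_concat_not_Nil: "near_concat \<beta> \<gamma> \<noteq> []"
  by (simp add: near_concat_def)

lemma near_concat_single: "near_concat [a] (c # \<gamma>) = (a + c) # \<gamma>"
  by (simp add: near_concat_def)

lemma near_concat_properties:
  "\<beta> \<noteq> [] \<Longrightarrow> \<gamma> \<noteq> [] \<Longrightarrow> \<beta> \<in> compositions \<Longrightarrow> \<gamma> \<in> compositions \<Longrightarrow>
    near_concat \<beta> \<gamma> \<in> compositions \<and> sum_list (near_concat \<beta> \<gamma>) = sum_list \<beta> + sum_list \<gamma> \<and>
    set_of_comp (near_concat \<beta> \<gamma>) = set_of_comp \<beta> \<union> (+) (sum_list \<beta>) ` set_of_comp \<gamma>"
proof (induction \<beta>)
  case (Cons a \<beta>)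
  then obtain c \<gamma>' where \<gamma>: "\<gamma> = c # \<gamma>'" by (cases \<gamma>) auto
  show ?case
  proof (cases \<beta>)
    case Nil
    have "set_of_comp ((a + c) # \<gamma>') = (+) a ` set_of_comp (c # \<gamma>')"
      by (cases \<gamma>') (auto simp: image_image add.assoc)
    then show ?thesis using Nil \<gamma> Cons.prems by (simp add: near_concat_single)
  next
    case (Cons b \<beta>')
    then have ne: "\<beta> \<noteq> []" by simp
    obtain d \<delta> where d: "near_concat \<beta> \<gamma> = d # \<delta>" using near_concat_not_Nil by (meson neq_Nil_conv)
    have IH: "d # \<delta> \<in> compositions" "sum_list (d # \<delta>) = sum_list \<beta> + sum_list \<gamma>"
      "set_of_comp (d # \<delta>) = set_of_comp \<beta> \<union> (+) (sum_list \<beta>) ` set_of_comp \<gamma>"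
      using Cons.IH[OF ne] Cons.prems d by auto
    have "set_of_comp (a # d # \<delta>) = insert a ((+) a ` set_of_comp (d # \<delta>))" by simp
    also have "\<dots> = set_of_comp (a # \<beta>) \<union> (+) (sum_list (a # \<beta>)) ` set_of_comp \<gamma>"
      unfolding IH(3) using Cons by (simp add: image_Un image_image add.assoc)
    finally show ?thesis
      using IH(1,2) Cons.prems near_concat_Cons[OF ne, of a \<gamma>] d by simp
  qed
qed simp

text \<open>Both kinds of splitting cut the partial sums of \<alpha> at the size b of \<beta>.
  Concatenation has b among the partial sums, near-concatenation has not; the condition 1 \<le> v
  leaves b unrestricted and so covers both at once.\<close>

lemma deconcat_iff:
  assumes \<alpha>: "\<alpha> \<in> compositions" and \<beta>: "\<beta> \<in> compositions" and \<gamma>: "\<gamma> \<in> compositions"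
  shows "(\<beta>, \<gamma>) \<in> deconcat \<alpha> \<longleftrightarrow> sum_list \<beta> + sum_list \<gamma> = sum_list \<alpha> \<and>
    set_of_comp \<beta> = set_of_comp \<alpha> \<inter> {..<sum_list \<beta>} \<and>
    (\<forall>v. 1 \<le> v \<longrightarrow> v \<in> set_of_comp \<gamma> \<longleftrightarrow> sum_list \<beta> + v \<in> set_of_comp \<alpha>)"
    (is "?l \<longleftrightarrow> ?r")
proof (cases "\<beta> = [] \<or> \<gamma> = []")
  case True
  \<comment> \<open>If one factor is empty, b is 0 or the full size. Neither is a proper partial
    sum, and concatenation is the only splitting.\<close>
  have bounds: "set_of_comp \<alpha> \<subseteq> {1..<sum_list \<alpha>}" "set_of_comp \<beta> \<subseteq> {1..<sum_list \<beta>}"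
    "set_of_comp \<gamma> \<subseteq> {1..<sum_list \<gamma>}"
    using \<alpha> \<beta> \<gamma> set_of_comp_subset by auto
  have l: "?l \<longleftrightarrow> \<beta> @ \<gamma> = \<alpha>" using True \<beta> \<gamma> by (auto simp: deconcat_def)
  show ?thesis
  proof (cases "\<beta> = []")
    case True
    have "?r \<longleftrightarrow> sum_list \<gamma> = sum_list \<alpha> \<and> set_of_comp \<gamma> = set_of_comp \<alpha>"
      using True bounds by (auto simp: Suc_le_eq)
    then show ?thesis using l True set_of_comp_inj[OF \<gamma> \<alpha>] by auto
  next
    case False
    then have g: "\<gamma> = []" using \<open>\<beta> = [] \<or> \<gamma> = []\<close> by simp
    have "?r \<longleftrightarrow> sum_list \<beta> = sum_list \<alpha> \<and> set_of_comp \<beta> = set_of_comp \<alpha>"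
      using g bounds by fastforce
    then show ?thesis using l g set_of_comp_inj[OF \<beta> \<alpha>] by auto
  qed
next
  case False
  define b where "b = sum_list \<beta>"
  have bounds: "set_of_comp \<beta> \<subseteq> {1..<b}" "set_of_comp \<gamma> \<subseteq> {1..<sum_list \<gamma>}"
    using \<beta> \<gamma> set_of_comp_subset by (auto simp: b_def)
  have n: "near_concat \<beta> \<gamma> \<in> compositions" "sum_list (near_concat \<beta> \<gamma>) = b + sum_list \<gamma>"
    "set_of_comp (near_concat \<beta> \<gamma>) = set_of_comp \<beta> \<union> (+) b ` set_of_comp \<gamma>"
    using near_concat_properties[of \<beta> \<gamma>] False \<beta> \<gamma> by (auto simp: b_def)
  have c: "\<beta> @ \<gamma> \<in> compositions" "sum_list (\<beta> @ \<gamma>) = b + sum_list \<gamma>"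
    "set_of_comp (\<beta> @ \<gamma>) = set_of_comp \<beta> \<union> {b} \<union> (+) b ` set_of_comp \<gamma>"
    using set_of_comp_append[of \<beta> \<gamma>] False \<beta> \<gamma> by (auto simp: b_def)
  have "?l \<longleftrightarrow> \<beta> @ \<gamma> = \<alpha> \<or> near_concat \<beta> \<gamma> = \<alpha>" using False \<beta> \<gamma> by (simp add: deconcat_def)
  also have "\<dots> \<longleftrightarrow> b + sum_list \<gamma> = sum_list \<alpha> \<and>
      (set_of_comp \<alpha> = set_of_comp \<beta> \<union> {b} \<union> (+) b ` set_of_comp \<gamma> \<or>
       set_of_comp \<alpha> = set_of_comp \<beta> \<union> (+) b ` set_of_comp \<gamma>)"
    using set_of_comp_inj[OF c(1) \<alpha>] set_of_comp_inj[OF n(1) \<alpha>] c n by metis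
  also have "\<dots> \<longleftrightarrow> ?r"
  proof -
    have "(X = B \<union> {b} \<union> (+) b ` C \<or> X = B \<union> (+) b ` C) \<longleftrightarrow>
      B = X \<inter> {..<b} \<and> (\<forall>v. 1 \<le> v \<longrightarrow> v \<in> C \<longleftrightarrow> b + v \<in> X)"
      if "B \<subseteq> {1..<b}" "C \<subseteq> {1..<g}" for X B C and g :: nat
    proof
      assume "X = B \<union> {b} \<union> (+) b ` C \<or> X = B \<union> (+) b ` C"
      then show "B = X \<inter> {..<b} \<and> (\<forall>v. 1 \<le> v \<longrightarrow> v \<in> C \<longleftrightarrow> b + v \<in> X)"
        using that by (auto simp: image_iff)
    next
      assume *: "B = X \<inter> {..<b} \<and> (\<forall>v. 1 \<le> v \<longrightarrow> v \<in> C \<longleftrightarrow> b + v \<in> X)"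
      have other: "x \<in> X \<longleftrightarrow> x \<in> B \<or> x \<in> (+) b ` C" if "x \<noteq> b" for x
      proof (cases "x < b")
        case True
        then show ?thesis using * by auto
      next
        case False
        have "x = b + (x - b)" "1 \<le> x - b" using that False by auto
        moreover have "x \<in> (+) b ` C \<longleftrightarrow> x - b \<in> C"
          using False by (auto intro!: image_eqI[of _ _ "x - b"])
        moreover have "x - b \<in> C \<longleftrightarrow> b + (x - b) \<in> X" using * calculation(2) by blast
        moreover have "x \<notin> B" using * False by blast
        ultimately show ?thesis by simp
      qed
      moreover have "b \<notin> B" "b \<notin> (+) b ` C" using that by auto
      ultimately show "X = B \<union> {b} \<union> (+) b ` C \<or> X = B \<union> (+) b ` C"
      proof (cases "b \<in> X")
        case True
        then have "x \<in> X \<longleftrightarrow> x \<in> B \<union> {b} \<union> (+) b ` C" for x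
          using other[of x] by (cases "x = b") auto
        then show ?thesis by blast
      next
        case False
        then have "x \<in> X \<longleftrightarrow> x \<in> B \<union> (+) b ` C" for x
          using other[of x] \<open>b \<notin> B\<close> \<open>b \<notin> (+) b ` C\<close> by (cases "x = b") auto
        then show ?thesis by blast
      qed
    qed
    from this[OF bounds, of "set_of_comp \<alpha>"] show ?thesis by (simp only: b_def[symmetric])
  qed
  finally show ?thesis .
qed


section \<open>Composition tableaux as words\<close>

fun fill_word :: "nat \<Rightarrow> nat list \<Rightarrow> nat list \<Rightarrow> nat list list \<Rightarrow> nat list list" where
  "fill_word N [] \<beta> T = T"
| "fill_word N (k # ks) \<beta> T = fill_word N ks (addL k \<beta>) (fill_box k \<beta> (N - sum_list \<beta>) T)"

lemma fill_word_snoc: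
  "path addL \<alpha> ks \<beta> \<Longrightarrow>
    fill_word N (ks @ [k]) \<alpha> T = fill_box k \<beta> (N - sum_list \<beta>) (fill_word N ks \<alpha> T)"
  by (induction ks arbitrary: \<alpha> T) auto

lemma path_snoc: "path f \<alpha> (ks @ [k]) \<gamma> \<longleftrightarrow> (\<exists>\<beta>. path f \<alpha> ks \<beta> \<and> addable k \<beta> \<and> \<gamma> = f k \<beta>)"
  by (auto simp: path_append)

lemma words_snoc: "ks @ [k] \<in> words \<gamma> \<longleftrightarrow> (\<exists>\<beta>. ks \<in> words \<beta> \<and> addable k \<beta> \<and> \<gamma> = addL k \<beta>)"
  by (simp add: words_def path_snoc)

lemma chain_filling_iff: "chain_filling N \<beta> T \<longleftrightarrow> (\<exists>ks\<in>words \<beta>. T = fill_word N ks [] [])"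
proof
  assume "chain_filling N \<beta> T"
  then show "\<exists>ks\<in>words \<beta>. T = fill_word N ks [] []"
  proof (induction rule: chain_filling.induct)
    case empty
    show ?case by (intro bexI[of _ "[]"]) (simp_all add: words_def)
  next
    case (step \<beta> T i \<alpha>)
    then obtain ks where ks: "ks \<in> words \<beta>" "T = fill_word N ks [] []" by blast
    have "addable i \<beta>" "\<alpha> = addL i \<beta>" using step by (auto simp: op_t_eq split: if_splits)
    then show ?case using ks fill_word_snoc[of "[]" ks \<beta> N i "[]"]
      by (intro bexI[of _ "ks @ [i]"]) (auto simp: words_snoc, simp add: words_def)
  qed
next
  have "ks \<in> words \<beta> \<Longrightarrow> chain_filling N \<beta> (fill_word N ks [] [])" for ks
  proof (induction ks arbitrary: \<beta> rule: rev_induct)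
    case Nil
    then show ?case by (simp add: words_def chain_filling.empty)
  next
    case (snoc k ks)
    then obtain \<gamma> where \<gamma>: "ks \<in> words \<gamma>" "addable k \<gamma>" "\<beta> = addL k \<gamma>" by (auto simp: words_snoc)
    then have "chain_filling N \<beta> (fill_box k \<gamma> (N - sum_list \<gamma>) (fill_word N ks [] []))"
      using addable_ge1[OF \<gamma>(2)] snoc.IH[OF \<gamma>(1)]
      by (intro chain_filling.step) (auto simp: op_t_eq)
    then show ?case using \<gamma> fill_word_snoc[of "[]" ks \<gamma>] by (simp add: words_def)
  qed
  then show "\<exists>ks\<in>words \<beta>. T = fill_word N ks [] [] \<Longrightarrow> chain_filling N \<beta> T" by blast
qed

text \<open>The box with entry \<open>N - x\<close> is the one added in step \<open>x\<close>, hence lies in column \<open>ks ! x\<close>.\<close>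

definition records :: "nat \<Rightarrow> nat list \<Rightarrow> nat list list \<Rightarrow> bool" where
  "records N ks T \<longleftrightarrow>
     (\<forall>r<length T. \<forall>c<length (T ! r). \<exists>x<length ks. T ! r ! c = N - x \<and> ks ! x = Suc c) \<and>
     (\<forall>x<length ks. \<exists>r<length T. \<exists>c<length (T ! r). T ! r ! c = N - x \<and> ks ! x = Suc c)"

text \<open>Shape and record are proved together: the new box lands in column k because the row
  chosen by \<open>leftmost\<close> has length k - 1.\<close>

lemma records_fill_word:
  "ks \<in> words \<beta> \<Longrightarrow> map length (fill_word N ks [] []) = \<beta> \<and> records N ks (fill_word N ks [] [])"
proof (induction ks arbitrary: \<beta> rule: rev_induct)
  case Nil
  then show ?case by (simp add: words_def records_def)
next
  case (snoc k ks)
  then obtain \<gamma> where \<gamma>: "ks \<in> words \<gamma>" "addable k \<gamma>" "\<beta> = addL k \<gamma>" by (auto simp: words_snoc)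
  define T where "T = fill_word N ks [] []"
  define v where "v = N - length ks"
  have T: "map length T = \<gamma>" "records N ks T" using snoc.IH[OF \<gamma>(1)] by (auto simp: T_def)
  then have len: "length T = length \<gamma>" by auto
  have k1: "1 \<le> k" by (rule addable_ge1[OF \<gamma>(2)])
  have eq: "fill_word N (ks @ [k]) [] [] = fill_box k \<gamma> v T"
    using \<gamma>(1) fill_word_snoc[of "[]" ks \<gamma> N k "[]"] words_length[OF \<gamma>(1)]
    by (simp add: words_def T_def v_def)
  have old: "\<exists>x<length (ks @ [k]). w = N - x \<and> (ks @ [k]) ! x = Suc c"
    if "\<exists>x<length ks. w = N - x \<and> ks ! x = Suc c" for w c
    using that by (metis length_append less_Suc_eq length_append_singleton nth_append)
  have new: "\<exists>x<length (ks @ [k]). v = N - x \<and> (ks @ [k]) ! x = k"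
    by (intro exI[of _ "length ks"]) (simp add: v_def)
  show ?case
  proof (cases "k = 1")
    case True
    then have T': "fill_box k \<gamma> v T = [v] # T" by (simp add: fill_box_def)
    have "records N (ks @ [k]) ([v] # T)"
      unfolding records_def
    proof (intro conjI allI impI)
      fix r c assume "r < length ([v] # T)" "c < length (([v] # T) ! r)"
      then show "\<exists>x<length (ks @ [k]). ([v] # T) ! r ! c = N - x \<and> (ks @ [k]) ! x = Suc c"
        using T(2) old new True by (cases r) (auto simp: records_def)
    next
      fix x assume "x < length (ks @ [k])"
      show "\<exists>r<length ([v] # T). \<exists>c<length (([v] # T) ! r).
          ([v] # T) ! r ! c = N - x \<and> (ks @ [k]) ! x = Suc c"
      proof (cases "x < length ks")
        case True
        then obtain r c where "r < length T" "c < length (T ! r)" "T ! r ! c = N - x" "ks ! x = Suc c"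
          using T(2) by (auto simp: records_def)
        then show ?thesis using True
          by (intro exI[of _ "Suc r"] exI[of _ c] conjI) (auto simp: nth_append)
      next
        case False
        then have "x = length ks" using \<open>x < length (ks @ [k])\<close> by simp
        then show ?thesis using \<open>k = 1\<close> by (intro exI[of _ 0]) (simp add: v_def)
      qed
    qed
    then show ?thesis using eq T' T(1) \<gamma>(3) True by (simp add: addL_def)
  next
    case False
    then have k2: "2 \<le> k" "k - 1 \<in> set \<gamma>" using \<gamma>(2) by (auto simp: addable_def)
    define r0 where "r0 = leftmost (k - 1) \<gamma>"
    have r0: "r0 < length \<gamma>" "\<gamma> ! r0 = k - 1"
    proof -
      have "\<exists>j. j < length \<gamma> \<and> \<gamma> ! j = k - 1" using k2(2) by (auto simp: in_set_conv_nth)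
      from LeastI_ex[OF this] show "r0 < length \<gamma>" "\<gamma> ! r0 = k - 1"
        by (auto simp: r0_def leftmost_def)
    qed
    have T': "fill_box k \<gamma> v T = T[r0 := T ! r0 @ [v]]"
      using False by (simp add: fill_box_def r0_def Let_def)
    have "length (T ! r0) = k - 1" using r0 T(1) len by (metis nth_map)
    then have row: "length (T ! r0) = k - 1" "length (T ! r0 @ [v]) = k" using k2(1) by auto
    have "addL k \<gamma> = \<gamma>[r0 := k]"
      using op_t_eq[OF k1, of \<gamma>] \<gamma>(2) False k2 by (simp add: op_t_def r0_def split: if_splits)
    then have shape: "map length (T[r0 := T ! r0 @ [v]]) = \<beta>"
      using T(1) row(2) \<gamma>(3) by (simp add: map_update)
    have "records N (ks @ [k]) (T[r0 := T ! r0 @ [v]])"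
      unfolding records_def
    proof (intro conjI allI impI)
      fix r c assume rc: "r < length (T[r0 := T ! r0 @ [v]])" "c < length (T[r0 := T ! r0 @ [v]] ! r)"
      show "\<exists>x<length (ks @ [k]). T[r0 := T ! r0 @ [v]] ! r ! c = N - x \<and> (ks @ [k]) ! x = Suc c"
      proof (cases "r = r0 \<and> c = k - 1")
        case True
        then have "T[r0 := T ! r0 @ [v]] ! r ! c = v" using r0 len row by (simp add: nth_append)
        then show ?thesis using new True k2 by simp
      next
        case False
        then have "r < length T" "c < length (T ! r)" "T[r0 := T ! r0 @ [v]] ! r ! c = T ! r ! c"
          using rc r0 len row by (auto simp: nth_list_update nth_append split: if_splits)
        then show ?thesis using T(2) by (intro old) (auto simp: records_def)
      qed
    next
      fix x assume x: "x < length (ks @ [k])"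
      show "\<exists>r<length (T[r0 := T ! r0 @ [v]]). \<exists>c<length (T[r0 := T ! r0 @ [v]] ! r).
          T[r0 := T ! r0 @ [v]] ! r ! c = N - x \<and> (ks @ [k]) ! x = Suc c"
      proof (cases "x < length ks")
        case True
        then obtain r c where rc: "r < length T" "c < length (T ! r)" "T ! r ! c = N - x" "ks ! x = Suc c"
          using T(2) by (auto simp: records_def)
        then have "c < length (T[r0 := T ! r0 @ [v]] ! r)" "T[r0 := T ! r0 @ [v]] ! r ! c = N - x"
          by (cases "r = r0"; simp add: nth_append)+
        then show ?thesis using rc True by (intro exI[of _ r] exI[of _ c]) (auto simp: nth_append)
      next
        case False
        then have "x = length ks" using x by simp
        then show ?thesis using r0 len row k2
          by (intro exI[of _ r0] exI[of _ "k - 1"] conjI) (auto simp: v_def nth_append)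
      qed
    qed
    then show ?thesis using eq T' shape by simp
  qed
qed

text \<open>The entries N - x are distinct for these x, which makes the definite description in
  \<open>column\<close> succeed. \<open>Suc\<close> mediates between columns counted from 0 and
  letters counted from 1.\<close>

lemma column_records:
  assumes "records N ks T" "length ks \<le> N" "x < length ks"
  shows "Suc (column T (N - x)) = ks ! x"
proof -
  obtain r c where rc: "r < length T" "c < length (T ! r)" "T ! r ! c = N - x" "ks ! x = Suc c"
    using assms by (auto simp: records_def)
  have "column T (N - x) = c"
    unfolding column_def
  proof (rule the_equality)
    fix c' assume "\<exists>r<length T. c' < length (T ! r) \<and> T ! r ! c' = N - x"
    then obtain y where y: "y < length ks" "N - x = N - y" "ks ! y = Suc c'"
      using assms(1) unfolding records_def by metis
    then have "x = y" using assms(2,3) by auto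
    then show "c' = c" using y rc by simp
  qed (use rc in blast)
  then show ?thesis using rc by simp
qed

text \<open>The columns of the entries give the word back, so tableaux and words correspond
  bijectively and no term is merged with another.\<close>

lemma qschur_eq: "qschur \<beta> = (\<Sum>ks\<in>words \<beta>. fund (sum_list \<beta>) (descents ks))"
proof -
  define N where "N = sum_list \<beta>"
  define fil where "fil ks = fill_word N ks [] []" for ks
  have rec: "records N ks (fil ks)" "length (concat (fil ks)) = N" "length ks = N" if "ks \<in> words \<beta>" for ks
    using records_fill_word[OF that, of N] words_length[OF that]
    by (auto simp: N_def fil_def length_concat)
  have "inj_on fil (words \<beta>)"
  proof (rule inj_onI)
    fix ks ks' assume *: "ks \<in> words \<beta>" "ks' \<in> words \<beta>" "fil ks = fil ks'"
    have "ks ! x = ks' ! x" if "x < N" for x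
      using column_records[OF rec(1)[OF *(1)], of x] column_records[OF rec(1)[OF *(2)], of x]
        rec(3) * that by simp
    then show "ks = ks'" using rec(3) * by (intro nth_equalityI) auto
  qed
  moreover have "SCT \<beta> = fil ` words \<beta>"
    by (auto simp: SCT_def chain_filling_iff N_def fil_def)
  moreover have "fundamental (comp_tableau (fil ks)) = fund N (descents ks)" if ks: "ks \<in> words \<beta>" for ks
  proof -
    have "column (fil ks) i \<le> column (fil ks) (i + 1) \<longleftrightarrow> ks ! (N - i) \<le> ks ! (N - i - 1)"
      if i: "1 \<le> i" "i < N" for i
    proof -
      have "Suc (column (fil ks) i) = ks ! (N - i)"
        using column_records[OF rec(1)[OF ks], of "N - i"] rec(3)[OF ks] i by simp
      moreover have "Suc (column (fil ks) (i + 1)) = ks ! (N - i - 1)"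
        using column_records[OF rec(1)[OF ks], of "N - i - 1"] rec(3)[OF ks] i by (simp add: Suc_diff_Suc)
      ultimately show ?thesis by linarith
    qed
    then have "Des (fil ks) = descents ks"
      using rec[OF ks] by (auto simp: Des_def descents_def)
    moreover have "descents ks \<subseteq> {1..<N}" using rec[OF ks] by (auto simp: descents_def)
    ultimately show ?thesis
      using rec[OF ks] by (simp add: comp_tableau_def fundamental_comp_of_set)
  qed
  ultimately show ?thesis
    unfolding qschur_def N_def[symmetric] by (simp add: sum.reindex)
qed


section \<open>Bases of the quasisymmetric functions\<close>

lemma sum_apply: "(\<Sum>i\<in>I. f i) x = (\<Sum>i\<in>I. f i x)" for f :: "'i \<Rightarrow> 'a \<Rightarrow> 'b::comm_monoid_add"
  by (induction I rule: infinite_finite_induct) auto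

lemma cscale_apply [simp]: "cscale c f x = c * f x"
  by (simp add: cscale_def)

text \<open>Substitution along r: the equation for j involves only the unknown at j and those at
  predecessors of j, so well-founded recursion solves it.\<close>

lemma triangular_solvable:
  fixes a :: "'i \<Rightarrow> 'i \<Rightarrow> complex"
  assumes "wf r" "finite I" "\<And>i. i \<in> I \<Longrightarrow> a i i \<noteq> 0"
    and "\<And>i j. i \<in> I \<Longrightarrow> j \<in> I \<Longrightarrow> a i j \<noteq> 0 \<Longrightarrow> i = j \<or> (i, j) \<in> r"
  shows "\<exists>c. \<forall>j\<in>I. (\<Sum>i\<in>I. c i * a i j) = v j"
proof -
  define F where "F c j = (v j - (\<Sum>i | i \<in> I \<and> (i, j) \<in> r. c i * a i j)) / a j j" for c j
  define c where "c = wfrec r F"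
  have c: "c j = F c j" for j
  proof -
    have "c j = F (cut c r j) j" unfolding c_def by (rule wfrec[OF assms(1)])
    also have "\<dots> = F c j" unfolding F_def by (auto intro!: arg_cong2[where f = "(/)"] sum.cong simp: cut_apply)
    finally show ?thesis .
  qed
  have "(\<Sum>i\<in>I. c i * a i j) = v j" if j: "j \<in> I" for j
  proof -
    have "(j, j) \<notin> r" using assms(1) by (rule wf_irrefl) blast
    have "(\<Sum>i\<in>I. c i * a i j) = (\<Sum>i\<in>insert j {i. i \<in> I \<and> (i, j) \<in> r}. c i * a i j)"
      using assms(2,4) j by (intro sum.mono_neutral_right) auto
    also have "\<dots> = c j * a j j + (\<Sum>i | i \<in> I \<and> (i, j) \<in> r. c i * a i j)"
      using \<open>(j, j) \<notin> r\<close> assms(2) by simp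
    also have "c j * a j j = v j - (\<Sum>i | i \<in> I \<and> (i, j) \<in> r. c i * a i j)"
      using assms(3)[OF j] by (subst c) (simp add: F_def)
    finally show ?thesis by simp
  qed
  then show ?thesis by blast
qed

lemma triangular_independent:
  fixes a :: "'i \<Rightarrow> 'i \<Rightarrow> complex"
  assumes "wf r" "finite I" "\<And>i. i \<in> I \<Longrightarrow> a i i \<noteq> 0"
    and "\<And>i j. i \<in> I \<Longrightarrow> j \<in> I \<Longrightarrow> a i j \<noteq> 0 \<Longrightarrow> i = j \<or> (i, j) \<in> r"
    and "\<And>j. j \<in> I \<Longrightarrow> (\<Sum>i\<in>I. c i * a i j) = 0"
  shows "j \<in> I \<Longrightarrow> c j = 0"
  using assms(1)
proof (induction j rule: wf_induct_rule)
  case (less j)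
  have "(\<Sum>i\<in>I. c i * a i j) = (\<Sum>i\<in>{j}. c i * a i j)"
    using assms(2,4) less by (intro sum.mono_neutral_right) force+
  then show ?case using assms(3,5) less.prems by simp
qed

section \<open>Quasisymmetry and one test monomial for each composition\<close>

definition quasisymmetric :: "pseries \<Rightarrow> bool" where
  "quasisymmetric f \<longleftrightarrow> (\<forall>m \<phi>. strict_mono_on (set_mset m) \<phi> \<longrightarrow> f (image_mset \<phi> m) = f m)"

text \<open>This set turns out to be \<open>QSym\<close>. In this form, closure under products is a
  statement about coefficients and involves no product formula for fundamental functions.\<close>

definition bounded_quasisymmetric :: "pseries set" where
  "bounded_quasisymmetric = {f. quasisymmetric f \<and> (\<exists>N. \<forall>m. N \<le> size m \<longrightarrow> f m = 0)}"

text \<open>The variable index at position j is the number of rises up to j. So the sorted list of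
  indices starts at 0 and goes up by one exactly at the positions in D, if D lies in
  \<open>{1..<N}\<close>.\<close>

definition pattern_monomial :: "nat \<Rightarrow> nat set \<Rightarrow> nat multiset" where
  "pattern_monomial N D = mset (map (\<lambda>j. card {d \<in> D. d \<le> j}) [0..<N])"

lemma size_pattern_monomial [simp]: "size (pattern_monomial N D) = N"
  by (simp add: pattern_monomial_def)

lemma ascent_set_pattern_monomial:
  assumes "D \<subseteq> {1..<N}"
  shows "ascent_set (pattern_monomial N D) = D"
proof -
  define x where "x j = card {d \<in> D. d \<le> j}" for j
  have fin: "finite {d \<in> D. d \<le> j}" for j by (rule finite_subset[of _ "{..j}"]) auto
  have "sorted (map x [0..<N])"
    unfolding x_def by (auto simp: sorted_iff_nth_mono intro!: card_mono[OF fin])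
  then have s: "sorted_list_of_multiset (pattern_monomial N D) = map x [0..<N]"
    by (simp only: pattern_monomial_def x_def[symmetric] sorted_list_of_multiset_mset sorted_sort_id)
  have step: "x (j - 1) < x j \<longleftrightarrow> j \<in> D" if "1 \<le> j" for j
  proof (cases "j \<in> D")
    case True
    have "j \<notin> {d \<in> D. d \<le> j - 1}" "j \<in> {d \<in> D. d \<le> j}" using True that by auto
    moreover have "{d \<in> D. d \<le> j - 1} \<subseteq> {d \<in> D. d \<le> j}" by auto
    ultimately have "{d \<in> D. d \<le> j - 1} \<subset> {d \<in> D. d \<le> j}" by blast
    then show ?thesis using True psubset_card_mono[OF fin] by (simp add: x_def)
  next
    case False
    then have "d \<le> j - 1 \<longleftrightarrow> d \<le> j" if "d \<in> D" for d
      using that \<open>1 \<le> j\<close> by (cases "d = j") auto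
    then have "{d \<in> D. d \<le> j - 1} = {d \<in> D. d \<le> j}" by blast
    then show ?thesis using False by (simp add: x_def)
  qed
  have "j \<in> ascent_set (pattern_monomial N D) \<longleftrightarrow> 1 \<le> j \<and> j < N \<and> x (j - 1) < x j" for j
    unfolding ascent_set_def s by (auto simp: less_imp_diff_less)
  then show ?thesis using step assms by auto
qed

lemma sorted_list_of_image_mset:
  assumes "strict_mono_on (set_mset m) \<phi>"
  shows "sorted_list_of_multiset (image_mset \<phi> m) = map \<phi> (sorted_list_of_multiset m)"
proof -
  define s where "s = sorted_list_of_multiset m"
  have "mset s = m" "sorted s" by (simp_all add: s_def)
  then have "set s = set_mset m" by auto
  have "sorted (map \<phi> s)"
    unfolding sorted_map
    using \<open>sorted s\<close> sorted_wrt_mono_rel[of s "(\<le>)" "\<lambda>x y. \<phi> x \<le> \<phi> y"] assms \<open>set s = set_mset m\<close>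
    by (metis strict_mono_on_leD)
  then have "sorted_list_of_multiset (mset (map \<phi> s)) = map \<phi> s"
    by (simp only: sorted_list_of_multiset_mset sorted_sort_id)
  then show ?thesis using \<open>mset s = m\<close> by (simp add: s_def)
qed

lemma length_sorted_list_of_multiset [simp]: "length (sorted_list_of_multiset m) = size m"
  by (metis mset_sorted_list_of_multiset size_mset)

lemma ascent_set_image:
  assumes "strict_mono_on (set_mset m) \<phi>"
  shows "ascent_set (image_mset \<phi> m) = ascent_set m"
proof -
  define s where "s = sorted_list_of_multiset m"
  have s: "set s = set_mset m" "length s = size m" by (simp_all add: s_def)
  have "\<phi> (s ! (j - 1)) < \<phi> (s ! j) \<longleftrightarrow> s ! (j - 1) < s ! j" if "j < size m" for j
  proof -
    have "s ! (j - 1) \<in> set_mset m" "s ! j \<in> set_mset m"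
      using that s by (metis nth_mem less_imp_diff_less)+
    then show ?thesis using assms by (metis strict_mono_on_less)
  qed
  then show ?thesis
    unfolding ascent_set_def sorted_list_of_image_mset[OF assms] s_def[symmetric] size_image_mset
    using s by auto
qed

text \<open>The variables of m are renumbered consecutively: \<phi> sends x to the number of rises
  whose new value is at most x. This map is strictly increasing on the variables that occur.\<close>

lemma quasisymmetric_pattern:
  assumes "quasisymmetric f"
  shows "f m = f (pattern_monomial (size m) (ascent_set m))"
proof -
  define s where "s = sorted_list_of_multiset m"
  have s: "sorted s" "mset s = m" "set s = set_mset m" "length s = size m" by (simp_all add: s_def)
  define A where "A = ascent_set m"
  have A: "A = {j. 1 \<le> j \<and> j < length s \<and> s ! (j - 1) < s ! j}"
    by (simp add: A_def ascent_set_def s_def)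
  define \<phi> where "\<phi> x = card {d \<in> A. s ! d \<le> x}" for x
  have fin: "finite {d \<in> A. P d}" for P by (rule finite_subset[of _ "{..<length s}"]) (auto simp: A)
  have val: "\<phi> (s ! j) = card {d \<in> A. d \<le> j}" if j: "j < length s" for j
  proof -
    have "s ! d \<le> s ! j \<longleftrightarrow> d \<le> j" if "d \<in> A" for d
    proof
      assume "s ! d \<le> s ! j"
      show "d \<le> j"
      proof (rule ccontr)
        assume "\<not> d \<le> j"
        then have "s ! j \<le> s ! (d - 1)" using s(1) that by (intro sorted_nth_mono) (auto simp: A)
        then show False using \<open>s ! d \<le> s ! j\<close> that by (auto simp: A)
      qed
    qed (use s(1) j in \<open>auto intro: sorted_nth_mono\<close>)
    then show ?thesis unfolding \<phi>_def by (metis (mono_tags, lifting))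
  qed
  have "strict_mono_on (set_mset m) \<phi>"
  proof (rule strict_mono_onI)
    fix x y assume "x \<in> set_mset m" "y \<in> set_mset m" "x < y"
    then obtain i j where ij: "i < length s" "j < length s" "s ! i = x" "s ! j = y"
      using s(3) by (metis in_set_conv_nth)
    have "i < j" using ij s(1) \<open>x < y\<close> by (metis linorder_not_le sorted_nth_mono)
    \<comment> \<open>The first position whose value exceeds x is a rise, and it is counted for y
      but not for x.\<close>
    define d where "d = (LEAST d. s ! i < s ! d)"
    have "s ! i < s ! j" using ij \<open>x < y\<close> by simp
    then have d: "s ! i < s ! d" "d \<le> j" unfolding d_def by (rule LeastI, rule Least_le)
    have "i < d" using d ij s(1) by (metis leD le_less_trans linorder_not_le sorted_nth_mono)
    moreover have "\<not> s ! i < s ! (d - 1)"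
      using not_less_Least[of "d - 1" "\<lambda>d. s ! i < s ! d"] \<open>i < d\<close> by (simp add: d_def[symmetric])
    ultimately have "d \<in> A" using d ij by (auto simp: A)
    moreover have "s ! d \<le> y" using d ij s(1) by (metis sorted_nth_mono)
    ultimately have "d \<in> {d \<in> A. s ! d \<le> y}" "d \<notin> {d \<in> A. s ! d \<le> x}" using d ij by auto
    moreover have "{d \<in> A. s ! d \<le> x} \<subseteq> {d \<in> A. s ! d \<le> y}" using \<open>x < y\<close> by auto
    ultimately show "\<phi> x < \<phi> y" unfolding \<phi>_def by (intro psubset_card_mono[OF fin]) blast
  qed
  then have "f m = f (image_mset \<phi> m)" using assms by (simp add: quasisymmetric_def)
  also have "image_mset \<phi> m = mset (map \<phi> s)" using s(2) by simp
  also have "map \<phi> s = map (\<lambda>j. card {d \<in> A. d \<le> j}) [0..<length s]"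
    using val by (intro nth_equalityI) auto
  finally show ?thesis by (simp add: pattern_monomial_def A_def s(4))
qed

lemma quasisymmetric_fund: "quasisymmetric (fund N D)"
  by (simp add: quasisymmetric_def fund_def ascent_set_image)

text \<open>An increasing renaming is injective on the variables of m, so it matches the
  factorisations of m with those of its image, term by term.\<close>

lemma quasisymmetric_mult:
  assumes "quasisymmetric f" "quasisymmetric g"
  shows "quasisymmetric (pseries_mult f g)"
  unfolding quasisymmetric_def
proof (intro allI impI)
  fix m :: "nat multiset" and \<phi> :: "nat \<Rightarrow> nat"
  assume \<phi>: "strict_mono_on (set_mset m) \<phi>"
  then have inj: "inj_on \<phi> (set_mset m)" by (rule strict_mono_on_imp_inj_on)
  define \<psi> where "\<psi> = inv_into (set_mset m) \<phi>"
  have \<psi>\<phi>: "image_mset \<psi> (image_mset \<phi> a) = a" if "set_mset a \<subseteq> set_mset m" for a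
    using that inj unfolding multiset.map_comp \<psi>_def
    by (intro multiset.map_ident_strong) (auto simp: subset_iff)
  have \<phi>\<psi>: "image_mset \<phi> (image_mset \<psi> a) = a" if "set_mset a \<subseteq> \<phi> ` set_mset m" for a
    using that unfolding multiset.map_comp \<psi>_def
    by (intro multiset.map_ident_strong) (auto simp: f_inv_into_f subset_iff)
  have "(\<Sum>(a, b)\<in>{(a, b). a + b = m}. f a * g b)
      = (\<Sum>(a, b)\<in>{(a, b). a + b = image_mset \<phi> m}. f a * g b)"
  proof (rule sum.reindex_bij_witness[where j = "\<lambda>(a, b). (image_mset \<phi> a, image_mset \<phi> b)"
        and i = "\<lambda>(a, b). (image_mset \<psi> a, image_mset \<psi> b)"])
    fix p assume p: "p \<in> {(a, b). a + b = m}"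
    then obtain a b where ab: "p = (a, b)" "a + b = m" by auto
    then have sub: "set_mset a \<subseteq> set_mset m" "set_mset b \<subseteq> set_mset m" by auto
    show "(case case p of (a, b) \<Rightarrow> (image_mset \<phi> a, image_mset \<phi> b) of
        (a, b) \<Rightarrow> (image_mset \<psi> a, image_mset \<psi> b)) = p"
      using ab \<psi>\<phi>[OF sub(1)] \<psi>\<phi>[OF sub(2)] by simp
    show "(case p of (a, b) \<Rightarrow> (image_mset \<phi> a, image_mset \<phi> b)) \<in> {(a, b). a + b = image_mset \<phi> m}"
      using ab by auto
    have "f (image_mset \<phi> a) = f a" "g (image_mset \<phi> b) = g b"
      using assms sub \<phi> unfolding quasisymmetric_def by (meson monotone_on_subset)+
    then show "(case case p of (a, b) \<Rightarrow> (image_mset \<phi> a, image_mset \<phi> b) of (a, b) \<Rightarrow> f a * g b)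
        = (case p of (a, b) \<Rightarrow> f a * g b)"
      using ab by simp
  next
    fix p assume p: "p \<in> {(a, b). a + b = image_mset \<phi> m}"
    then obtain a b where ab: "p = (a, b)" "a + b = image_mset \<phi> m" by auto
    then have sub: "set_mset a \<subseteq> \<phi> ` set_mset m" "set_mset b \<subseteq> \<phi> ` set_mset m"
      by (metis set_mset_union set_image_mset Un_upper1 Un_upper2)+
    show "(case case p of (a, b) \<Rightarrow> (image_mset \<psi> a, image_mset \<psi> b) of
        (a, b) \<Rightarrow> (image_mset \<phi> a, image_mset \<phi> b)) = p"
      using ab \<phi>\<psi>[OF sub(1)] \<phi>\<psi>[OF sub(2)] by simp
    have "image_mset \<psi> a + image_mset \<psi> b = m"
      using ab(2) \<psi>\<phi>[of m] by (metis image_mset_union order_refl)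
    then show "(case p of (a, b) \<Rightarrow> (image_mset \<psi> a, image_mset \<psi> b)) \<in> {(a, b). a + b = m}"
      using ab by simp
  qed
  then show "pseries_mult f g (image_mset \<phi> m) = pseries_mult f g m"
    by (simp add: pseries_mult_def)
qed

lemma bounded_quasisymmetric_mult:
  assumes "f \<in> bounded_quasisymmetric" "g \<in> bounded_quasisymmetric"
  shows "pseries_mult f g \<in> bounded_quasisymmetric"
proof -
  obtain M N where M: "\<And>m. M \<le> size m \<Longrightarrow> f m = 0" and N: "\<And>m. N \<le> size m \<Longrightarrow> g m = 0"
    using assms by (auto simp: bounded_quasisymmetric_def)
  have "pseries_mult f g m = 0" if "M + N \<le> size m" for m
    unfolding pseries_mult_def
  proof (rule sum.neutral, clarsimp)
    fix a b assume "m = a + b" "g b \<noteq> 0"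
    then have "size b < N" "size a + size b \<ge> M + N" using N[of b] that by (auto simp: not_le[symmetric])
    then show "f a = 0" by (intro M) simp
  qed
  then show ?thesis
    using assms quasisymmetric_mult[of f g] by (auto simp: bounded_quasisymmetric_def)
qed

lemma subspace_bounded_quasisymmetric: "cfun.subspace bounded_quasisymmetric"
proof (rule cfun.subspaceI)
  fix f g assume f: "f \<in> bounded_quasisymmetric" and g: "g \<in> bounded_quasisymmetric"
  obtain M N where "\<And>m. M \<le> size m \<Longrightarrow> f m = 0" "\<And>m. N \<le> size m \<Longrightarrow> g m = 0"
    using f g by (auto simp: bounded_quasisymmetric_def)
  then have "\<forall>m. max M N \<le> size m \<longrightarrow> (f + g) m = 0" by simp
  then show "f + g \<in> bounded_quasisymmetric"
    using f g by (auto simp: bounded_quasisymmetric_def quasisymmetric_def simp del: max.bounded_iff)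
qed (auto simp: bounded_quasisymmetric_def quasisymmetric_def)

definition monomial_of :: "nat list \<Rightarrow> nat multiset" where
  "monomial_of \<alpha> = pattern_monomial (sum_list \<alpha>) (set_of_comp \<alpha>)"

lemma size_monomial_of [simp]: "size (monomial_of \<alpha>) = sum_list \<alpha>"
  by (simp add: monomial_of_def)

lemma quasisymmetric_eqI:
  assumes "quasisymmetric f" "quasisymmetric g"
    and "\<And>\<alpha>. \<alpha> \<in> compositions \<Longrightarrow> sum_list \<alpha> = size m \<Longrightarrow> f (monomial_of \<alpha>) = g (monomial_of \<alpha>)"
  shows "f m = g m"
proof -
  define \<alpha> where "\<alpha> = comp_of_set (size m) (ascent_set m)"
  have "ascent_set m \<subseteq> {1..<size m}" by (auto simp: ascent_set_def)
  note * = comp_of_set[OF this, folded \<alpha>_def]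
  show ?thesis
    using quasisymmetric_pattern[OF assms(1), of m] quasisymmetric_pattern[OF assms(2), of m]
      assms(3)[OF *(1,2)] * by (simp add: monomial_of_def)
qed

text \<open>Quasisymmetric series are determined by their values at the test monomials, so a
  homogeneous family that is triangular there with nonzero diagonal is a basis. The order r stays a
  parameter because the two families need different ones.\<close>

lemma triangular_basis:
  fixes b :: "nat list \<Rightarrow> pseries"
  assumes r: "wf r"
    and b: "\<And>\<alpha>. \<alpha> \<in> compositions \<Longrightarrow> quasisymmetric (b \<alpha>)"
    and deg: "\<And>\<alpha> m. \<alpha> \<in> compositions \<Longrightarrow> size m \<noteq> sum_list \<alpha> \<Longrightarrow> b \<alpha> m = 0"
    and diag: "\<And>\<alpha>. \<alpha> \<in> compositions \<Longrightarrow> b \<alpha> (monomial_of \<alpha>) \<noteq> 0"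
    and tri: "\<And>\<alpha> \<beta>. \<alpha> \<in> compositions \<Longrightarrow> \<beta> \<in> compositions \<Longrightarrow> sum_list \<alpha> = sum_list \<beta> \<Longrightarrow>
      b \<alpha> (monomial_of \<beta>) \<noteq> 0 \<Longrightarrow> \<alpha> = \<beta> \<or> (\<alpha>, \<beta>) \<in> r"
  shows "inj_on b compositions" "cfun.independent (b ` compositions)"
    "cfun.span (b ` compositions) = bounded_quasisymmetric"
proof -
  have tri': "\<alpha> = \<beta> \<or> (\<alpha>, \<beta>) \<in> r"
    if "\<alpha> \<in> compositions" "\<beta> \<in> compositions" "b \<alpha> (monomial_of \<beta>) \<noteq> 0" for \<alpha> \<beta>
    using that deg[of \<alpha> "monomial_of \<beta>"] tri[of \<alpha> \<beta>]
    by (cases "sum_list \<alpha> = sum_list \<beta>") auto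
  show inj: "inj_on b compositions"
  proof (rule inj_onI, rule ccontr)
    fix \<alpha> \<beta> assume *: "\<alpha> \<in> compositions" "\<beta> \<in> compositions" "b \<alpha> = b \<beta>" "\<alpha> \<noteq> \<beta>"
    then have "(\<alpha>, \<beta>) \<in> r" "(\<beta>, \<alpha>) \<in> r" using tri'[of \<alpha> \<beta>] tri'[of \<beta> \<alpha>] diag by metis+
    then show False using r by (meson wf_asym)
  qed
  show "cfun.independent (b ` compositions)"
    unfolding cfun.independent_explicit_module
  proof (intro allI impI)
    fix t u v assume t: "finite t" "t \<subseteq> b ` compositions" "(\<Sum>v\<in>t. cscale (u v) v) = 0" "v \<in> t"
    then obtain I where I: "I \<subseteq> compositions" "inj_on b I" "t = b ` I" by (auto simp: subset_image_inj)
    then have fin: "finite I" using t(1) finite_imageD by blast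
    obtain i where i: "i \<in> I" "v = b i" using I t(4) by auto
    have "(\<Sum>i\<in>I. u (b i) * b i m) = 0" for m
      using fun_cong[OF t(3), of m] I by (simp add: sum_apply sum.reindex)
    then have "u (b i) = 0"
      using triangular_independent[OF r fin, of "\<lambda>i j. b i (monomial_of j)" "\<lambda>i. u (b i)" i]
        I(1) diag tri' i(1) by (simp add: subset_iff)
    then show "u v = 0" using i by simp
  qed
  show "cfun.span (b ` compositions) = bounded_quasisymmetric"
  proof
    have "b \<alpha> \<in> bounded_quasisymmetric" if "\<alpha> \<in> compositions" for \<alpha>
      unfolding bounded_quasisymmetric_def using b[OF that] deg[OF that]
      by (auto intro!: exI[of _ "Suc (sum_list \<alpha>)"])
    then show "cfun.span (b ` compositions) \<subseteq> bounded_quasisymmetric"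
      by (intro cfun.span_minimal subspace_bounded_quasisymmetric) auto
    show "bounded_quasisymmetric \<subseteq> cfun.span (b ` compositions)"
    proof
      fix f assume f: "f \<in> bounded_quasisymmetric"
      then obtain N where N: "\<And>m. N \<le> size m \<Longrightarrow> f m = 0" and qf: "quasisymmetric f"
        by (auto simp: bounded_quasisymmetric_def)
      \<comment> \<open>Since f vanishes in large degrees, finitely many compositions suffice and
        the triangular system is finite.\<close>
      define I where "I = {\<alpha> \<in> compositions. sum_list \<alpha> \<le> N}"
      have fin: "finite I" unfolding I_def by (rule finite_compositions_le)
      have "\<exists>c. \<forall>j\<in>I. (\<Sum>i\<in>I. c i * b i (monomial_of j)) = f (monomial_of j)"
        using diag tri' by (intro triangular_solvable[OF r fin, of "\<lambda>i j. b i (monomial_of j)"])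
          (simp_all add: I_def)
      then obtain c where c: "\<And>j. j \<in> I \<Longrightarrow> (\<Sum>i\<in>I. c i * b i (monomial_of j)) = f (monomial_of j)"
        by blast
      define g where "g = (\<Sum>i\<in>I. cscale (c i) (b i))"
      have g: "g m = (\<Sum>i\<in>I. c i * b i m)" for m by (simp add: g_def sum_apply)
      have "f m = g m" for m
      proof (cases "size m \<le> N")
        case True
        have "quasisymmetric g"
          using b by (simp add: quasisymmetric_def g I_def)
        then show ?thesis
        proof (rule quasisymmetric_eqI[OF qf])
          fix \<alpha> assume "\<alpha> \<in> compositions" "sum_list \<alpha> = size m"
          then have "\<alpha> \<in> I" using True by (simp add: I_def)
          then show "f (monomial_of \<alpha>) = g (monomial_of \<alpha>)" using c by (simp add: g)
        qed
      next
        case False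
        then have "g m = 0" unfolding g by (intro sum.neutral) (auto simp: I_def deg)
        then show ?thesis using N False by simp
      qed
      then have "f = g" by blast
      moreover have "g \<in> cfun.span (b ` compositions)"
        unfolding g_def by (intro cfun.span_sum cfun.span_scale cfun.span_base) (auto simp: I_def)
      ultimately show "f \<in> cfun.span (b ` compositions)" by simp
    qed
  qed
qed

lemma fund_eq_0: "size m \<noteq> N \<Longrightarrow> fund N D m = 0"
  by (simp add: fund_def)

lemma fundamental_eq_0: "\<alpha> \<in> compositions \<Longrightarrow> size m \<noteq> sum_list \<alpha> \<Longrightarrow> fundamental \<alpha> m = 0"
  by (simp add: fundamental_eq fund_eq_0)

lemma fundamental_monomial_of:
  assumes "\<alpha> \<in> compositions" "\<beta> \<in> compositions"
  shows "fundamental \<alpha> (monomial_of \<beta>) =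
    (if sum_list \<beta> = sum_list \<alpha> \<and> set_of_comp \<alpha> \<subseteq> set_of_comp \<beta> then 1 else 0)"
  using set_of_comp_subset[OF assms(2)]
  by (simp add: fundamental_eq[OF assms(1)] fund_def monomial_of_def ascent_set_pattern_monomial)

lemma
  shows inj_on_fundamental: "inj_on fundamental compositions"
    and independent_fundamental: "cfun.independent (fundamental ` compositions)"
    and QSym_eq: "QSym = bounded_quasisymmetric"
proof -
  \<comment> \<open>Among compositions of one size, F_\<alpha> is nonzero at the monomial of \<beta>
    only if set(\<alpha>) is contained in set(\<beta>); the number of partial sums is therefore a
    suitable measure.\<close>
  define r :: "(nat list \<times> nat list) set" where "r = measure (\<lambda>\<alpha>. card (set_of_comp \<alpha>))"
  have tri: "\<alpha> = \<beta> \<or> (\<alpha>, \<beta>) \<in> r"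
    if "\<alpha> \<in> compositions" "\<beta> \<in> compositions" "sum_list \<alpha> = sum_list \<beta>"
      "fundamental \<alpha> (monomial_of \<beta>) \<noteq> 0" for \<alpha> \<beta>
  proof -
    have sub: "set_of_comp \<alpha> \<subseteq> set_of_comp \<beta>"
      using that by (simp add: fundamental_monomial_of split: if_splits)
    have "finite (set_of_comp \<beta>)" using set_of_comp_subset[OF that(2)] finite_subset by blast
    then show ?thesis
      using sub set_of_comp_inj[OF that(1-3)] psubset_card_mono[of "set_of_comp \<beta>" "set_of_comp \<alpha>"]
      by (auto simp: r_def)
  qed
  have wf: "wf r" by (simp add: r_def)
  have qs: "quasisymmetric (fundamental \<alpha>)" if "\<alpha> \<in> compositions" for \<alpha>
    using that by (simp add: fundamental_eq quasisymmetric_fund)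
  have diag: "fundamental \<alpha> (monomial_of \<alpha>) \<noteq> 0" if "\<alpha> \<in> compositions" for \<alpha>
    using that by (simp add: fundamental_monomial_of)
  note basis = triangular_basis[OF wf qs fundamental_eq_0 diag tri]
  show "inj_on fundamental compositions" "cfun.independent (fundamental ` compositions)"
    "QSym = bounded_quasisymmetric"
    unfolding QSym_def using basis by blast+
qed


section \<open>Triangularity of the quasisymmetric Schur functions\<close>

lemma length_addL: "2 \<le> c \<Longrightarrow> length (addL c \<alpha>) = length \<alpha>"
proof -
  have "length (inc_first c \<alpha>) = length \<alpha>" by (induction \<alpha>) auto
  then show "2 \<le> c \<Longrightarrow> length (addL c \<alpha>) = length \<alpha>" by (simp add: addL_def)
qed

lemma length_path_addL: "path addL \<alpha> w \<beta> \<Longrightarrow> \<forall>c\<in>set w. 2 \<le> c \<Longrightarrow> length \<beta> = length \<alpha>"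
  by (induction w arbitrary: \<alpha>) (auto simp: length_addL)

text \<open>A letter c extends a row of length c - 1, so letters from r + 2 on pass over a head of
  length r.\<close>

lemma path_addL_fixed_head:
  "path addL (r # \<delta>) w \<beta> \<Longrightarrow> \<forall>c\<in>set w. r + 2 \<le> c \<Longrightarrow> \<exists>\<delta>'. \<beta> = r # \<delta>' \<and> length \<delta>' = length \<delta>"
proof (induction w arbitrary: \<delta>)
  case (Cons c w)
  have c: "r + 2 \<le> c" using Cons.prems by simp
  then have "addL c (r # \<delta>) = r # addL c \<delta>" by (simp add: addL_def)
  then have "path addL (r # addL c \<delta>) w \<beta>" using Cons.prems(1) by simp
  from Cons.IH[OF this] Cons.prems(2) length_addL[of c \<delta>] c show ?case by auto
qed auto

text \<open>The head grows as long as the letters continue r + 1, r + 2 and so on; once a value is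
  skipped, all later letters are too large to touch it. So either it takes all boxes or it stays
  shorter.\<close>

lemma path_addL_increasing_head:
  "path addL (r # \<delta>) w \<beta> \<Longrightarrow> 1 \<le> r \<Longrightarrow> sorted_wrt (<) (r # w) \<Longrightarrow>
    \<beta> = (r + length w) # \<delta> \<or> (\<exists>x \<delta>'. \<beta> = x # \<delta>' \<and> x < r + length w \<and> length \<delta>' = length \<delta>)"
proof (induction w arbitrary: r)
  case (Cons c w)
  have c: "r < c" "\<forall>d\<in>set w. c < d" "sorted_wrt (<) w" using Cons.prems(3) by auto
  show ?case
  proof (cases "c = Suc r")
    case True
    then have "addL c (r # \<delta>) = Suc r # \<delta>" using Cons.prems(2) by (simp add: addL_def)
    then show ?thesis using Cons.IH[of "Suc r"] Cons.prems c True by auto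
  next
    case False
    then have "\<forall>d\<in>set (c # w). r + 2 \<le> d" using c by force
    then obtain \<delta>' where "\<beta> = r # \<delta>'" "length \<delta>' = length \<delta>"
      using path_addL_fixed_head[OF Cons.prems(1)] by blast
    then show ?thesis by simp
  qed
qed simp

lemma lenlex_less_than_iff:
  "(\<alpha>, \<beta>) \<in> lenlex less_than \<longleftrightarrow> length \<alpha> < length \<beta> \<or> length \<alpha> = length \<beta> \<and> (\<alpha>, \<beta>) \<in> lex less_than"
  by (auto simp: lenlex_conv)

text \<open>An increasing word contains 1 at most once and so adds at most one row. Without a new
  row the shape has too few rows. With one, that row has at most \<open>length w\<close> boxes, and
  equality leaves \<beta>1 unchanged below it.\<close>

lemma increasing_strip_lenlex:
  assumes "path addL \<beta>1 w \<beta>" "sorted_wrt (<) w" "w \<noteq> []" "\<beta>1 = \<gamma> \<or> (\<beta>1, \<gamma>) \<in> lenlex less_than"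
  shows "\<beta> = length w # \<gamma> \<or> (\<beta>, length w # \<gamma>) \<in> lenlex less_than"
proof -
  have len: "length \<beta>1 \<le> length \<gamma>" using assms(4) by (auto simp: lenlex_less_than_iff)
  obtain c w' where w: "w = c # w'" using assms(3) by (cases w) auto
  show ?thesis
  proof (cases "c = 1")
    case True
    then have "path addL (1 # \<beta>1) w' \<beta>" using assms(1) w by (simp add: addL_def)
    from path_addL_increasing_head[OF this] assms(2) True w
    consider "\<beta> = length w # \<beta>1" | x \<delta> where "\<beta> = x # \<delta>" "x < length w" "length \<delta> = length \<beta>1"
      by auto
    then show ?thesis using assms(4) len by cases (auto simp: Cons_lenlex_iff)
  next
    case False
    then have "2 \<le> c" using path_ge1[OF assms(1)] w by fastforce
    then have "\<forall>d\<in>set w. 2 \<le> d" using assms(2) w by fastforce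
    then have "length \<beta> < length (length w # \<gamma>)" using length_path_addL[OF assms(1)] len by simp
    then show ?thesis by (simp add: lenlex_less_than_iff)
  qed
qed

lemma descents_append:
  assumes "length w = a"
  shows "1 \<le> v \<Longrightarrow> v < a \<Longrightarrow> v \<in> descents (ks @ w) \<longleftrightarrow> w ! (a - v) \<le> w ! (a - v - 1)"
    and "1 \<le> v \<Longrightarrow> a + v \<in> descents (ks @ w) \<longleftrightarrow> v \<in> descents ks"
  using assms by (auto simp: descents_def nth_append)

text \<open>Let a be the first part of \<gamma>. No v < a is a descent, so the last a letters, which
  place the entries 1 to a, increase. By induction the shape before them is at most the tail of
  \<gamma>, and \<open>increasing_strip_lenlex\<close> adds the strip.\<close>

lemma words_descents_lenlex:
  "\<gamma> \<in> compositions \<Longrightarrow> ks \<in> words \<beta> \<Longrightarrow> length ks = sum_list \<gamma> \<Longrightarrow> descents ks \<subseteq> set_of_comp \<gamma> \<Longrightarrow>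
    \<beta> = \<gamma> \<or> (\<beta>, \<gamma>) \<in> lenlex less_than"
proof (induction \<gamma> arbitrary: ks \<beta>)
  case Nil
  then show ?case by (simp add: words_def)
next
  case (Cons a \<gamma>)
  define ks1 w where "ks1 = take (sum_list \<gamma>) ks" and "w = drop (sum_list \<gamma>) ks"
  have ks: "ks = ks1 @ w" and len: "length ks1 = sum_list \<gamma>" "length w = a"
    using Cons.prems(3) by (simp_all add: ks1_def w_def)
  have a: "1 \<le> a" and \<gamma>: "\<gamma> \<in> compositions" using Cons.prems(1) by auto
  obtain \<beta>1 where \<beta>1: "ks1 \<in> words \<beta>1" "path addL \<beta>1 w \<beta>"
    using Cons.prems(2) unfolding ks words_def mem_Collect_eq path_append by blast
  have pos: "x \<in> set_of_comp (a # \<gamma>) \<Longrightarrow> a \<le> x \<and> (x = a \<or> x - a \<in> set_of_comp \<gamma>)" for x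
    by (cases \<gamma>) auto
  have "w ! x < w ! Suc x" if "Suc x < length w" for x
  proof -
    have "a - Suc x \<notin> descents ks"
    proof
      assume "a - Suc x \<in> descents ks"
      then have "a \<le> a - Suc x" using pos Cons.prems(4) by blast
      then show False using a by simp
    qed
    moreover have "a - (a - Suc x) - 1 = x" "a - (a - Suc x) = Suc x" using that len by auto
    ultimately show ?thesis
      using descents_append(1)[OF len(2), of "a - Suc x" ks1] that len ks a by auto
  qed
  then have "monotone_word True w"
    by (auto simp: monotone_word_def all_set_conv_all_nth length_ascents nth_ascents)
  then have inc: "sorted_wrt (<) w" by (simp add: monotone_word_True)
  have "descents ks1 \<subseteq> set_of_comp \<gamma>"
  proof
    fix v assume v: "v \<in> descents ks1"
    then have "1 \<le> v" by (simp add: descents_def)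
    then have "a + v \<in> set_of_comp (a # \<gamma>)"
      using v descents_append(2)[OF len(2), of v ks1] ks Cons.prems(4) by auto
    then show "v \<in> set_of_comp \<gamma>" using pos \<open>1 \<le> v\<close> by force
  qed
  from increasing_strip_lenlex[OF \<beta>1(2) inc _ Cons.IH[OF \<gamma> \<beta>1(1) len(1) this]]
  show ?case using len(2) a by (cases w) auto
qed

lemma path_addL_row: "1 \<le> r \<Longrightarrow> path addL (r # \<delta>) [Suc r..<Suc (r + k)] ((r + k) # \<delta>)"
proof (induction k arbitrary: r)
  case (Suc k)
  have "[Suc r..<Suc (r + Suc k)] = Suc r # [Suc (Suc r)..<Suc (Suc r + k)]"
    by (subst upt_conv_Cons) (simp_all del: upt_Suc)
  then show ?case using Suc.IH[of "Suc r"] Suc.prems by (simp add: addable_def addL_def del: upt_Suc)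
qed simp

text \<open>Build the rows from bottom to top, each from left to right. Within a row the letters
  increase, so a descent can occur only where a new row begins.\<close>

lemma exists_word_descents:
  "\<gamma> \<in> compositions \<Longrightarrow> \<exists>ks\<in>words \<gamma>. descents ks \<subseteq> set_of_comp \<gamma>"
proof (induction \<gamma>)
  case Nil
  show ?case by (intro bexI[of _ "[]"]) (auto simp: words_def descents_def)
next
  case (Cons a \<gamma>)
  then obtain ks where ks: "ks \<in> words \<gamma>" "descents ks \<subseteq> set_of_comp \<gamma>" by auto
  define w where "w = [1..<Suc a]"
  have a: "1 \<le> a" "length w = a" using Cons.prems by (auto simp: w_def)
  have "w = 1 # [Suc 1..<Suc (1 + (a - 1))]"
    using a unfolding w_def by (subst upt_conv_Cons) (simp_all del: upt_Suc)
  then have "path addL \<gamma> w (a # \<gamma>)"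
    using path_addL_row[of 1 \<gamma> "a - 1"] a by (simp add: addable_def addL_def del: upt_Suc)
  then have "ks @ w \<in> words (a # \<gamma>)" using ks(1) by (auto simp: words_def path_append)
  moreover have "v \<in> set_of_comp (a # \<gamma>)" if v: "v \<in> descents (ks @ w)" for v
  proof -
    have v': "1 \<le> v" "v < length ks + a" using v a by (auto simp: descents_def)
    have "\<not> v < a"
      using descents_append(1)[OF a(2) v'(1)] v v' by (auto simp: w_def simp del: upt_Suc)
    then have "\<gamma> \<noteq> []" using v' words_length[OF ks(1)] by auto
    then obtain b \<gamma>' where \<gamma>: "\<gamma> = b # \<gamma>'" by (cases \<gamma>) auto
    show ?thesis
    proof (cases "v = a")
      case False
      then have "v - a \<in> descents ks"
        using descents_append(2)[OF a(2), of "v - a" ks] v \<open>\<not> v < a\<close> by auto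
      then have "v - a \<in> set_of_comp \<gamma>" using ks(2) by blast
      then show ?thesis using \<gamma> \<open>\<not> v < a\<close> by (auto intro!: image_eqI[of _ _ "v - a"])
    qed (simp add: \<gamma>)
  qed
  ultimately show ?case by blast
qed

lemma qschur_monomial_of:
  assumes "\<beta> \<in> compositions" "\<gamma> \<in> compositions" "sum_list \<beta> = sum_list \<gamma>"
  shows "qschur \<beta> (monomial_of \<gamma>) = of_nat (card {ks \<in> words \<beta>. descents ks \<subseteq> set_of_comp \<gamma>})"
proof -
  have "ascent_set (monomial_of \<gamma>) = set_of_comp \<gamma>"
    using set_of_comp_subset[OF assms(2)] by (simp add: monomial_of_def ascent_set_pattern_monomial)
  then have "qschur \<beta> (monomial_of \<gamma>) = (\<Sum>ks\<in>words \<beta>. if descents ks \<subseteq> set_of_comp \<gamma> then 1 else 0)"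
    using assms(3) by (simp add: qschur_eq sum_apply fund_def)
  also have "\<dots> = (\<Sum>ks | ks \<in> words \<beta> \<and> descents ks \<subseteq> set_of_comp \<gamma>. 1)"
    by (rule sum.inter_filter[symmetric]) (rule finite_words)
  finally show ?thesis by simp
qed

lemma
  shows quasisymmetric_qschur: "quasisymmetric (qschur \<beta>)"
    and qschur_eq_0: "size m \<noteq> sum_list \<beta> \<Longrightarrow> qschur \<beta> m = 0"
  using quasisymmetric_fund by (auto simp: qschur_eq sum_apply quasisymmetric_def fund_eq_0)

lemma
  shows inj_on_qschur: "inj_on qschur compositions"
    and independent_qschur: "cfun.independent (qschur ` compositions)"
    and span_qschur: "cfun.span (qschur ` compositions) = QSym"
proof -
  have diag: "qschur \<beta> (monomial_of \<beta>) \<noteq> 0" if "\<beta> \<in> compositions" for \<beta>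
    using exists_word_descents[OF that] finite_words[of \<beta>]
    by (auto simp: qschur_monomial_of that card_eq_0_iff)
  have tri: "\<beta> = \<gamma> \<or> (\<beta>, \<gamma>) \<in> lenlex less_than"
    if *: "\<beta> \<in> compositions" "\<gamma> \<in> compositions" "sum_list \<beta> = sum_list \<gamma>"
      "qschur \<beta> (monomial_of \<gamma>) \<noteq> 0" for \<beta> \<gamma>
  proof -
    have "card {ks \<in> words \<beta>. descents ks \<subseteq> set_of_comp \<gamma>} \<noteq> 0"
      using *(4) by (simp add: qschur_monomial_of *(1-3))
    then obtain ks where "ks \<in> words \<beta>" "descents ks \<subseteq> set_of_comp \<gamma>"
      by (metis (mono_tags, lifting) Collect_empty_eq card.empty)
    then show ?thesis using words_descents_lenlex[OF *(2)] words_length *(3) by simp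
  qed
  have wf: "wf (lenlex less_than)" by blast
  note basis = triangular_basis[OF wf quasisymmetric_qschur qschur_eq_0 diag tri]
  show "inj_on qschur compositions" "cfun.independent (qschur ` compositions)"
    "cfun.span (qschur ` compositions) = QSym"
    unfolding QSym_eq using basis by blast+
qed


section \<open>Noncommutative Schur functions as coordinate functionals\<close>

definition linear_on_QSym :: "(pseries \<Rightarrow> complex) \<Rightarrow> bool" where
  "linear_on_QSym s \<longleftrightarrow> (\<forall>f\<in>QSym. \<forall>g\<in>QSym. s (f + g) = s f + s g) \<and>
     (\<forall>c. \<forall>f\<in>QSym. s (cscale c f) = c * s f)"

lemma NSym_linear: "s \<in> NSym \<Longrightarrow> linear_on_QSym s"
  by (simp add: NSym_def linear_on_QSym_def)

lemma subspace_QSym: "cfun.subspace QSym"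
  by (simp add: QSym_def cfun.subspace_span)

lemmas QSym_0 = cfun.subspace_0[OF subspace_QSym]
  and QSym_add = cfun.subspace_add[OF subspace_QSym]
  and QSym_scale = cfun.subspace_scale[OF subspace_QSym]
  and QSym_sum = cfun.subspace_sum[OF subspace_QSym]

lemma linear_on_QSym_add:
    "linear_on_QSym s \<Longrightarrow> f \<in> QSym \<Longrightarrow> g \<in> QSym \<Longrightarrow> s (f + g) = s f + s g"
  and linear_on_QSym_scale: "linear_on_QSym s \<Longrightarrow> f \<in> QSym \<Longrightarrow> s (cscale c f) = c * s f"
  by (simp_all add: linear_on_QSym_def)

lemma linear_on_QSym_0: "linear_on_QSym s \<Longrightarrow> s 0 = 0"
proof -
  assume "linear_on_QSym s"
  then have "s (cscale 0 0) = 0 * s 0" using QSym_0 unfolding linear_on_QSym_def by blast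
  moreover have "cscale 0 0 = (0 :: pseries)" by (simp add: fun_eq_iff)
  ultimately show ?thesis by simp
qed

lemma linear_on_QSym_sum:
  assumes s: "linear_on_QSym s"
  shows "(\<And>i. i \<in> I \<Longrightarrow> f i \<in> QSym) \<Longrightarrow> s (\<Sum>i\<in>I. f i) = (\<Sum>i\<in>I. s (f i))"
proof (induction I rule: infinite_finite_induct)
  case (insert i I)
  have I: "f i \<in> QSym" "\<And>j. j \<in> I \<Longrightarrow> f j \<in> QSym" using insert.prems by blast+
  have "s (f i + (\<Sum>i\<in>I. f i)) = s (f i) + s (\<Sum>i\<in>I. f i)"
    by (intro linear_on_QSym_add[OF s] I QSym_sum)
  also have "s (\<Sum>i\<in>I. f i) = (\<Sum>i\<in>I. s (f i))" by (rule insert.IH[OF I(2)])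
  finally show ?case unfolding sum.insert[OF insert.hyps] .
qed (use linear_on_QSym_0[OF s] in auto)

lemma linear_on_QSym_scale_sum:
  assumes s: "linear_on_QSym s" and f: "\<And>i. i \<in> I \<Longrightarrow> f i \<in> QSym"
  shows "s (\<Sum>i\<in>I. cscale (c i) (f i)) = (\<Sum>i\<in>I. c i * s (f i))"
  using f s by (subst linear_on_QSym_sum[OF s]) (auto simp: QSym_scale linear_on_QSym_def)

lemma linear_on_QSym_eqI:
  assumes "linear_on_QSym s" "linear_on_QSym t" "cfun.span B = QSym" "\<And>b. b \<in> B \<Longrightarrow> s b = t b"
    and "f \<in> QSym"
  shows "s f = t f"
proof -
  have "f \<in> cfun.span B" using assms by simp
  then have "f \<in> QSym \<and> s f = t f"
  proof (induction rule: cfun.span_induct_alt)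
    case base
    show ?case using QSym_0 linear_on_QSym_0[OF assms(1)] linear_on_QSym_0[OF assms(2)] by metis
  next
    case (step c x y)
    have x: "x \<in> QSym" using step(1) assms(3) cfun.span_base by blast
    have y: "y \<in> QSym" "s y = t y" using step by auto
    have "s (cscale c x + y) = c * s x + s y"
      using linear_on_QSym_add[OF assms(1) QSym_scale[OF x] y(1)] linear_on_QSym_scale[OF assms(1) x] by simp
    moreover have "t (cscale c x + y) = c * t x + t y"
      using linear_on_QSym_add[OF assms(2) QSym_scale[OF x] y(1)] linear_on_QSym_scale[OF assms(2) x] by simp
    ultimately have "s (cscale c x + y) = t (cscale c x + y)"
      using assms(4)[OF step(1)] y by presburger
    then show ?case using QSym_add[OF QSym_scale[OF x] y(1)] by blast
  qed
  then show ?thesis ..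
qed

text \<open>Interpreted for the fundamental and for the quasisymmetric Schur functions, so that
  functionals on \<open>QSym\<close> can be compared on whichever basis suits them.\<close>

locale composition_basis =
  fixes b :: "nat list \<Rightarrow> pseries"
  assumes inj: "inj_on b compositions"
    and indep: "cfun.independent (b ` compositions)"
    and span: "cfun.span (b ` compositions) = QSym"
begin

definition coord :: "pseries \<Rightarrow> nat list \<Rightarrow> complex" where
  "coord f \<alpha> = cfun.representation (b ` compositions) f (b \<alpha>)"

lemma in_QSym: "\<alpha> \<in> compositions \<Longrightarrow> b \<alpha> \<in> QSym"
  using span cfun.span_base by blast

lemma linear_coord: "linear_on_QSym (\<lambda>f. coord f \<alpha>)"
  using indep span
  by (simp add: linear_on_QSym_def coord_def cfun.representation_add cfun.representation_scale)

lemma coord_basis: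
  assumes "\<alpha> \<in> compositions" "\<beta> \<in> compositions"
  shows "coord (b \<beta>) \<alpha> = (if \<alpha> = \<beta> then 1 else 0)"
  using assms inj_onD[OF inj, of \<alpha> \<beta>]
  by (auto simp: coord_def cfun.representation_basis[OF indep])

lemma coord_outside: "f \<notin> QSym \<Longrightarrow> coord f \<alpha> = 0"
  by (simp add: coord_def cfun.representation_def span)

lemma finite_coord: "finite {\<alpha> \<in> compositions. coord f \<alpha> \<noteq> 0}"
proof (rule finite_imageD)
  show "finite (b ` {\<alpha> \<in> compositions. coord f \<alpha> \<noteq> 0})"
    by (rule finite_subset[OF _ cfun.finite_representation[of "b ` compositions" f]])
      (auto simp: coord_def)
qed (use inj in \<open>auto intro: inj_on_subset\<close>)

text \<open>The linear functional with value \<open>G \<alpha>\<close> at \<open>b \<alpha>\<close>.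
  A series outside \<open>QSym\<close> has coordinates 0, so the functional vanishes there.\<close>

definition extend :: "(nat list \<Rightarrow> complex) \<Rightarrow> pseries \<Rightarrow> complex" where
  "extend G f = (\<Sum>\<alpha> | \<alpha> \<in> compositions \<and> coord f \<alpha> \<noteq> 0. coord f \<alpha> * G \<alpha>)"

lemma extend_superset:
  assumes "finite I" "{\<alpha> \<in> compositions. coord f \<alpha> \<noteq> 0} \<subseteq> I" "I \<subseteq> compositions"
  shows "extend G f = (\<Sum>\<alpha>\<in>I. coord f \<alpha> * G \<alpha>)"
  unfolding extend_def using assms by (intro sum.mono_neutral_left) auto

lemma linear_extend: "linear_on_QSym (extend G)"
  unfolding linear_on_QSym_def
proof (intro conjI ballI allI)
  fix f g assume fg: "f \<in> QSym" "g \<in> QSym"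
  define I where "I = {\<alpha> \<in> compositions. coord f \<alpha> \<noteq> 0} \<union> {\<alpha> \<in> compositions. coord g \<alpha> \<noteq> 0}
    \<union> {\<alpha> \<in> compositions. coord (f + g) \<alpha> \<noteq> 0}"
  have I: "finite I" "I \<subseteq> compositions" using finite_coord by (auto simp: I_def)
  have "coord (f + g) \<alpha> = coord f \<alpha> + coord g \<alpha>" for \<alpha>
    using linear_coord fg by (simp add: linear_on_QSym_def)
  then show "extend G (f + g) = extend G f + extend G g"
    using extend_superset[OF I(1) _ I(2), of f G] extend_superset[OF I(1) _ I(2), of g G]
      extend_superset[OF I(1) _ I(2), of "f + g" G]
    by (simp add: I_def subset_iff sum.distrib algebra_simps)
next
  fix c f assume f: "f \<in> QSym"
  define I where "I = {\<alpha> \<in> compositions. coord f \<alpha> \<noteq> 0} \<union> {\<alpha> \<in> compositions. coord (cscale c f) \<alpha> \<noteq> 0}"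
  have I: "finite I" "I \<subseteq> compositions" using finite_coord by (auto simp: I_def)
  have "coord (cscale c f) \<alpha> = c * coord f \<alpha>" for \<alpha>
    using linear_coord f by (simp add: linear_on_QSym_def)
  then show "extend G (cscale c f) = c * extend G f"
    using extend_superset[OF I(1) _ I(2), of f G] extend_superset[OF I(1) _ I(2), of "cscale c f" G]
    by (simp add: I_def subset_iff sum_distrib_left mult.assoc)
qed

lemma extend_basis: "\<beta> \<in> compositions \<Longrightarrow> extend G (b \<beta>) = G \<beta>"
proof -
  assume "\<beta> \<in> compositions"
  moreover from this have "{\<alpha> \<in> compositions. coord (b \<beta>) \<alpha> \<noteq> 0} \<subseteq> {\<beta>}"
    by (auto simp: coord_basis split: if_splits)
  ultimately show ?thesis using extend_superset[of "{\<beta>}" "b \<beta>" G] by (simp add: coord_basis)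
qed

lemma eqI: "linear_on_QSym s \<Longrightarrow> linear_on_QSym t \<Longrightarrow>
    (\<And>\<alpha>. \<alpha> \<in> compositions \<Longrightarrow> s (b \<alpha>) = t (b \<alpha>)) \<Longrightarrow> f \<in> QSym \<Longrightarrow> s f = t f"
  by (rule linear_on_QSym_eqI[OF _ _ span]) auto

end

interpretation fundamental: composition_basis fundamental
  by unfold_locales (simp_all add: inj_on_fundamental independent_fundamental QSym_def)

interpretation qschur: composition_basis qschur
  by unfold_locales (simp_all add: inj_on_qschur independent_qschur span_qschur)

lemma fundamental_coeff_eq: "fundamental_coeff = fundamental.coord"
  by (simp add: fun_eq_iff fundamental_coeff_def fundamental.coord_def)

lemma fund_in_QSym: "D \<subseteq> {1..<N} \<Longrightarrow> fund N D \<in> QSym"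
  using fundamental.in_QSym comp_of_set(1) fundamental_comp_of_set by metis

lemma linear_on_QSym_apply: "linear_on_QSym (\<lambda>f. f m)"
  by (simp add: linear_on_QSym_def)

section \<open>Degrees and the coordinate functionals\<close>

definition homogeneous_part :: "nat \<Rightarrow> pseries \<Rightarrow> pseries" where
  "homogeneous_part N f = (\<lambda>m. if size m = N then f m else 0)"

lemma homogeneous_part_in_QSym: "f \<in> QSym \<Longrightarrow> homogeneous_part N f \<in> QSym"
  unfolding QSym_eq bounded_quasisymmetric_def
  by (auto simp: quasisymmetric_def homogeneous_part_def)

text \<open>The basis elements are homogeneous, so the coordinate at \<beta> sees a single degree.
  This provides the vanishing in large degrees demanded by \<open>NSym\<close>, and later the finite
  support of the skew family.\<close>

lemma qschur_coord_homogeneous: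
  assumes "f \<in> QSym" "\<beta> \<in> compositions"
  shows "qschur.coord f \<beta> = qschur.coord (homogeneous_part (sum_list \<beta>) f) \<beta>"
proof (rule qschur.eqI[OF qschur.linear_coord _ _ assms(1)])
  have "homogeneous_part N (f + g) = homogeneous_part N f + homogeneous_part N g"
    "homogeneous_part N (cscale c f) = cscale c (homogeneous_part N f)" for N c f g
    by (auto simp: homogeneous_part_def fun_eq_iff)
  then show "linear_on_QSym (\<lambda>f. qschur.coord (homogeneous_part (sum_list \<beta>) f) \<beta>)"
    using qschur.linear_coord[of \<beta>] by (simp add: linear_on_QSym_def homogeneous_part_in_QSym)
next
  fix \<alpha> assume \<alpha>: "\<alpha> \<in> compositions"
  have 1: "homogeneous_part (sum_list \<alpha>) (qschur \<alpha>) = qschur \<alpha>"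
    by (auto simp: homogeneous_part_def fun_eq_iff qschur_eq_0)
  have 2: "homogeneous_part N (qschur \<alpha>) = 0" if "N \<noteq> sum_list \<alpha>" for N
    using that by (auto simp: homogeneous_part_def fun_eq_iff qschur_eq_0)
  show "qschur.coord (qschur \<alpha>) \<beta> = qschur.coord (homogeneous_part (sum_list \<beta>) (qschur \<alpha>)) \<beta>"
    using 1 2[of "sum_list \<beta>"] linear_on_QSym_0[OF qschur.linear_coord] \<alpha> assms(2)
    by (cases "sum_list \<alpha> = sum_list \<beta>") (auto simp: qschur.coord_basis)
qed

lemma qschur_coord_eq_0:
  assumes "f \<in> QSym" "\<beta> \<in> compositions" "\<And>m. size m = sum_list \<beta> \<Longrightarrow> f m = 0"
  shows "qschur.coord f \<beta> = 0"
proof -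
  have "homogeneous_part (sum_list \<beta>) f = 0"
    using assms(3) by (auto simp: homogeneous_part_def fun_eq_iff)
  then show ?thesis
    using qschur_coord_homogeneous[OF assms(1,2)] linear_on_QSym_0[OF qschur.linear_coord] by simp
qed

lemma qschur_coord_in_NSym:
  assumes "\<beta> \<in> compositions"
  shows "(\<lambda>f. qschur.coord f \<beta>) \<in> NSym"
proof -
  have "qschur.coord (fundamental \<alpha>) \<beta> = 0" if "\<alpha> \<in> compositions" "Suc (sum_list \<beta>) \<le> sum_list \<alpha>" for \<alpha>
    using that assms fundamental.in_QSym
    by (intro qschur_coord_eq_0) (simp_all add: fundamental_eq_0)
  then show ?thesis
    using qschur.linear_coord[of \<beta>] qschur.coord_outside
    unfolding NSym_def linear_on_QSym_def by blast
qed

lemma nschur_eq: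
  assumes \<beta>: "\<beta> \<in> compositions"
  shows "nschur \<beta> = (\<lambda>f. qschur.coord f \<beta>)"
  unfolding nschur_def
proof (rule the_equality)
  show "(\<lambda>f. qschur.coord f \<beta>) \<in> NSym \<and>
      (\<forall>\<alpha>\<in>compositions. qschur.coord (qschur \<alpha>) \<beta> = (if \<alpha> = \<beta> then 1 else 0))"
    using qschur_coord_in_NSym[OF \<beta>] \<beta> by (auto simp: qschur.coord_basis)
next
  fix s assume s: "s \<in> NSym \<and> (\<forall>\<alpha>\<in>compositions. s (qschur \<alpha>) = (if \<alpha> = \<beta> then 1 else 0))"
  show "s = (\<lambda>f. qschur.coord f \<beta>)"
  proof
    fix f
    show "s f = qschur.coord f \<beta>"
    proof (cases "f \<in> QSym")
      case True
      have "linear_on_QSym s" using s NSym_linear by blast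
      then show ?thesis
      proof (rule qschur.eqI[OF _ qschur.linear_coord _ True])
        fix \<alpha> assume "\<alpha> \<in> compositions"
        then show "s (qschur \<alpha>) = qschur.coord (qschur \<alpha>) \<beta>"
          using s \<beta> by (simp add: qschur.coord_basis)
      qed
    next
      case False
      then show ?thesis using s qschur.coord_outside by (simp add: NSym_def)
    qed
  qed
qed

lemma nschur_in_NSym: "\<beta> \<in> compositions \<Longrightarrow> nschur \<beta> \<in> NSym"
  by (simp add: nschur_eq qschur_coord_in_NSym)

lemmas linear_nschur = NSym_linear[OF nschur_in_NSym]

lemma nschur_qschur:
  "\<alpha> \<in> compositions \<Longrightarrow> \<beta> \<in> compositions \<Longrightarrow> nschur \<beta> (qschur \<alpha>) = (if \<alpha> = \<beta> then 1 else 0)"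
  by (auto simp: nschur_eq qschur.coord_basis)

section \<open>Products and skew functions\<close>

lemma pseries_mult_add_left: "pseries_mult (f + g) h = pseries_mult f h + pseries_mult g h"
  by (auto simp: pseries_mult_def fun_eq_iff sum.distrib[symmetric] distrib_right intro!: sum.cong)

lemma pseries_mult_scale_left: "pseries_mult (cscale c f) h = cscale c (pseries_mult f h)"
  by (auto simp: pseries_mult_def fun_eq_iff sum_distrib_left mult.assoc intro!: sum.cong)

lemma pseries_mult_commute: "pseries_mult f g = pseries_mult g f"
proof
  fix m
  show "pseries_mult f g m = pseries_mult g f m"
    unfolding pseries_mult_def
    by (rule sum.reindex_bij_witness[of _ "\<lambda>(a, b). (b, a)" "\<lambda>(a, b). (b, a)"])
      (auto simp: add.commute mult.commute)
qed

lemma pseries_mult_in_QSym: "f \<in> QSym \<Longrightarrow> g \<in> QSym \<Longrightarrow> pseries_mult f g \<in> QSym"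
  by (simp add: QSym_eq bounded_quasisymmetric_mult)

lemma linear_pseries_mult_left:
  "linear_on_QSym s \<Longrightarrow> h \<in> QSym \<Longrightarrow> linear_on_QSym (\<lambda>f. s (pseries_mult f h))"
  unfolding linear_on_QSym_def
  by (simp add: pseries_mult_add_left pseries_mult_scale_left pseries_mult_in_QSym)

lemma linear_pseries_mult_right:
  "linear_on_QSym s \<Longrightarrow> h \<in> QSym \<Longrightarrow> linear_on_QSym (\<lambda>f. s (pseries_mult h f))"
  using linear_pseries_mult_left[of s h] by (simp only: pseries_mult_commute[of h])

lemma pseries_mult_degree:
  assumes "\<And>m. size m \<noteq> M \<Longrightarrow> f m = 0" "\<And>m. size m \<noteq> N \<Longrightarrow> g m = 0" "size m \<noteq> M + N"
  shows "pseries_mult f g m = 0"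
  unfolding pseries_mult_def using assms by (intro sum.neutral) force

text \<open>Pairing the second tensor factor with the quasisymmetric Schur function of \<gamma>
  isolates the term at \<gamma>. This forces the candidate \<open>t\<close> and makes it unique; a
  comparison of degrees gives it finite support.\<close>

lemma
  assumes \<alpha>: "\<alpha> \<in> compositions" and \<beta>: "\<beta> \<in> compositions"
  shows skew_nschur_eq: "skew_nschur \<alpha> \<beta> =
      (\<lambda>f. if f \<in> QSym then nschur \<alpha> (pseries_mult f (qschur \<beta>)) else 0)"
    and skew_nschur_in_NSym: "skew_nschur \<alpha> \<beta> \<in> NSym"
proof -
  define t where "t \<beta> = (if \<beta> \<in> compositions
    then (\<lambda>f. if f \<in> QSym then nschur \<alpha> (pseries_mult f (qschur \<beta>)) else 0) else 0)" for \<beta>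
  have vanish: "nschur \<alpha> (pseries_mult (fundamental \<gamma>) (qschur \<beta>)) = 0"
    if "\<gamma> \<in> compositions" "\<beta> \<in> compositions" "sum_list \<gamma> + sum_list \<beta> \<noteq> sum_list \<alpha>" for \<beta> \<gamma>
    using that \<alpha> pseries_mult_degree[of "sum_list \<gamma>" "fundamental \<gamma>" "sum_list \<beta>" "qschur \<beta>"]
    unfolding nschur_eq[OF \<alpha>]
    by (intro qschur_coord_eq_0 pseries_mult_in_QSym)
      (simp_all add: fundamental.in_QSym qschur.in_QSym fundamental_eq_0 qschur_eq_0)
  have lin: "linear_on_QSym (t \<beta>)" if "\<beta> \<in> compositions" for \<beta>
    using linear_pseries_mult_left[OF linear_nschur[OF \<alpha>] qschur.in_QSym[OF that]] that
    by (simp add: t_def linear_on_QSym_def QSym_add QSym_scale)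
  have t_NSym: "t \<beta> \<in> NSym" if "\<beta> \<in> compositions" for \<beta>
  proof -
    have "\<forall>\<gamma>\<in>compositions. Suc (sum_list \<alpha>) \<le> sum_list \<gamma> \<longrightarrow> t \<beta> (fundamental \<gamma>) = 0"
      using vanish[OF _ that] that by (auto simp: t_def)
    moreover have "\<forall>f. f \<notin> QSym \<longrightarrow> t \<beta> f = 0" by (simp add: t_def)
    ultimately show ?thesis
      using lin[OF that] unfolding NSym_def linear_on_QSym_def by blast
  qed
  have t_0: "t \<beta> = 0" if "sum_list \<alpha> < sum_list \<beta>" for \<beta>
  proof (cases "\<beta> \<in> compositions")
    case True
    have "t \<beta> f = 0" for f
    proof (cases "f \<in> QSym")
      case f: True
      have "linear_on_QSym (\<lambda>_. 0)" by (simp add: linear_on_QSym_def)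
      from lin[OF True] this show ?thesis
      proof (rule fundamental.eqI[OF _ _ _ f])
        fix \<gamma> assume "\<gamma> \<in> compositions"
        then show "t \<beta> (fundamental \<gamma>) = 0" using vanish[of \<gamma> \<beta>] that True by (simp add: t_def)
      qed
    qed (simp add: t_def)
    then show ?thesis by (simp add: fun_eq_iff)
  qed (simp add: t_def)
  have t_outside: "t \<beta> = 0" if "\<beta> \<notin> compositions" for \<beta> using that by (simp add: t_def)
  have fin: "finite {\<beta>. t \<beta> \<noteq> 0}"
  proof (rule finite_subset[OF _ finite_compositions_le[of "sum_list \<alpha>"]])
    show "{\<beta>. t \<beta> \<noteq> 0} \<subseteq> {\<beta> \<in> compositions. sum_list \<beta> \<le> sum_list \<alpha>}"
      using t_0 t_outside not_less by blast
  qed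
  \<comment> \<open>Here \<open>t\<close> is rebound to an arbitrary family of finite support, so
    that one evaluation serves both existence and uniqueness.\<close>
  have eval: "(\<Sum>\<beta> | t \<beta> \<noteq> 0. tensor (t \<beta>) (nschur \<beta>)) (f, qschur \<gamma>) = t \<gamma> f"
    if "finite {\<beta>. t \<beta> \<noteq> 0}" "\<forall>\<beta>. \<beta> \<notin> compositions \<longrightarrow> t \<beta> = 0" "\<gamma> \<in> compositions"
    for t :: "nat list \<Rightarrow> pseries \<Rightarrow> complex" and f \<gamma>
  proof -
    have "(\<Sum>\<beta> | t \<beta> \<noteq> 0. tensor (t \<beta>) (nschur \<beta>)) (f, qschur \<gamma>)
        = (\<Sum>\<beta> | t \<beta> \<noteq> 0. if \<gamma> = \<beta> then t \<beta> f else 0)"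
      unfolding sum_apply
    proof (rule sum.cong[OF refl])
      fix \<beta> assume "\<beta> \<in> {\<beta>. t \<beta> \<noteq> 0}"
      then have "\<beta> \<in> compositions" using that(2) by blast
      then show "tensor (t \<beta>) (nschur \<beta>) (f, qschur \<gamma>) = (if \<gamma> = \<beta> then t \<beta> f else 0)"
        using that(3) by (simp add: tensor_def nschur_qschur)
    qed
    also have "\<dots> = t \<gamma> f" using that(1) by (simp add: sum.delta)
    finally show ?thesis .
  qed
  have t_prop: "(\<forall>\<beta>\<in>compositions. t \<beta> \<in> NSym) \<and> (\<forall>\<beta>. \<beta> \<notin> compositions \<longrightarrow> t \<beta> = 0) \<and>
     finite {\<beta>. t \<beta> \<noteq> 0} \<and>
     nsym_coproduct (nschur \<alpha>) = (\<Sum>\<beta> | t \<beta> \<noteq> 0. tensor (t \<beta>) (nschur \<beta>))"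
  proof (intro conjI ballI)
    show "nsym_coproduct (nschur \<alpha>) = (\<Sum>\<beta> | t \<beta> \<noteq> 0. tensor (t \<beta>) (nschur \<beta>))"
    proof (rule ext, clarify)
      fix f g
      have comps: "t \<beta> \<noteq> 0 \<Longrightarrow> \<beta> \<in> compositions" for \<beta> using t_outside by blast
      show "nsym_coproduct (nschur \<alpha>) (f, g) = (\<Sum>\<beta> | t \<beta> \<noteq> 0. tensor (t \<beta>) (nschur \<beta>)) (f, g)"
      proof (cases "f \<in> QSym \<and> g \<in> QSym")
        case True
        have "nschur \<alpha> (pseries_mult f g) = (\<Sum>\<beta> | t \<beta> \<noteq> 0. tensor (t \<beta>) (nschur \<beta>)) (f, g)"
        proof (rule qschur.eqI[of "\<lambda>g. nschur \<alpha> (pseries_mult f g)"])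
          show "linear_on_QSym (\<lambda>g. nschur \<alpha> (pseries_mult f g))"
            using True by (intro linear_pseries_mult_right linear_nschur \<alpha>) simp
          show "linear_on_QSym (\<lambda>g. (\<Sum>\<beta> | t \<beta> \<noteq> 0. tensor (t \<beta>) (nschur \<beta>)) (f, g))"
            using linear_nschur comps
            by (auto simp: linear_on_QSym_def sum_apply tensor_def sum.distrib[symmetric]
                sum_distrib_left algebra_simps intro!: sum.cong)
          fix \<gamma> assume \<gamma>: "\<gamma> \<in> compositions"
          show "nschur \<alpha> (pseries_mult f (qschur \<gamma>))
              = (\<Sum>\<beta> | t \<beta> \<noteq> 0. tensor (t \<beta>) (nschur \<beta>)) (f, qschur \<gamma>)"
            using eval[OF fin _ \<gamma>] t_outside True \<gamma> by (simp add: t_def[of \<gamma>])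
        qed (use True in simp)
        then show ?thesis using True by (simp add: nsym_coproduct_def)
      next
        case False
        have "tensor (t \<beta>) (nschur \<beta>) (f, g) = 0" if "t \<beta> \<noteq> 0" for \<beta>
          using False nschur_in_NSym[OF comps[OF that]] by (auto simp: tensor_def t_def NSym_def)
        then show ?thesis using False by (auto simp: nsym_coproduct_def sum_apply)
      qed
    qed
  qed (use t_NSym fin t_outside in auto)
  have "skew_nschur \<alpha> = t"
    unfolding skew_nschur_def
  proof (rule the_equality, rule t_prop)
    fix t' assume t': "(\<forall>\<beta>\<in>compositions. t' \<beta> \<in> NSym) \<and> (\<forall>\<beta>. \<beta> \<notin> compositions \<longrightarrow> t' \<beta> = 0) \<and>
     finite {\<beta>. t' \<beta> \<noteq> 0} \<and>
     nsym_coproduct (nschur \<alpha>) = (\<Sum>\<beta> | t' \<beta> \<noteq> 0. tensor (t' \<beta>) (nschur \<beta>))"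
    have "t' \<beta> f = t \<beta> f" for \<beta> f
    proof (cases "\<beta> \<in> compositions")
      case True
      have "t' \<beta> f = nsym_coproduct (nschur \<alpha>) (f, qschur \<beta>)" using t' eval[of t' \<beta> f] True by simp
      also have "\<dots> = t \<beta> f" using t_prop eval[of t \<beta> f] True by simp
      finally show ?thesis .
    qed (use t' t_prop in auto)
    then show "t' = t" by blast
  qed
  then show "skew_nschur \<alpha> \<beta> =
      (\<lambda>f. if f \<in> QSym then nschur \<alpha> (pseries_mult f (qschur \<beta>)) else 0)"
    "skew_nschur \<alpha> \<beta> \<in> NSym"
    using \<beta> t_NSym by (simp_all add: t_def)
qed


section \<open>Truncation of quasisymmetric functions\<close>

text \<open>The left factor of the one term in the coproduct of the fundamental function whose right
  factor is F_(n) if h holds and F_(1^n) otherwise. The place N - n is not tested, since the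
  coproduct contains both concatenations and near-concatenations.\<close>

definition trunc_fund :: "bool \<Rightarrow> nat \<Rightarrow> nat \<Rightarrow> nat set \<Rightarrow> pseries" where
  "trunc_fund h n N D =
     (if n \<le> N \<and> (\<forall>v. N - n < v \<and> v < N \<longrightarrow> (v \<notin> D) = h) then fund (N - n) (D \<inter> {..<N - n}) else 0)"

text \<open>The operator H_n of the overview if h holds and E_n otherwise, with value 0 outside
  \<open>QSym\<close>.\<close>

definition trunc :: "bool \<Rightarrow> nat \<Rightarrow> pseries \<Rightarrow> pseries" where
  "trunc h n f = (\<lambda>m. fundamental.extend (\<lambda>\<alpha>. trunc_fund h n (sum_list \<alpha>) (set_of_comp \<alpha>) m) f)"

lemma linear_trunc_apply: "linear_on_QSym (\<lambda>f. trunc h n f m)"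
  unfolding trunc_def by (rule fundamental.linear_extend)

lemma trunc_fundamental:
  "\<alpha> \<in> compositions \<Longrightarrow> trunc h n (fundamental \<alpha>) = trunc_fund h n (sum_list \<alpha>) (set_of_comp \<alpha>)"
  by (simp add: trunc_def fundamental.extend_basis)

lemma trunc_of_fund: "D \<subseteq> {1..<N} \<Longrightarrow> trunc h n (fund N D) = trunc_fund h n N D"
  using trunc_fundamental[of "comp_of_set N D" h n] comp_of_set[of D N]
  by (simp add: fundamental_comp_of_set)

lemma trunc_fund_in_QSym: "D \<subseteq> {1..<N} \<Longrightarrow> trunc_fund h n N D \<in> QSym"
  using QSym_0 by (auto simp: trunc_fund_def intro!: fund_in_QSym)

lemma trunc_in_QSym: "trunc h n f \<in> QSym"
proof -
  have "trunc h n f = (\<Sum>\<alpha> | \<alpha> \<in> compositions \<and> fundamental.coord f \<alpha> \<noteq> 0.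
      cscale (fundamental.coord f \<alpha>) (trunc_fund h n (sum_list \<alpha>) (set_of_comp \<alpha>)))"
    by (simp add: trunc_def fundamental.extend_def fun_eq_iff sum_apply)
  moreover have "trunc_fund h n (sum_list \<alpha>) (set_of_comp \<alpha>) \<in> QSym" if "\<alpha> \<in> compositions" for \<alpha>
    by (rule trunc_fund_in_QSym[OF set_of_comp_subset[OF that]])
  ultimately show ?thesis by (simp only:) (intro QSym_sum QSym_scale, blast)
qed

lemma trunc_add: "f \<in> QSym \<Longrightarrow> g \<in> QSym \<Longrightarrow> trunc h n (f + g) = trunc h n f + trunc h n g"
  using linear_on_QSym_add[OF linear_trunc_apply] by (simp add: fun_eq_iff)

lemma trunc_scale: "f \<in> QSym \<Longrightarrow> trunc h n (cscale c f) = cscale c (trunc h n f)"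
  using linear_on_QSym_scale[OF linear_trunc_apply] by (simp add: fun_eq_iff)

lemma linear_trunc: "linear_on_QSym s \<Longrightarrow> linear_on_QSym (\<lambda>f. s (trunc h n f))"
  by (simp add: linear_on_QSym_def trunc_add trunc_scale trunc_in_QSym)

lemma trunc_sum:
  assumes "\<And>i. i \<in> I \<Longrightarrow> f i \<in> QSym"
  shows "trunc h n (\<Sum>i\<in>I. cscale (c i) (f i)) = (\<Sum>i\<in>I. cscale (c i) (trunc h n (f i)))"
proof
  fix m
  show "trunc h n (\<Sum>i\<in>I. cscale (c i) (f i)) m = (\<Sum>i\<in>I. cscale (c i) (trunc h n (f i))) m"
    using linear_on_QSym_scale_sum[OF linear_trunc_apply[of h n m], of I f c] assms
    by (simp add: sum_apply)
qed

lemma pseries_mult_sum_right: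
  "pseries_mult g (\<Sum>i\<in>I. cscale (c i) (f i)) m = (\<Sum>i\<in>I. c i * pseries_mult g (f i) m)"
proof -
  have "pseries_mult g (\<Sum>i\<in>I. cscale (c i) (f i)) m
      = (\<Sum>p\<in>{(a, b). a + b = m}. \<Sum>i\<in>I. c i * (g (fst p) * f i (snd p)))"
    by (simp add: pseries_mult_def case_prod_unfold sum_apply sum_distrib_left algebra_simps)
  also have "\<dots> = (\<Sum>i\<in>I. c i * pseries_mult g (f i) m)"
    by (subst sum.swap) (simp add: pseries_mult_def case_prod_unfold sum_distrib_left)
  finally show ?thesis .
qed

section \<open>A last variable and the product rule\<close>

lemma ascent_set_add_replicate:
  assumes "\<forall>x\<in>#m. x < k"
  shows "ascent_set (m + replicate_mset n k) = ascent_set m \<union> (if n \<noteq> 0 \<and> m \<noteq> {#} then {size m} else {})"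
proof -
  define s where "s = sorted_list_of_multiset m"
  have s: "sorted s" "mset s = m" "length s = size m" by (simp_all add: s_def)
  have "sorted (s @ replicate n k)" using s assms by (auto simp: sorted_append less_imp_le)
  then have "sorted_list_of_multiset (mset (s @ replicate n k)) = s @ replicate n k"
    by (simp only: sorted_list_of_multiset_mset sorted_sort_id)
  moreover have "mset (s @ replicate n k) = m + replicate_mset n k"
    using s(2) by (simp add: mset_replicate)
  ultimately have l: "sorted_list_of_multiset (m + replicate_mset n k) = s @ replicate n k" by metis
  have last: "s ! (size m - 1) < k" if "m \<noteq> {#}"
  proof -
    have "size m - 1 < length s" using that s(3) by (simp add: nonempty_has_size)
    then have "s ! (size m - 1) \<in># m" using s(2) by (metis nth_mem set_mset_mset)
    then show ?thesis using assms by blast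
  qed
  show ?thesis
  proof (rule set_eqI)
    fix j
    consider "j < size m" | "j = size m" | "size m < j" by linarith
    then show "j \<in> ascent_set (m + replicate_mset n k) \<longleftrightarrow>
        j \<in> ascent_set m \<union> (if n \<noteq> 0 \<and> m \<noteq> {#} then {size m} else {})"
    proof cases
      case 1
      then show ?thesis unfolding ascent_set_def l s_def[symmetric] using s(3) by (auto simp: nth_append)
    next
      case 2
      then show ?thesis unfolding ascent_set_def l s_def[symmetric]
        using s(3) last by (auto simp: nth_append Suc_le_eq nonempty_has_size)
    next
      case 3
      then show ?thesis unfolding ascent_set_def l s_def[symmetric] using s(3) by (auto simp: nth_append)
    qed
  qed
qed

text \<open>Removing \<open>n\<close> final non-descents extracts the coefficient of the \<open>n\<close>-th power of a last variable;
  this is what makes \<open>trunc True\<close> compatible with products.\<close>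

lemma trunc_True_apply:
  assumes f: "f \<in> QSym" and k: "\<forall>x\<in>#m. x < k"
  shows "trunc True n f m = f (m + replicate_mset n k)"
proof (rule fundamental.eqI[OF linear_trunc_apply linear_on_QSym_apply _ f])
  fix \<alpha> assume \<alpha>: "\<alpha> \<in> compositions"
  define N D where "N = sum_list \<alpha>" and "D = set_of_comp \<alpha>"
  have D: "D \<subseteq> {1..<N}" using set_of_comp_subset[OF \<alpha>] by (simp add: N_def D_def)
  have "D \<subseteq> ascent_set (m + replicate_mset n k) \<longleftrightarrow>
      (\<forall>v. size m < v \<and> v < N \<longrightarrow> v \<notin> D) \<and> D \<inter> {..<size m} \<subseteq> ascent_set m" if N: "size m + n = N"
  proof
    assume "D \<subseteq> ascent_set (m + replicate_mset n k)"
    then show "(\<forall>v. size m < v \<and> v < N \<longrightarrow> v \<notin> D) \<and> D \<inter> {..<size m} \<subseteq> ascent_set m"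
      unfolding ascent_set_add_replicate[OF k]
      by (auto simp: ascent_set_def split: if_splits)
  next
    assume *: "(\<forall>v. size m < v \<and> v < N \<longrightarrow> v \<notin> D) \<and> D \<inter> {..<size m} \<subseteq> ascent_set m"
    show "D \<subseteq> ascent_set (m + replicate_mset n k)"
    proof
      fix d assume d: "d \<in> D"
      then have "1 \<le> d" "d < N" "\<not> size m < d" using D * by auto
      then consider "d < size m" | "d = size m" "n \<noteq> 0" "m \<noteq> {#}" using N by fastforce
      then show "d \<in> ascent_set (m + replicate_mset n k)"
        unfolding ascent_set_add_replicate[OF k] using * d by cases auto
    qed
  qed
  then have "trunc_fund True n N D m = fund N D (m + replicate_mset n k)"
    by (auto simp: trunc_fund_def fund_def)
  then show "trunc True n (fundamental \<alpha>) m = fundamental \<alpha> (m + replicate_mset n k)"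
    unfolding trunc_fundamental[OF \<alpha>] by (simp add: fundamental_eq[OF \<alpha>] N_def D_def)
qed

text \<open>With k beyond all variables of m, a factorisation of m times the n-th power of the
  variable k splits m and distributes the n copies of k independently. The number of copies in the
  first factor is the summation index.\<close>

lemma trunc_True_mult:
  assumes f: "f \<in> QSym" and g: "g \<in> QSym"
  shows "trunc True n (pseries_mult f g) m =
    (\<Sum>i\<le>n. pseries_mult (trunc True i f) (trunc True (n - i) g) m)"
proof -
  obtain k where k: "\<forall>x\<in>set_mset m. x < k" using finite_nat_set_iff_bounded[of "set_mset m"] by auto
  have k': "k \<notin># m" using k by auto
  have nk: "filter_mset (\<lambda>x. x \<noteq> k) c + replicate_mset (count c k) k = c" for c
    using multiset_partition[of c "\<lambda>x. x \<noteq> k"] by (simp add: filter_eq_replicate_mset)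
  have "(\<Sum>i\<le>n. pseries_mult (trunc True i f) (trunc True (n - i) g) m)
      = (\<Sum>i\<le>n. \<Sum>(a, b)\<in>{(a, b). a + b = m}. f (a + replicate_mset i k) * g (b + replicate_mset (n - i) k))"
    unfolding pseries_mult_def using k
    by (intro sum.cong refl) (auto intro!: arg_cong2[where f = "(*)"] trunc_True_apply f g)
  also have "\<dots> = (\<Sum>(i, a, b)\<in>{..n} \<times> {(a, b). a + b = m}.
      f (a + replicate_mset i k) * g (b + replicate_mset (n - i) k))"
    by (simp add: sum.cartesian_product case_prod_unfold)
  also have "\<dots> = (\<Sum>(a, b)\<in>{(a, b). a + b = m + replicate_mset n k}. f a * g b)"
  proof (rule sum.reindex_bij_witness[where
        j = "\<lambda>(i, a, b). (a + replicate_mset i k, b + replicate_mset (n - i) k)" and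
        i = "\<lambda>(a, b). (count a k, filter_mset (\<lambda>x. x \<noteq> k) a, filter_mset (\<lambda>x. x \<noteq> k) b)"])
    fix p assume "p \<in> {..n} \<times> {(a, b). a + b = m}"
    then obtain i a b where p: "p = (i, a, b)" "i \<le> n" "a + b = m" by auto
    have "k \<notin># a" "k \<notin># b" using k' p(3) by auto
    moreover have "filter_mset (\<lambda>x. x \<noteq> k) c = c" if "k \<notin># c" for c
      by (rule multiset_eqI) (use that in \<open>auto simp: not_in_iff\<close>)
    ultimately have "count a k = 0" "filter_mset (\<lambda>x. x \<noteq> k) a = a" "filter_mset (\<lambda>x. x \<noteq> k) b = b"
      by (auto simp: not_in_iff)
    then show "(case case p of (i, a, b) \<Rightarrow> (a + replicate_mset i k, b + replicate_mset (n - i) k) of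
        (a, b) \<Rightarrow> (count a k, filter_mset (\<lambda>x. x \<noteq> k) a, filter_mset (\<lambda>x. x \<noteq> k) b)) = p"
      using p by simp
    have "a + replicate_mset i k + (b + replicate_mset (n - i) k) = m + replicate_mset n k"
      using p by (auto simp: multiset_eq_iff)
    then show "(case p of (i, a, b) \<Rightarrow> (a + replicate_mset i k, b + replicate_mset (n - i) k))
        \<in> {(a, b). a + b = m + replicate_mset n k}"
      using p by simp
  next
    fix p assume "p \<in> {(a, b). a + b = m + replicate_mset n k}"
    then obtain a b where p: "p = (a, b)" "a + b = m + replicate_mset n k" by auto
    have "count (a + b) k = n" unfolding p(2) using k' by (simp add: not_in_iff)
    then have c: "count a k \<le> n" "n - count a k = count b k" by auto
    have "filter_mset (\<lambda>x. x \<noteq> k) (m + replicate_mset n k) = m"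
      using k' by (auto simp: multiset_eq_iff not_in_iff)
    then have "filter_mset (\<lambda>x. x \<noteq> k) a + filter_mset (\<lambda>x. x \<noteq> k) b = m"
      unfolding p(2)[symmetric] by simp
    then show "(case p of (a, b) \<Rightarrow> (count a k, filter_mset (\<lambda>x. x \<noteq> k) a, filter_mset (\<lambda>x. x \<noteq> k) b))
        \<in> {..n} \<times> {(a, b). a + b = m}"
      using p c by simp
    show "(case case p of (a, b) \<Rightarrow> (count a k, filter_mset (\<lambda>x. x \<noteq> k) a, filter_mset (\<lambda>x. x \<noteq> k) b) of
        (i, a, b) \<Rightarrow> (a + replicate_mset i k, b + replicate_mset (n - i) k)) = p"
      using p c nk by simp
  qed auto
  also have "\<dots> = pseries_mult f g (m + replicate_mset n k)" by (simp add: pseries_mult_def)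
  also have "\<dots> = trunc True n (pseries_mult f g) m"
    using trunc_True_apply[OF pseries_mult_in_QSym[OF f g] k] by simp
  finally show ?thesis by simp
qed

section \<open>The alternating identities\<close>

lemma alternating_telescope:
  fixes q :: "nat \<Rightarrow> complex"
  shows "(\<Sum>j\<le>n. (-1) ^ j * (q j + q (Suc j))) = q 0 + (-1) ^ n * q (Suc n)"
  by (induction n) (auto simp: algebra_simps)

text \<open>\<open>q j\<close> is the case in which the pattern changes exactly at \<open>N - j\<close>; each admissible change point
  is counted by \<open>j\<close> and by \<open>j - 1\<close>, with opposite signs.\<close>

lemma alternating_patterns:
  fixes P :: "nat \<Rightarrow> bool"
  assumes "1 \<le> n" "n \<le> N"
  shows "(\<Sum>j\<le>n. (-1) ^ j * (if (\<forall>v. N - j < v \<and> v < N \<longrightarrow> \<not> P v) \<and> (\<forall>v. N - n < v \<and> v < N - j \<longrightarrow> P v)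
    then 1 else 0)) = (0 :: complex)"
proof -
  define A where "A j \<longleftrightarrow> (\<forall>v. N - j < v \<and> v < N \<longrightarrow> \<not> P v) \<and> (\<forall>v. N - n < v \<and> v < N - j \<longrightarrow> P v)" for j
  define Q where "Q j \<longleftrightarrow> 1 \<le> j \<and> j \<le> n \<and> (\<forall>v. N - j < v \<and> v < N \<longrightarrow> \<not> P v) \<and>
    (\<forall>v. N - n < v \<and> v \<le> N - j \<longrightarrow> P v)" for j
  define q where "q j = (if Q j then 1 else 0 :: complex)" for j
  have "(if A j then 1 else 0) = q j + q (Suc j)" if j: "j \<le> n" for j
  proof -
    consider "j = 0" | "1 \<le> j" "j = n" | "1 \<le> j" "j < n" using j by linarith
    then show ?thesis
    proof cases
      case 1
      have "A 0 \<longleftrightarrow> Q (Suc 0)" using assms unfolding A_def Q_def by auto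
      moreover have "\<not> Q 0" by (simp add: Q_def)
      ultimately show ?thesis using 1 by (simp add: q_def)
    next
      case 2
      have "A n \<longleftrightarrow> Q n" using assms unfolding A_def Q_def by auto
      moreover have "\<not> Q (Suc n)" by (simp add: Q_def)
      ultimately show ?thesis using 2 by (simp add: q_def)
    next
      case 3
      \<comment> \<open>\<open>A j\<close> demands nothing at w itself. \<open>Q j\<close> adds the
        demand \<open>P w\<close> and \<open>Q (Suc j)\<close> its negation, so exactly one of them
        holds when \<open>A j\<close> does.\<close>
      define w where "w = N - j"
      have w: "N - n < w" "w < N" "N - Suc j = w - 1" "1 \<le> w" using 3 assms by (auto simp: w_def)
      have le: "w - 1 < v \<longleftrightarrow> w \<le> v" "v \<le> w - 1 \<longleftrightarrow> v < w" for v using w(4) by auto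
      have low: "(\<forall>v. N - n < v \<and> v \<le> w \<longrightarrow> P v) \<longleftrightarrow> P w \<and> (\<forall>v. N - n < v \<and> v < w \<longrightarrow> P v)"
        using w(1) by (auto simp: le_less)
      have high: "(\<forall>v. w \<le> v \<and> v < N \<longrightarrow> \<not> P v) \<longleftrightarrow> \<not> P w \<and> (\<forall>v. w < v \<and> v < N \<longrightarrow> \<not> P v)"
        using w(2) by (auto simp: le_less)
      have Aj: "A j \<longleftrightarrow> (\<forall>v. w < v \<and> v < N \<longrightarrow> \<not> P v) \<and> (\<forall>v. N - n < v \<and> v < w \<longrightarrow> P v)"
        by (simp add: A_def w_def)
      have "Q j \<longleftrightarrow> (\<forall>v. w < v \<and> v < N \<longrightarrow> \<not> P v) \<and> (\<forall>v. N - n < v \<and> v \<le> w \<longrightarrow> P v)"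
        using 3 by (simp add: Q_def w_def)
      then have Qj: "Q j \<longleftrightarrow> P w \<and> A j" unfolding low Aj by blast
      have "Q (Suc j) \<longleftrightarrow> (\<forall>v. w \<le> v \<and> v < N \<longrightarrow> \<not> P v) \<and> (\<forall>v. N - n < v \<and> v < w \<longrightarrow> P v)"
        using 3 unfolding Q_def w(3) le by simp
      then have "Q (Suc j) \<longleftrightarrow> \<not> P w \<and> A j" unfolding high Aj by blast
      with Qj show ?thesis by (simp add: q_def)
    qed
  qed
  then have "(\<Sum>j\<le>n. (-1) ^ j * (if A j then 1 else 0)) = (\<Sum>j\<le>n. (-1) ^ j * (q j + q (Suc j)))"
    by (intro sum.cong) auto
  \<comment> \<open>Both end terms vanish because Q requires 1 \<le> j and j \<le> n.\<close>
  also have "\<dots> = 0" unfolding alternating_telescope by (simp add: q_def Q_def)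
  finally show ?thesis by (simp add: A_def)
qed

text \<open>On a fundamental function all terms share the remainder
  \<open>fund (N - n) (D \<inter> {..<N - n})\<close>. What varies with j is a condition on the
  descents above N - n: the pattern of \<open>\<not> h\<close> after N - j, that of h before it, and
  no demand at N - j. \<open>alternating_patterns\<close> sums these conditions to 0.\<close>

lemma trunc_alternating:
  assumes f: "f \<in> QSym"
  shows "(\<Sum>j\<le>n. (-1) ^ j * trunc h (n - j) (trunc (\<not> h) j f) m) = (if n = 0 then f m else 0)"
proof (rule fundamental.eqI[OF _ _ _ f])
  show "linear_on_QSym (\<lambda>f. \<Sum>j\<le>n. (-1) ^ j * trunc h (n - j) (trunc (\<not> h) j f) m)"
    using linear_trunc[OF linear_trunc_apply]
    by (auto simp: linear_on_QSym_def sum.distrib[symmetric] sum_distrib_left algebra_simps intro!: sum.cong)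
  show "linear_on_QSym (\<lambda>f. if n = 0 then f m else 0)"
    by (simp add: linear_on_QSym_def)
  fix \<alpha> assume \<alpha>: "\<alpha> \<in> compositions"
  define N D where "N = sum_list \<alpha>" and "D = set_of_comp \<alpha>"
  have D: "D \<subseteq> {1..<N}" using set_of_comp_subset[OF \<alpha>] by (simp add: N_def D_def)
  have F: "fundamental \<alpha> = fund N D" using fundamental_eq[OF \<alpha>] by (simp add: N_def D_def)
  define P where "P v \<longleftrightarrow> (v \<notin> D) = h" for v
  have at_fund: "trunc h (n - j) (trunc (\<not> h) j (fund N D)) m
      = (if n \<le> N \<and> (\<forall>v. N - j < v \<and> v < N \<longrightarrow> \<not> P v) \<and> (\<forall>v. N - n < v \<and> v < N - j \<longrightarrow> P v)
         then 1 else 0) * fund (N - n) (D \<inter> {..<N - n}) m" if j: "j \<le> n" for j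
  proof -
    have "D \<inter> {..<N - j} \<subseteq> {1..<N - j}" using D by auto
    note inner = trunc_of_fund[OF this, of h "n - j"]
    have sub: "D \<inter> {..<N - j} \<inter> {..<N - n} = D \<inter> {..<N - n}" using j by auto
    have zero: "trunc h (n - j) 0 m = 0" using linear_on_QSym_0[OF linear_trunc_apply] .
    have cond: "(\<forall>v. N - j - (n - j) < v \<and> v < N - j \<longrightarrow> (v \<notin> D \<inter> {..<N - j}) = h)
        \<longleftrightarrow> (\<forall>v. N - n < v \<and> v < N - j \<longrightarrow> P v)" if "n \<le> N"
      using j that by (auto simp: P_def)
    have P': "(v \<notin> D) = (\<not> h) \<longleftrightarrow> \<not> P v" for v by (auto simp: P_def)
    show ?thesis
      using j zero sub cond inner P'
      by (auto simp: trunc_of_fund[OF D] trunc_fund_def)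
  qed
  show "(\<Sum>j\<le>n. (-1) ^ j * trunc h (n - j) (trunc (\<not> h) j (fundamental \<alpha>)) m)
      = (if n = 0 then fundamental \<alpha> m else 0)"
  proof (cases "n = 0 \<or> N < n")
    case True
    then show ?thesis
    proof
      assume "n = 0"
      have "D \<inter> {..<N} = D" using D by auto
      moreover have "(\<forall>v. N - 0 < v \<and> v < N \<longrightarrow> \<not> P v) \<and> (\<forall>v. N - n < v \<and> v < N - 0 \<longrightarrow> P v)"
        using \<open>n = 0\<close> by auto
      ultimately have "trunc h 0 (trunc (\<not> h) 0 (fund N D)) m = fund N D m"
        using \<open>n = 0\<close> at_fund[of 0] by simp
      then show ?thesis using \<open>n = 0\<close> F by simp
    next
      assume "N < n"
      then have "(\<Sum>j\<le>n. (-1) ^ j * trunc h (n - j) (trunc (\<not> h) j (fundamental \<alpha>)) m) = 0"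
        unfolding F by (intro sum.neutral) (simp add: at_fund)
      then show ?thesis using \<open>N < n\<close> by simp
    qed
  next
    case False
    then have n: "1 \<le> n" "n \<le> N" by auto
    have "(\<Sum>j\<le>n. (-1) ^ j * trunc h (n - j) (trunc (\<not> h) j (fundamental \<alpha>)) m)
      = (\<Sum>j\<le>n. (-1) ^ j * (if (\<forall>v. N - j < v \<and> v < N \<longrightarrow> \<not> P v) \<and>
          (\<forall>v. N - n < v \<and> v < N - j \<longrightarrow> P v) then 1 else 0)) * fund (N - n) (D \<inter> {..<N - n}) m"
      unfolding F sum_distrib_right using n by (intro sum.cong) (auto simp: at_fund)
    then show ?thesis using alternating_patterns[OF n, of P] n by simp
  qed
qed

lemma sum_triangle_swap:
  fixes n :: nat
  shows "(\<Sum>j\<le>n. \<Sum>i\<le>n - j. g i j) = (\<Sum>i\<le>n. \<Sum>j\<le>n - i. g i j)"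
proof -
  have "(\<Sum>j\<le>n. \<Sum>i\<le>n - j. g i j) = (\<Sum>j\<le>n. \<Sum>i | i \<in> {..n} \<and> i + j \<le> n. g i j)"
    by (intro sum.cong) auto
  also have "\<dots> = (\<Sum>i\<le>n. \<Sum>j | j \<in> {..n} \<and> i + j \<le> n. g i j)"
    by (rule sum.swap_restrict) auto
  also have "\<dots> = (\<Sum>i\<le>n. \<Sum>j\<le>n - i. g i j)"
    by (intro sum.cong) auto
  finally show ?thesis .
qed

text \<open>After the product rule and an exchange of the sums, the i-th summand contains the
  alternating sum \<open>R (n - i)\<close>, which is f for i = n and 0 otherwise.\<close>

lemma trunc_alternating_mult_True:
  assumes f: "f \<in> QSym" and g: "g \<in> QSym"
  shows "(\<Sum>j\<le>n. (-1) ^ j * trunc True (n - j) (pseries_mult g (trunc False j f)) m)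
    = pseries_mult (trunc True n g) f m"
proof -
  define R where "R j = (\<Sum>i\<le>j. cscale ((-1) ^ i) (trunc True (j - i) (trunc False i f)))" for j
  have R: "R j = (if j = 0 then f else 0)" for j
    using trunc_alternating[OF f, where h = True and n = j] by (auto simp: R_def fun_eq_iff sum_apply)
  have "(\<Sum>j\<le>n. (-1) ^ j * trunc True (n - j) (pseries_mult g (trunc False j f)) m)
    = (\<Sum>j\<le>n. \<Sum>i\<le>n - j. (-1) ^ j *
        pseries_mult (trunc True i g) (trunc True (n - i - j) (trunc False j f)) m)"
    by (simp add: trunc_True_mult[OF g trunc_in_QSym] sum_distrib_left add.commute)
  also have "\<dots> = (\<Sum>i\<le>n. \<Sum>j\<le>n - i. (-1) ^ j *
        pseries_mult (trunc True i g) (trunc True (n - i - j) (trunc False j f)) m)"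
    by (rule sum_triangle_swap)
  also have "\<dots> = (\<Sum>i\<le>n. pseries_mult (trunc True i g) (R (n - i)) m)"
    unfolding R_def pseries_mult_sum_right ..
  also have "\<dots> = (\<Sum>i\<in>{n}. pseries_mult (trunc True i g) (R (n - i)) m)"
    by (intro sum.mono_neutral_right) (auto simp: R pseries_mult_def)
  finally show ?thesis by (simp add: R)
qed

text \<open>The preceding identity with f and g interchanged writes the product of g and H_j f as
  the sum over b of (-1)^b times H_{j-b} of the product X b of f and E_b g. Insert this and put c =
  j - b: for fixed b, the sum over c is the alternating sum of E and H in degree n - b applied to X
  b, so only b = n survives.\<close>

lemma trunc_alternating_mult_False:
  assumes f: "f \<in> QSym" and g: "g \<in> QSym"
  shows "(\<Sum>j\<le>n. (-1) ^ j * trunc False (n - j) (pseries_mult g (trunc True j f)) m)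
    = pseries_mult (trunc False n g) f m"
proof -
  define X where "X b = pseries_mult f (trunc False b g)" for b
  have X: "X b \<in> QSym" for b by (simp add: X_def pseries_mult_in_QSym f trunc_in_QSym)
  have "pseries_mult g (trunc True j f) = (\<Sum>b\<le>j. cscale ((-1) ^ b) (trunc True (j - b) (X b)))" for j
    using trunc_alternating_mult_True[OF g f, of j] pseries_mult_commute[of g]
    by (simp add: fun_eq_iff sum_apply X_def)
  then have "(\<Sum>j\<le>n. (-1) ^ j * trunc False (n - j) (pseries_mult g (trunc True j f)) m)
    = (\<Sum>j\<le>n. \<Sum>b\<le>j. (-1) ^ (j + b) * trunc False (n - j) (trunc True (j - b) (X b)) m)"
    by (simp add: trunc_sum trunc_in_QSym sum_apply sum_distrib_left power_add mult.assoc)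
  also have "\<dots> = (\<Sum>j\<le>n. \<Sum>b\<le>j. (-1) ^ (j - b) * trunc False (n - b - (j - b)) (trunc True (j - b) (X b)) m)"
  proof (intro sum.cong refl)
    fix j b assume "j \<in> {..n}" "b \<in> {..j}"
    then obtain d where d: "j = b + d" by (metis atMost_iff le_Suc_ex)
    \<comment> \<open>j + b and j - b have the same parity, so the two signs combine to the sign for
      c = j - b.\<close>
    have e: "b + d + b = d + 2 * b" by simp
    have "(-1 :: complex) ^ (b + d + b) = (-1) ^ d"
      unfolding e by (simp add: power_add power_mult)
    with d show "(-1) ^ (j + b) * trunc False (n - j) (trunc True (j - b) (X b)) m
        = (-1) ^ (j - b) * trunc False (n - b - (j - b)) (trunc True (j - b) (X b)) m"
      by simp
  qed
  also have "\<dots> = (\<Sum>(b, c)\<in>{(b, c). b + c \<le> n}. (-1) ^ c * trunc False (n - b - c) (trunc True c (X b)) m)"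
    by (rule sum.triangle_reindex_eq[symmetric])
  also have "{(b, c). b + c \<le> n} = (SIGMA b:{..n}. {..n - b})" by auto
  also have "(\<Sum>(b, c)\<in>(SIGMA b:{..n}. {..n - b}). (-1) ^ c * trunc False (n - b - c) (trunc True c (X b)) m)
    = (\<Sum>b\<le>n. \<Sum>c\<le>n - b. (-1) ^ c * trunc False (n - b - c) (trunc True c (X b)) m)"
    by (rule sum.Sigma[symmetric]) auto
  also have "\<dots> = (\<Sum>b\<le>n. if n - b = 0 then X b m else 0)"
  proof (intro sum.cong refl)
    fix b
    show "(\<Sum>c\<le>n - b. (-1) ^ c * trunc False (n - b - c) (trunc True c (X b)) m) =
        (if n - b = 0 then X b m else 0)"
      using trunc_alternating[OF X[of b], where h = False and n = "n - b" and m = m] by simp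
  qed
  also have "\<dots> = (\<Sum>b\<in>{n}. if n - b = 0 then X b m else 0)"
    by (intro sum.mono_neutral_right) auto
  finally show ?thesis by (simp add: X_def pseries_mult_commute)
qed

lemma trunc_alternating_mult:
  assumes "f \<in> QSym" "g \<in> QSym"
  shows "(\<Sum>j\<le>n. (-1) ^ j * trunc h (n - j) (pseries_mult g (trunc (\<not> h) j f)) m)
    = pseries_mult (trunc h n g) f m"
  using trunc_alternating_mult_True[OF assms] trunc_alternating_mult_False[OF assms] by (cases h) auto

section \<open>Truncation as the adjoint of right multiplication\<close>

lemma trunc_qschur:
  assumes \<beta>: "\<beta> \<in> compositions"
  shows "trunc h n (qschur \<beta>) = (\<Sum>\<alpha> | \<alpha> \<in> compositions \<and> strip h n \<alpha> \<beta>. qschur \<alpha>)"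
proof -
  have D: "descents ks \<subseteq> {1..<sum_list \<beta>}" if "ks \<in> words \<beta>" for ks
    using words_length[OF that] by (auto simp: descents_def)
  have "trunc h n (qschur \<beta>) = (\<Sum>ks\<in>words \<beta>. trunc h n (fund (sum_list \<beta>) (descents ks)))"
    unfolding qschur_eq
    using trunc_sum[of "words \<beta>" "\<lambda>ks. fund (sum_list \<beta>) (descents ks)" h n "\<lambda>_. 1"] D
    by (simp add: fund_in_QSym cscale_def)
  also have "\<dots> = (\<Sum>ks\<in>words \<beta>. trunc_fund h n (sum_list \<beta>) (descents ks))"
    using D by (intro sum.cong) (simp_all add: trunc_of_fund)
  also have "\<dots> = (\<Sum>\<alpha> | \<alpha> \<in> compositions \<and> strip h n \<alpha> \<beta>. \<Sum>ks\<in>words \<alpha>. fund (sum_list \<alpha>) (descents ks))"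
    unfolding trunc_fund_def by (rule strip_sum[OF \<beta>])
  finally show ?thesis by (simp add: qschur_eq)
qed

text \<open>The composition (n) or (1^n). For n = 0 both are empty; \<open>[n]\<close> would then be
  \<open>[0]\<close>, which is not a composition.\<close>

definition strip_comp :: "bool \<Rightarrow> nat \<Rightarrow> nat list" where
  "strip_comp h n = (if n = 0 then [] else if h then [n] else replicate n 1)"

lemma strip_comp_compositions: "strip_comp h n \<in> compositions"
  by (auto simp: strip_comp_def compositions_def)

lemma sum_list_strip_comp: "sum_list (strip_comp h n) = n"
  by (simp add: strip_comp_def sum_list_replicate)

lemma set_of_comp_strip_comp:
  "1 \<le> v \<Longrightarrow> v < n \<Longrightarrow> v \<notin> set_of_comp (strip_comp h n) \<longleftrightarrow> h"
proof -
  have "set_of_comp (replicate n 1) = {1..<n}" for n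
  proof (induction n)
    case (Suc n)
    show ?case
    proof (cases n)
      case (Suc k)
      have "set_of_comp (replicate (Suc n) 1) = insert 1 (Suc ` set_of_comp (replicate n 1))"
        using Suc by simp
      also have "\<dots> = insert 1 {Suc 1..<Suc n}"
        unfolding Suc.IH by (simp only: image_Suc_atLeastLessThan)
      also have "\<dots> = {1..<Suc n}" using Suc by auto
      finally show ?thesis .
    qed simp
  qed simp
  then show "1 \<le> v \<Longrightarrow> v < n \<Longrightarrow> v \<notin> set_of_comp (strip_comp h n) \<longleftrightarrow> h"
    by (auto simp: strip_comp_def)
qed

lemma strip_from_empty: "strip h n [] \<beta> \<longleftrightarrow> \<beta> = strip_comp h n"
proof
  assume "strip h n [] \<beta>"
  then obtain w where "length w = n" "monotone_word h w" "path addR [] w \<beta>" by (auto simp: strip_def)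
  then show "\<beta> = strip_comp h n"
    using path_monotone_from_empty[of addR h w \<beta>] by (auto simp: strip_comp_def split: if_splits)
next
  assume \<beta>: "\<beta> = strip_comp h n"
  define w where "w = (if h then [1..<Suc n] else replicate n 1)"
  have w: "length w = n" by (simp add: w_def)
  have m: "monotone_word h w"
    by (cases h) (auto simp: w_def monotone_word_True monotone_word_False sorted_wrt_upt
        sorted_wrt_iff_nth_less simp del: upt_Suc)
  have "path addR [] w \<beta>"
    using path_monotone_from_empty[of addR h w \<beta>] m w \<beta>
    by (auto simp: strip_comp_def w_def simp del: upt_Suc)
  then show "strip h n [] \<beta>" using w m by (auto simp: strip_def)
qed

lemma finite_strip_source: "finite {\<alpha> \<in> compositions. strip h n \<alpha> \<beta>}"
  by (rule finite_subset[OF _ finite_compositions_le[of "sum_list \<beta>"]])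
    (auto simp: strip_def dest: sum_list_path_addR)

lemma finite_strip_target:
  assumes "\<alpha> \<in> compositions"
  shows "finite {\<beta> \<in> compositions. strip h n \<alpha> \<beta>}"
  using assms
  by (intro finite_subset[OF _ finite_compositions_le[of "sum_list \<alpha> + n"]])
    (auto simp: strip_def dest: sum_list_path_addR)

text \<open>The functional that sends f to the constant term of \<open>trunc h n f\<close> takes the
  value 1 at those quasisymmetric Schur functions whose index is reached by a strip from the empty
  composition, and 0 at the others. Hence it is \<open>nschur (strip_comp h n)\<close>, and it can
  be evaluated on the fundamental basis, where it turns out to be dual to F_(n) or F_(1^n).\<close>

lemma nschur_strip_comp_fundamental:
  assumes \<gamma>: "\<gamma> \<in> compositions"
  shows "nschur (strip_comp h n) (fundamental \<gamma>) = (if \<gamma> = strip_comp h n then 1 else 0)"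
proof -
  have "nschur (strip_comp h n) f = trunc h n f {#}" if "f \<in> QSym" for f
  proof (rule qschur.eqI[OF linear_nschur[OF strip_comp_compositions] linear_trunc_apply _ that])
    fix \<beta> assume \<beta>: "\<beta> \<in> compositions"
    have "qschur \<alpha> {#} = (if \<alpha> = [] then 1 else 0)" if "\<alpha> \<in> compositions" for \<alpha>
    proof (cases "\<alpha> = []")
      case True
      have "ks = []" if "ks \<in> words []" for ks using words_length[OF that] by simp
      moreover have "[] \<in> words []" by (simp add: words_def)
      ultimately have "words [] = {[]}" by blast
      then show ?thesis using True by (simp add: qschur_eq fund_def descents_def)
    next
      case False
      then show ?thesis using that sum_list_compositions_0[of \<alpha>] by (simp add: qschur_eq_0)
    qed
    then have "trunc h n (qschur \<beta>) {#}
        = (\<Sum>\<alpha> | \<alpha> \<in> compositions \<and> strip h n \<alpha> \<beta>. if \<alpha> = [] then 1 else 0)"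
      by (simp add: trunc_qschur[OF \<beta>] sum_apply)
    also have "\<dots> = (if strip h n [] \<beta> then 1 else 0)"
      using finite_strip_source by (simp add: sum.delta)
    finally show "nschur (strip_comp h n) (qschur \<beta>) = trunc h n (qschur \<beta>) {#}"
      using \<beta> by (simp add: nschur_qschur strip_comp_compositions strip_from_empty)
  qed
  from this[OF fundamental.in_QSym[OF \<gamma>]]
  have "nschur (strip_comp h n) (fundamental \<gamma>) = trunc_fund h n (sum_list \<gamma>) (set_of_comp \<gamma>) {#}"
    by (simp add: trunc_fundamental[OF \<gamma>])
  also have "\<dots> = (if sum_list \<gamma> = n \<and> (\<forall>v. 0 < v \<and> v < n \<longrightarrow> (v \<notin> set_of_comp \<gamma>) = h) then 1 else 0)"
    by (auto simp: trunc_fund_def fund_def)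
  also have "sum_list \<gamma> = n \<and> (\<forall>v. 0 < v \<and> v < n \<longrightarrow> (v \<notin> set_of_comp \<gamma>) = h) \<longleftrightarrow> \<gamma> = strip_comp h n"
    (is "?l \<longleftrightarrow> _")
  proof
    assume l: ?l
    have "v \<in> set_of_comp \<gamma> \<longleftrightarrow> v \<in> set_of_comp (strip_comp h n)" for v
    proof (cases "1 \<le> v \<and> v < n")
      case True
      then show ?thesis using l set_of_comp_strip_comp[of v n h] by auto
    next
      case False
      then show ?thesis
        using l set_of_comp_subset[OF \<gamma>] set_of_comp_subset[OF strip_comp_compositions[of h n]]
          sum_list_strip_comp[of h n] by auto
    qed
    then show "\<gamma> = strip_comp h n"
      using l \<gamma> by (intro set_of_comp_inj) (auto simp: strip_comp_compositions sum_list_strip_comp)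
  qed (auto simp: sum_list_strip_comp set_of_comp_strip_comp)
  finally show ?thesis .
qed

text \<open>The degree of the right factor fixes the cut at N - n, so at most one splitting
  contributes. The pattern of descents above the cut decides whether it does.\<close>

lemma sum_deconcat_strip_comp:
  assumes \<alpha>: "\<alpha> \<in> compositions"
  shows "(\<Sum>(\<beta>, \<gamma>)\<in>deconcat \<alpha>. fundamental \<beta> m * (if \<gamma> = strip_comp h n then 1 else 0))
    = trunc_fund h n (sum_list \<alpha>) (set_of_comp \<alpha>) m"
proof -
  define N D where "N = sum_list \<alpha>" and "D = set_of_comp \<alpha>"
  have D: "D \<subseteq> {1..<N}" using set_of_comp_subset[OF \<alpha>] by (simp add: N_def D_def)
  define c where "c = strip_comp h n"
  define \<beta>0 where "\<beta>0 = comp_of_set (N - n) (D \<inter> {..<N - n})"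
  have \<beta>0: "\<beta>0 \<in> compositions" "sum_list \<beta>0 = N - n" "set_of_comp \<beta>0 = D \<inter> {..<N - n}"
  proof -
    have "D \<inter> {..<N - n} \<subseteq> {1..<N - n}" using D by auto
    from comp_of_set[OF this] show "\<beta>0 \<in> compositions" "sum_list \<beta>0 = N - n"
      "set_of_comp \<beta>0 = D \<inter> {..<N - n}" by (simp_all add: \<beta>0_def)
  qed
  define C where "C \<longleftrightarrow> n \<le> N \<and> (\<forall>v. N - n < v \<and> v < N \<longrightarrow> (v \<notin> D) = h)"
  have c: "c \<in> compositions" "sum_list c = n" "set_of_comp c \<subseteq> {1..<n}"
    using set_of_comp_subset[of c] by (auto simp: c_def strip_comp_compositions sum_list_strip_comp)
  have fin: "finite (deconcat \<alpha>)"
  proof (rule finite_subset)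
    show "deconcat \<alpha> \<subseteq> {\<beta> \<in> compositions. sum_list \<beta> \<le> N} \<times> {\<gamma> \<in> compositions. sum_list \<gamma> \<le> N}"
    proof (rule subrelI)
      fix \<beta> \<gamma> assume *: "(\<beta>, \<gamma>) \<in> deconcat \<alpha>"
      then have "\<beta> \<in> compositions" "\<gamma> \<in> compositions" by (auto simp: deconcat_def)
      then show "(\<beta>, \<gamma>) \<in> {\<beta> \<in> compositions. sum_list \<beta> \<le> N} \<times> {\<gamma> \<in> compositions. sum_list \<gamma> \<le> N}"
        using * deconcat_iff[OF \<alpha>, of \<beta> \<gamma>] by (auto simp: N_def)
    qed
  qed (intro finite_cartesian_product finite_compositions_le)
  have pattern: "(\<forall>v. 1 \<le> v \<longrightarrow> v \<in> set_of_comp c \<longleftrightarrow> N - n + v \<in> D) \<longleftrightarrow>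
      (\<forall>v. N - n < v \<and> v < N \<longrightarrow> (v \<notin> D) = h)" if n: "n \<le> N"
  proof
    assume *: "\<forall>v. 1 \<le> v \<longrightarrow> v \<in> set_of_comp c \<longleftrightarrow> N - n + v \<in> D"
    show "\<forall>v. N - n < v \<and> v < N \<longrightarrow> (v \<notin> D) = h"
    proof (intro allI impI)
      fix v assume v: "N - n < v \<and> v < N"
      then have "1 \<le> v - (N - n)" "v - (N - n) < n" "N - n + (v - (N - n)) = v" using n by auto
      then show "(v \<notin> D) = h" using *[rule_format, of "v - (N - n)"] set_of_comp_strip_comp c_def by metis
    qed
  next
    assume *: "\<forall>v. N - n < v \<and> v < N \<longrightarrow> (v \<notin> D) = h"
    show "\<forall>v. 1 \<le> v \<longrightarrow> v \<in> set_of_comp c \<longleftrightarrow> N - n + v \<in> D"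
    proof (intro allI impI)
      fix v :: nat assume v: "1 \<le> v"
      show "v \<in> set_of_comp c \<longleftrightarrow> N - n + v \<in> D"
      proof (cases "v < n")
        case True
        have "(N - n + v \<notin> D) = h" by (rule *[rule_format]) (use True v n in auto)
        then show ?thesis using set_of_comp_strip_comp[OF v True, of h] c_def by auto
      next
        case False
        then have "\<not> N - n + v < N" using n by simp
        then have "v \<notin> set_of_comp c" "N - n + v \<notin> D" using c(3) D False by force+
        then show ?thesis by simp
      qed
    qed
  qed
  have "(\<beta>, c) \<in> deconcat \<alpha> \<longleftrightarrow> C \<and> \<beta> = \<beta>0" for \<beta>
  proof (cases "\<beta> \<in> compositions")
    case True
    have "(\<beta>, c) \<in> deconcat \<alpha> \<longleftrightarrow> sum_list \<beta> + n = N \<and> set_of_comp \<beta> = D \<inter> {..<sum_list \<beta>} \<and>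
        (\<forall>v. 1 \<le> v \<longrightarrow> v \<in> set_of_comp c \<longleftrightarrow> sum_list \<beta> + v \<in> D)"
      using deconcat_iff[OF \<alpha> True c(1)] c(2) by (simp add: N_def D_def)
    also have "\<dots> \<longleftrightarrow> n \<le> N \<and> sum_list \<beta> = N - n \<and> set_of_comp \<beta> = D \<inter> {..<N - n} \<and>
        (\<forall>v. 1 \<le> v \<longrightarrow> v \<in> set_of_comp c \<longleftrightarrow> N - n + v \<in> D)"
      by (auto simp: eq_diff_iff)
    also have "\<dots> \<longleftrightarrow> C \<and> sum_list \<beta> = N - n \<and> set_of_comp \<beta> = D \<inter> {..<N - n}"
      using pattern by (auto simp: C_def)
    also have "\<dots> \<longleftrightarrow> C \<and> \<beta> = \<beta>0"
      using set_of_comp_inj[OF True \<beta>0(1)] \<beta>0 by auto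
    finally show ?thesis .
  next
    case False
    then show ?thesis using \<beta>0 by (auto simp: deconcat_def)
  qed
  then have set: "{p \<in> deconcat \<alpha>. snd p = c} = (if C then {(\<beta>0, c)} else {})" by force
  have "(\<Sum>(\<beta>, \<gamma>)\<in>deconcat \<alpha>. fundamental \<beta> m * (if \<gamma> = c then 1 else 0))
      = (\<Sum>p\<in>deconcat \<alpha>. if snd p = c then fundamental (fst p) m else 0)"
    by (auto intro!: sum.cong)
  also have "\<dots> = (\<Sum>p | p \<in> deconcat \<alpha> \<and> snd p = c. fundamental (fst p) m)"
    using fin by (simp add: sum.inter_filter)
  also have "\<dots> = (if C then fundamental \<beta>0 m else 0)" unfolding set by simp
  also have "\<dots> = trunc_fund h n N D m"
    unfolding trunc_fund_def C_def[symmetric] using fundamental_eq[OF \<beta>0(1)] \<beta>0 by simp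
  finally show ?thesis by (simp add: c_def N_def D_def)
qed

text \<open>In the coproduct of f, the second functional annihilates every fundamental right factor
  except F_(n) or F_(1^n). What it leaves is computed coefficient by coefficient in the first
  alphabet.\<close>

lemma nsym_mult_strip_comp:
  assumes s: "s \<in> NSym" and f: "f \<in> QSym"
  shows "nsym_mult s (nschur (strip_comp h n)) f = s (trunc h n f)"
proof -
  define t where "t = nschur (strip_comp h n)"
  define K where "K = {\<alpha>. \<alpha> \<in> compositions \<and> fundamental_coeff f \<alpha> \<noteq> 0}"
  have t: "linear_on_QSym t" unfolding t_def by (rule linear_nschur[OF strip_comp_compositions])
  have comps: "p \<in> deconcat \<alpha> \<Longrightarrow> fst p \<in> compositions \<and> snd p \<in> compositions" for p \<alpha>
    by (auto simp: deconcat_def)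
  have "t (\<lambda>m'. qsym_coproduct f (m, m')) = trunc h n f m" for m
  proof -
    have inner: "(\<Sum>p\<in>deconcat \<alpha>. cscale (fundamental (fst p) m) (fundamental (snd p))) \<in> QSym" for \<alpha>
      using comps by (intro QSym_sum QSym_scale fundamental.in_QSym) blast
    have "(\<lambda>m'. qsym_coproduct f (m, m')) = (\<Sum>\<alpha>\<in>K. cscale (fundamental_coeff f \<alpha>)
        (\<Sum>p\<in>deconcat \<alpha>. cscale (fundamental (fst p) m) (fundamental (snd p))))"
      by (auto simp: fun_eq_iff qsym_coproduct_def K_def sum_apply tensor_def case_prod_unfold)
    then have "t (\<lambda>m'. qsym_coproduct f (m, m')) = (\<Sum>\<alpha>\<in>K. fundamental_coeff f \<alpha> *
        t (\<Sum>p\<in>deconcat \<alpha>. cscale (fundamental (fst p) m) (fundamental (snd p))))"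
      using linear_on_QSym_scale_sum[OF t inner] by simp
    also have "\<dots> = (\<Sum>\<alpha>\<in>K. fundamental_coeff f \<alpha> *
        (\<Sum>p\<in>deconcat \<alpha>. fundamental (fst p) m * t (fundamental (snd p))))"
      using linear_on_QSym_scale_sum[OF t, of "deconcat _" "\<lambda>p. fundamental (snd p)"]
        comps fundamental.in_QSym by simp
    also have "\<dots> = (\<Sum>\<alpha>\<in>K. fundamental_coeff f \<alpha> *
        (\<Sum>(\<beta>, \<gamma>)\<in>deconcat \<alpha>. fundamental \<beta> m * (if \<gamma> = strip_comp h n then 1 else 0)))"
      using comps by (intro sum.cong refl arg_cong2[where f = "(*)"])
        (auto simp: t_def nschur_strip_comp_fundamental case_prod_unfold)
    also have "\<dots> = trunc h n f m"
      by (simp add: trunc_def fundamental.extend_def K_def fundamental_coeff_eq sum_deconcat_strip_comp)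
    finally show ?thesis .
  qed
  then show ?thesis using f by (simp add: nsym_mult_def tensor_pairing_def t_def)
qed

text \<open>The right Pieri rule in dual form: by \<open>nsym_mult_strip_comp\<close> the right-hand
  side is the value at f of the product of \<open>nschur \<alpha>\<close> and
  \<open>nschur (strip_comp h n)\<close>. On the quasisymmetric Schur function of \<gamma>, each
  side tests whether a strip leads from \<alpha> to \<gamma>.\<close>

lemma sum_nschur_strip:
  assumes \<alpha>: "\<alpha> \<in> compositions" and f: "f \<in> QSym"
  shows "(\<Sum>\<beta> | \<beta> \<in> compositions \<and> strip h n \<alpha> \<beta>. nschur \<beta> f) = nschur \<alpha> (trunc h n f)"
proof (rule qschur.eqI[OF _ linear_trunc[OF linear_nschur[OF \<alpha>]] _ f])
  show "linear_on_QSym (\<lambda>f. \<Sum>\<beta> | \<beta> \<in> compositions \<and> strip h n \<alpha> \<beta>. nschur \<beta> f)"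
    using linear_nschur
    by (auto simp: linear_on_QSym_def sum.distrib[symmetric] sum_distrib_left intro!: sum.cong)
  fix \<gamma> assume \<gamma>: "\<gamma> \<in> compositions"
  have "nschur \<alpha> (trunc h n (qschur \<gamma>)) = (\<Sum>\<delta> | \<delta> \<in> compositions \<and> strip h n \<delta> \<gamma>. nschur \<alpha> (qschur \<delta>))"
    unfolding trunc_qschur[OF \<gamma>]
    by (rule linear_on_QSym_sum[OF linear_nschur[OF \<alpha>]]) (auto simp: qschur.in_QSym)
  also have "\<dots> = (\<Sum>\<delta> | \<delta> \<in> compositions \<and> strip h n \<delta> \<gamma>. if \<delta> = \<alpha> then 1 else 0)"
    using \<alpha> by (intro sum.cong) (auto simp: nschur_qschur)
  also have "\<dots> = (if strip h n \<alpha> \<gamma> then 1 else 0)"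
    using finite_strip_source \<alpha> by (simp add: sum.delta)
  also have "\<dots> = (\<Sum>\<beta> | \<beta> \<in> compositions \<and> strip h n \<alpha> \<beta>. if \<beta> = \<gamma> then 1 else 0)"
    using finite_strip_target[OF \<alpha>] \<gamma> by (simp add: sum.delta)
  also have "\<dots> = (\<Sum>\<beta> | \<beta> \<in> compositions \<and> strip h n \<alpha> \<beta>. nschur \<beta> (qschur \<gamma>))"
    using \<gamma> by (intro sum.cong) (auto simp: nschur_qschur)
  finally show "(\<Sum>\<beta> | \<beta> \<in> compositions \<and> strip h n \<alpha> \<beta>. nschur \<beta> (qschur \<gamma>))
      = nschur \<alpha> (trunc h n (qschur \<gamma>))" by simp
qed

text \<open>Evaluated at g, the right-hand side is \<open>nschur \<alpha>\<close> of the alternating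
  sum in \<open>trunc_alternating_mult\<close>: strips added to \<alpha> become the outer truncation
  by \<open>sum_nschur_strip\<close>, and strips removed from \<beta> the inner one by
  \<open>trunc_qschur\<close>.\<close>

lemma skew_pieri:
  assumes \<alpha>: "\<alpha> \<in> compositions" and \<beta>: "\<beta> \<in> compositions"
  shows "nsym_mult (skew_nschur \<alpha> \<beta>) (nschur (strip_comp h n)) =
    (\<Sum>(i, j, \<alpha>p, \<beta>m) \<in> {(i, j, \<alpha>p, \<beta>m). i + j = n \<and>
        \<alpha>p \<in> compositions \<and> \<beta>m \<in> compositions \<and> strip h i \<alpha> \<alpha>p \<and> strip (\<not> h) j \<beta>m \<beta>}.
      cscale ((-1) ^ j) (skew_nschur \<alpha>p \<beta>m))"
proof
  let ?S = "{(i, j, \<alpha>p, \<beta>m). i + j = n \<and> \<alpha>p \<in> compositions \<and> \<beta>m \<in> compositions \<and>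
      strip h i \<alpha> \<alpha>p \<and> strip (\<not> h) j \<beta>m \<beta>}"
  fix g
  define A where "A i = {\<alpha>p \<in> compositions. strip h i \<alpha> \<alpha>p}" for i
  define B where "B j = {\<beta>m \<in> compositions. strip (\<not> h) j \<beta>m \<beta>}" for j
  have fin: "finite (A i)" "finite (B i)" for i
    using finite_strip_target[OF \<alpha>] finite_strip_source by (auto simp: A_def B_def)
  have "(\<Sum>(i, j, \<alpha>p, \<beta>m) \<in> ?S. cscale ((-1) ^ j) (skew_nschur \<alpha>p \<beta>m)) g
      = (\<Sum>(i, j, \<alpha>p, \<beta>m) \<in> ?S. (-1) ^ j * skew_nschur \<alpha>p \<beta>m g)"
    by (auto simp: sum_apply intro!: sum.cong)
  also have "\<dots> = (\<Sum>(j, \<alpha>p, \<beta>m) \<in> (SIGMA j:{..n}. A (n - j) \<times> B j). (-1) ^ j * skew_nschur \<alpha>p \<beta>m g)"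
    by (rule sum.reindex_bij_witness[where i = "\<lambda>(j, \<alpha>p, \<beta>m). (n - j, j, \<alpha>p, \<beta>m)"
          and j = "\<lambda>(i, j, \<alpha>p, \<beta>m). (j, \<alpha>p, \<beta>m)"]) (auto simp: A_def B_def)
  also have "\<dots> = (\<Sum>j\<le>n. \<Sum>(\<alpha>p, \<beta>m)\<in>A (n - j) \<times> B j. (-1) ^ j * skew_nschur \<alpha>p \<beta>m g)"
    using fin by (subst sum.Sigma) auto
  finally have rhs: "(\<Sum>(i, j, \<alpha>p, \<beta>m) \<in> ?S. cscale ((-1) ^ j) (skew_nschur \<alpha>p \<beta>m)) g
      = (\<Sum>j\<le>n. \<Sum>(\<alpha>p, \<beta>m)\<in>A (n - j) \<times> B j. (-1) ^ j * skew_nschur \<alpha>p \<beta>m g)" .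
  have skew: "skew_nschur \<alpha>p \<beta>m g = (if g \<in> QSym then nschur \<alpha>p (pseries_mult g (qschur \<beta>m)) else 0)"
    if "\<alpha>p \<in> A i" "\<beta>m \<in> B j" for \<alpha>p \<beta>m i j
    using that by (simp add: skew_nschur_eq A_def B_def)
  show "nsym_mult (skew_nschur \<alpha> \<beta>) (nschur (strip_comp h n)) g
      = (\<Sum>(i, j, \<alpha>p, \<beta>m) \<in> ?S. cscale ((-1) ^ j) (skew_nschur \<alpha>p \<beta>m)) g"
  proof (cases "g \<in> QSym")
    case False
    then have "(\<Sum>j\<le>n. \<Sum>(\<alpha>p, \<beta>m)\<in>A (n - j) \<times> B j. (-1) ^ j * skew_nschur \<alpha>p \<beta>m g) = 0"
      using skew by (intro sum.neutral ballI) (auto intro!: sum.neutral)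
    then show ?thesis using False rhs by (simp add: nsym_mult_def)
  next
    case g: True
    have mult: "pseries_mult g f \<in> QSym" if "f \<in> QSym" for f using g that by (rule pseries_mult_in_QSym)
    have eq: "(\<Sum>(\<alpha>p, \<beta>m)\<in>A (n - j) \<times> B j. (-1) ^ j * skew_nschur \<alpha>p \<beta>m g)
        = (-1) ^ j * nschur \<alpha> (trunc h (n - j) (pseries_mult g (trunc (\<not> h) j (qschur \<beta>))))" for j
    proof -
      define X where "X = trunc (\<not> h) j (qschur \<beta>)"
      have X: "X = (\<Sum>\<beta>m\<in>B j. qschur \<beta>m)" by (simp add: X_def trunc_qschur[OF \<beta>] B_def)
      have "(\<Sum>(\<alpha>p, \<beta>m)\<in>A (n - j) \<times> B j. (-1) ^ j * skew_nschur \<alpha>p \<beta>m g)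
          = (\<Sum>\<alpha>p\<in>A (n - j). \<Sum>\<beta>m\<in>B j. (-1) ^ j * nschur \<alpha>p (pseries_mult g (qschur \<beta>m)))"
        using skew g by (auto simp: sum.cartesian_product[symmetric] intro!: sum.cong)
      also have "\<dots> = (-1) ^ j * (\<Sum>\<alpha>p\<in>A (n - j). nschur \<alpha>p (pseries_mult g X))"
      proof -
        have "nschur \<alpha>p (pseries_mult g X) = (\<Sum>\<beta>m\<in>B j. nschur \<alpha>p (pseries_mult g (qschur \<beta>m)))"
          if "\<alpha>p \<in> A (n - j)" for \<alpha>p
          unfolding X using that linear_pseries_mult_right[OF linear_nschur g]
          by (intro linear_on_QSym_sum[where s = "\<lambda>f. nschur \<alpha>p (pseries_mult g f)"])
            (auto simp: A_def B_def qschur.in_QSym)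
        then show ?thesis by (simp add: sum_distrib_left)
      qed
      also have "\<dots> = (-1) ^ j * nschur \<alpha> (trunc h (n - j) (pseries_mult g X))"
        using sum_nschur_strip[OF \<alpha> mult, of X h "n - j"] by (simp add: A_def X_def trunc_in_QSym)
      finally show ?thesis by (simp add: X_def)
    qed
    have "(\<Sum>j\<le>n. (-1) ^ j * nschur \<alpha> (trunc h (n - j) (pseries_mult g (trunc (\<not> h) j (qschur \<beta>)))))
        = nschur \<alpha> (\<Sum>j\<le>n. cscale ((-1) ^ j) (trunc h (n - j) (pseries_mult g (trunc (\<not> h) j (qschur \<beta>)))))"
      by (rule linear_on_QSym_scale_sum[OF linear_nschur[OF \<alpha>], symmetric]) (rule trunc_in_QSym)
    also have "(\<Sum>j\<le>n. cscale ((-1) ^ j) (trunc h (n - j) (pseries_mult g (trunc (\<not> h) j (qschur \<beta>)))))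
        = pseries_mult (trunc h n g) (qschur \<beta>)"
      using trunc_alternating_mult[OF qschur.in_QSym[OF \<beta>] g] by (simp add: fun_eq_iff sum_apply)
    also have "nschur \<alpha> (pseries_mult (trunc h n g) (qschur \<beta>)) = skew_nschur \<alpha> \<beta> (trunc h n g)"
      by (simp add: skew_nschur_eq[OF \<alpha> \<beta>] trunc_in_QSym)
    also have "\<dots> = nsym_mult (skew_nschur \<alpha> \<beta>) (nschur (strip_comp h n)) g"
      by (rule nsym_mult_strip_comp[OF skew_nschur_in_NSym[OF \<alpha> \<beta>] g, symmetric])
    finally show ?thesis using rhs eq by simp
  qed
qed

theorem theorem4p9:
  fixes \<alpha> \<beta> :: "nat list" and n :: nat
  assumes "\<alpha> \<in> compositions" and "\<beta> \<in> compositions" and "1 \<le> n"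
  shows "nsym_mult (skew_nschur \<alpha> \<beta>) (nschur [n]) =
           (\<Sum>(i, j, \<alpha>p, \<beta>m) \<in> {(i, j, \<alpha>p, \<beta>m). i + j = n \<and>
                \<alpha>p \<in> compositions \<and> \<beta>m \<in> compositions \<and>
                right_horizontal_strip i \<alpha> \<alpha>p \<and> right_vertical_strip j \<beta>m \<beta>}.
              cscale ((-1) ^ j) (skew_nschur \<alpha>p \<beta>m)) \<and>
         nsym_mult (skew_nschur \<alpha> \<beta>) (nschur (replicate n 1)) =
           (\<Sum>(i, j, \<alpha>p, \<beta>m) \<in> {(i, j, \<alpha>p, \<beta>m). i + j = n \<and>
                \<alpha>p \<in> compositions \<and> \<beta>m \<in> compositions \<and>
                right_vertical_strip i \<alpha> \<alpha>p \<and> right_horizontal_strip j \<beta>m \<beta>}.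
              cscale ((-1) ^ j) (skew_nschur \<alpha>p \<beta>m))"
proof -
  have sets: "{(i, j, \<alpha>p, \<beta>m). i + j = n \<and> \<alpha>p \<in> compositions \<and> \<beta>m \<in> compositions \<and>
      right_horizontal_strip i \<alpha> \<alpha>p \<and> right_vertical_strip j \<beta>m \<beta>}
    = {(i, j, \<alpha>p, \<beta>m). i + j = n \<and> \<alpha>p \<in> compositions \<and> \<beta>m \<in> compositions \<and>
      strip True i \<alpha> \<alpha>p \<and> strip (\<not> True) j \<beta>m \<beta>}"
    "{(i, j, \<alpha>p, \<beta>m). i + j = n \<and> \<alpha>p \<in> compositions \<and> \<beta>m \<in> compositions \<and>
      right_vertical_strip i \<alpha> \<alpha>p \<and> right_horizontal_strip j \<beta>m \<beta>}
    = {(i, j, \<alpha>p, \<beta>m). i + j = n \<and> \<alpha>p \<in> compositions \<and> \<beta>m \<in> compositions \<and>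
      strip False i \<alpha> \<alpha>p \<and> strip (\<not> False) j \<beta>m \<beta>}"
    using assms(1) by (auto simp: right_strip_eq)
  \<comment> \<open>Since n is positive, \<open>strip_comp\<close> is outside its degenerate
    case.\<close>
  have comps: "[n] = strip_comp True n" "replicate n 1 = strip_comp False n"
    using assms(3) by (auto simp: strip_comp_def)
  show ?thesis
    unfolding sets comps
    using skew_pieri[OF assms(1,2), of True n] skew_pieri[OF assms(1,2), of False n] by (rule conjI)
qed

end
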